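(* Let $\mathcal{G}$ be a weight-balanced, strongly connected digraph on $N$ nodes with adjacency matrix $[a_{ij}]$. Let $H\in\mathbb{R}^{N\times m}$ have full column rank and rows $H_1,\dots,H_N$, let $z=[z_1,\dots,z_N]^\top\in\mathbb{R}^N$, and let $y^*=(H^\top H)^{-1}H^\top z$ be the least squares solution of $z=Hy$. Suppose the measurement available at node $i$ is $\tilde z_i(t)=z_i+\varepsilon_i(t)+w_i(t)$, where $\varepsilon_i(t)=\sum_{j=1}^{k_i}A_{ij}\sin(\omega_{ij}t+\phi_{ij})$ with $A_{ij}\neq 0$, $\phi_{ij}\in\mathbb{R}$, and distinct frequencies $\omega_{i1},\dots,\omega_{ik_i}>0$ for each $i$ (amplitudes, phases and frequencies being unknown), and $w(t)=[w_1(t),\dots,w_N(t)]^\top$ is a bounded unstructured disturbance. Let $\ell>0$, $\kappa_1\ge 1$ and $\kappa_2\ge \frac{6N\bar\lambda^4\kappa_1^2}{\underline{\lambda}^4}\max\{1,\frac{1}{\underline{\lambda}}\}$, with $\underline\lambda,\bar\lambda$ as defined in the context. Consider, for $i=1,\dots,N$, the distributed solver $$\dot x_i=-\kappa_1H_i^\top\big[H_ix_i-\tilde z_i+D_{i0}\check T_i^{-1}\tilde\eta_i\big]-(\kappa_1+\kappa_2)\sum_{j=1}^Na_{ij}(x_i-x_j)-\sum_{j=1}^Na_{ij}(v_i-v_j),$$ $$\dot v_i=\kappa_1\kappa_2\sum_{j=1}^Na_{ij}(x_i-x_j),\qquad \dot{\tilde\eta}_i=\tilde S_i\tilde\eta_i+B_i\tilde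 z_i,\qquad \dot{\hat\alpha}_i=\ell\, e_i\,\tilde\eta_{oi},$$ with $x_i,v_i\in\mathbb{R}^m$, $\tilde\eta_i\in\mathbb{R}^{2k_i+1}$, $\hat\alpha_i\in\mathbb{R}^{k_i}$, and with $D_{i0},\check T_i,\tilde S_i,B_i,e_i,\tilde\eta_{oi}$ as defined in the context. Then, for any initial point $x_i(0),v_i(0),\tilde\eta_i(0),\hat\alpha_i(0)$, $i=1,\dots,N$, there are constants $\gamma>0$ and $\delta>0$, not depending on $w$, such that along the trajectory of this system (the frequency estimates being well defined as in the context), for every $i$, $$\int_0^\infty|x_i(t)-y^*|^2\,\mathrm{d}t\le\gamma\int_0^\infty|w(t)|^2\,\mathrm{d}t+\delta .$$
   Context: Digraph: nodes $\{1,\dots,N\}$, weights $a_{ii}=0$, $a_{ij}\ge 0$, and $a_{ij}>0$ iff there is an edge from $j$ to $i$. Weight-balanced: $\sum_ja_{ij}=\sum_ja_{ji}$ for every $i$. The Laplacian is $L=\mathrm{diag}(\sum_ja_{1j},\dots,\sum_ja_{Nj})-[a_{ij}]$, and $\mathrm{Sym}(L)=(L+L^\top)/2$ has eigenvalues $0=\lambda_1<\lambda_2\le\dots\le\lambda_N$. Let $\lambda_h,\lambda_H$ be the minimal and maximal eigenvalues of $H^\top H$, and put $\underline\lambda=\min\{\lambda_2,\lambda_h\}$, $\bar\lambda=\max\{\lambda_N,\lambda_H\}$. Filter: $\tilde S_i=\begin{bmatrix}\mathbf 0& I_{2k_i}\\ -\tilde\beta_{i0}&\tilde{\mathbf p}_i\end{bmatrix}\in\mathbb{R}^{(2k_i+1)\times(2k_i+1)}$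 with $\tilde{\mathbf p}_i=-[\tilde\alpha_{i1}\ \tilde\beta_{i1}\ \cdots\ \tilde\alpha_{ik_i}\ \tilde\beta_{ik_i}]$, where the constants $\tilde\alpha_{ij},\tilde\beta_{ij}$ are chosen so that $\tilde S_i$ is Hurwitz, and $B_i=[0,\dots,0,1]^\top\in\mathbb{R}^{2k_i+1}$. Identifier: $\hat\alpha_i=[\hat\alpha_{i1},\dots,\hat\alpha_{ik_i}]^\top$ estimates $\alpha_i=[\alpha_{i1},\dots,\alpha_{ik_i}]^\top$ defined by $\prod_{j=1}^{k_i}(s^2+\omega_{ij}^2)=s^{2k_i}+\alpha_{ik_i}s^{2k_i-2}+\dots+\alpha_{i2}s^2+\alpha_{i1}$. Write $\tilde\eta_i=[\tilde\eta_{i1},\dots,\tilde\eta_{i(2k_i+1)}]^\top$ and $\tilde\eta_{oi}=[\tilde\eta_{i2},\tilde\eta_{i4},\dots,\tilde\eta_{i(2k_i)}]^\top\in\mathbb{R}^{k_i}$. The identifier output is $\hat z_{oi}=[\tilde\beta_{i0}\ \ \tilde\alpha_{i1}-\hat\alpha_{i1}\ \ \tilde\beta_{i1}\ \cdots\ \tilde\alpha_{ik_i}-\hat\alpha_{ik_i}\ \ \tilde\beta_{ik_i}]\,\tilde\eta_i$ and the identifier error is $e_i=\hat z_{oi}-\tilde z_i$. Compensator: the frequency estimates $\hat\omega_{i1}(t),\dots,\hat\omega_{ik_i}(t)$ are obtained from $\hat\alpha_i(t)$ by $\prod_{j=1}^{k_i}(s^2+\hat\omega_{ij}^2)=s^{2k_i}+\hat\alpha_{ik_i}s^{2k_i-2}+\dots+\hat\alpha_{i2}s^2+\hat\alpha_{i1}$.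 It is a standing convention that they are well defined, positive and pairwise distinct (for each $i$) at all $t\ge 0$, labelled consistently with $\omega_{i1},\dots,\omega_{ik_i}$ (e.g. both in increasing order). Set $\check S_i(t)=\mathrm{blkdiag}\left(0,\begin{bmatrix}0&\hat\omega_{i1}\\-\hat\omega_{i1}&0\end{bmatrix},\dots,\begin{bmatrix}0&\hat\omega_{ik_i}\\-\hat\omega_{ik_i}&0\end{bmatrix}\right)$, $D_i=[1\ \ 1\ 0\ \ 1\ 0\ \cdots\ 1\ 0]$ and $D_{i0}=[0\ \ 1\ 0\ \ 1\ 0\ \cdots\ 1\ 0]$, both in $\mathbb{R}^{1\times(2k_i+1)}$. Then $\check T_i=\check T_i(t)$ is the unique (invertible) solution of the Sylvester equation $\check T_i\check S_i-\tilde S_i\check T_i=B_iD_i$.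
   Formalization: The frequency estimates are assumed to stay above some fixed bound μ>0 for all t≥0 (not merely positive), and γ, δ may depend on μ but not on w; with mere positivity, disturbances of bounded energy can drive an estimate near 0 and no uniform γ, δ exist. *)

theory Defs
  imports
    "HOL-Analysis.Analysis"
    "Jordan_Normal_Form.Char_Poly"
    "Jordan_Normal_Form.Gauss_Jordan_Elimination"
begin

text \<open>
  Objects indexed by the nodes and the least squares variable use the finite types
  \<open>'n\<close> and \<open>'m\<close>. The filter of node \<open>i\<close> lives in dimension \<open>2 * k i + 1\<close>, which varies with
  the node, so it uses the carrier-based matrices of \<open>Jordan_Normal_Form\<close>. Those have indices
  starting at 0, whereas scalar families such as \<open>\<omega> i j\<close> are indexed by \<open>j \<in> {1..k i}\<close>.
\<close>

no_notation Matrix.vec_index (infixl \<open>$\<close> 100)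
no_notation Matrix.scalar_prod (infix \<open>\<bullet>\<close> 70)

section \<open>Graph and spectral quantities\<close>

definition edges :: "real^'n^'n \<Rightarrow> ('n \<times> 'n) set" where
  "edges a = {(j, i). a $ i $ j > 0}"

definition adjacency_matrix :: "real^'n^'n \<Rightarrow> bool" where
  "adjacency_matrix a \<longleftrightarrow> (\<forall>i. a $ i $ i = 0) \<and> (\<forall>i j. a $ i $ j \<ge> 0)"

definition weight_balanced :: "real^'n^'n \<Rightarrow> bool" where
  "weight_balanced a \<longleftrightarrow> (\<forall>i. (\<Sum>j\<in>UNIV. a $ i $ j) = (\<Sum>j\<in>UNIV. a $ j $ i))"

definition strongly_connected :: "real^'n^'n \<Rightarrow> bool" where
  "strongly_connected a \<longleftrightarrow> (\<forall>i j. (i, j) \<in> (edges a)\<^sup>*)"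

definition laplacian :: "real^'n^'n \<Rightarrow> real^'n^'n" where
  "laplacian a = (\<chi> i j. (if i = j then \<Sum>l\<in>UNIV. a $ i $ l else 0) - a $ i $ j)"

definition sym_part :: "real^'n^'n \<Rightarrow> real^'n^'n" where
  "sym_part A = (1 / 2) *\<^sub>R (A + transpose A)"

text \<open>
  The increasing list of real eigenvalues, repeated according to the dimension of the
  eigenspace. It is only used for symmetric matrices, where this is the algebraic multiplicity
  and the list has as many entries as the matrix has rows.
\<close>

definition eigenvalues :: "real^'n^'n \<Rightarrow> real list" where
  "eigenvalues A =
     (THE ls. sorted ls \<and> (\<forall>l. count_list ls l = dim {u. A *v u = l *\<^sub>R u}))"

definition lambda_lower :: "real^'n^'n \<Rightarrow> real^'m^'n \<Rightarrow> real" where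
  "lambda_lower a H =
     min (eigenvalues (sym_part (laplacian a)) ! 1) (hd (eigenvalues (transpose H ** H)))"

definition lambda_upper :: "real^'n^'n \<Rightarrow> real^'m^'n \<Rightarrow> real" where
  "lambda_upper a H =
     max (last (eigenvalues (sym_part (laplacian a)))) (last (eigenvalues (transpose H ** H)))"

definition least_squares :: "real^'m^'n \<Rightarrow> real^'n \<Rightarrow> real^'m" where
  "least_squares H z = matrix_inv (transpose H ** H) *v (transpose H *v z)"

section \<open>Filter, identifier and compensator of a single node\<close>

text \<open>Entry \<open>q\<close> (from 0) of the row \<open>[b 0, c 1, b 1, \<dots>, c k, b k]\<close>.\<close>

definition interleave :: "(nat \<Rightarrow> real) \<Rightarrow> (nat \<Rightarrow> real) \<Rightarrow> nat \<Rightarrow> real" where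
  "interleave b c q = (if odd q then c (Suc q div 2) else b (q div 2))"

definition filter_matrix :: "nat \<Rightarrow> (nat \<Rightarrow> real) \<Rightarrow> (nat \<Rightarrow> real) \<Rightarrow> real Matrix.mat" where
  "filter_matrix k \<alpha>f \<beta>f = Matrix.mat (2 * k + 1) (2 * k + 1)
     (\<lambda>(p, q). if p < 2 * k then (if q = Suc p then 1 else 0) else - interleave \<beta>f \<alpha>f q)"

definition filter_input :: "nat \<Rightarrow> real Matrix.vec" where
  "filter_input k = unit_vec (2 * k + 1) (2 * k)"

definition hurwitz :: "real Matrix.mat \<Rightarrow> bool" where
  "hurwitz S \<longleftrightarrow> (\<forall>c. eigenvalue (map_mat complex_of_real S) c \<longrightarrow> Re c < 0)"

definition identifier_error ::
  "nat \<Rightarrow> (nat \<Rightarrow> real) \<Rightarrow> (nat \<Rightarrow> real) \<Rightarrow> (nat \<Rightarrow> real) \<Rightarrow> real Matrix.vec \<Rightarrow> real \<Rightarrow> real" where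
  "identifier_error k \<alpha>f \<beta>f \<alpha>h \<eta> y =
     Matrix.scalar_prod (Matrix.vec (2 * k + 1) (interleave \<beta>f (\<lambda>j. \<alpha>f j - \<alpha>h j))) \<eta> - y"

definition compensator_matrix :: "nat \<Rightarrow> (nat \<Rightarrow> real) \<Rightarrow> real Matrix.mat" where
  "compensator_matrix k \<omega>h = diag_block_mat
     (0\<^sub>m 1 1 # map (\<lambda>j. mat_of_rows_list 2 [[0, \<omega>h j], [- \<omega>h j, 0]]) [1..<Suc k])"

definition output_row :: "nat \<Rightarrow> real Matrix.vec" where
  "output_row k = Matrix.vec (2 * k + 1) (\<lambda>q. if q = 0 \<or> odd q then 1 else 0)"

definition output_row0 :: "nat \<Rightarrow> real Matrix.vec" where
  "output_row0 k = Matrix.vec (2 * k + 1) (\<lambda>q. if odd q then 1 else 0)"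

definition sylvester_solution ::
  "nat \<Rightarrow> (nat \<Rightarrow> real) \<Rightarrow> (nat \<Rightarrow> real) \<Rightarrow> (nat \<Rightarrow> real) \<Rightarrow> real Matrix.mat" where
  "sylvester_solution k \<alpha>f \<beta>f \<omega>h =
     (THE T. T \<in> carrier_mat (2 * k + 1) (2 * k + 1) \<and>
        T * compensator_matrix k \<omega>h - filter_matrix k \<alpha>f \<beta>f * T =
        mat_of_cols (2 * k + 1) [filter_input k] * mat_of_rows (2 * k + 1) [output_row k])"

definition compensation ::
  "nat \<Rightarrow> (nat \<Rightarrow> real) \<Rightarrow> (nat \<Rightarrow> real) \<Rightarrow> (nat \<Rightarrow> real) \<Rightarrow> real Matrix.vec \<Rightarrow> real" where
  "compensation k \<alpha>f \<beta>f \<omega>h \<eta> =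
     Matrix.scalar_prod (output_row0 k)
       (the (mat_inverse (sylvester_solution k \<alpha>f \<beta>f \<omega>h)) *\<^sub>v \<eta>)"

text \<open>
  The frequency estimates \<open>\<omega>h\<close> are the roots determined by \<open>\<alpha>h\<close>, positive, pairwise distinct
  and ordered like the true frequencies \<open>\<omega>\<close>. Positivity is read uniformly in time, through
  a lower bound \<open>\<mu> > 0\<close>: one has \<open>compensation \<dots> \<eta> = zo - q\<close>, where \<open>zo\<close> is affine in \<open>\<alpha>h\<close> and
  \<open>q = \<beta>f 0 * (\<eta>\<^sub>1 + (\<alpha>h 2 / \<alpha>h 1) * \<eta>\<^sub>3 + \<dots> + (1 / \<alpha>h 1) * \<eta>\<^sub>2\<^sub>k\<^sub>+\<^sub>1)\<close> with
  \<open>\<alpha>h 1 = (\<Prod>j. (\<omega>h j)\<^sup>2)\<close>, and without such a bound disturbances of comparatively small energy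
  can drive \<open>\<alpha>h 1\<close> towards 0, so that no constants are uniform in the disturbance. An upper
  bound, or a positive distance between different estimates, is not required.
\<close>

definition frequency_estimates ::
  "nat \<Rightarrow> (nat \<Rightarrow> real) \<Rightarrow> real \<Rightarrow> (nat \<Rightarrow> real) \<Rightarrow> (nat \<Rightarrow> real) \<Rightarrow> bool" where
  "frequency_estimates k \<omega> \<mu> \<alpha>h \<omega>h \<longleftrightarrow>
     (\<forall>s::real. (\<Prod>j=1..k. s ^ 2 + (\<omega>h j) ^ 2) = s ^ (2 * k) + (\<Sum>j=1..k. \<alpha>h j * s ^ (2 * (j - 1)))) \<and>
     (\<forall>j\<in>{1..k}. \<mu> \<le> \<omega>h j) \<and>
     inj_on \<omega>h {1..k} \<and>
     (\<forall>i\<in>{1..k}. \<forall>j\<in>{1..k}. \<omega>h i < \<omega>h j \<longleftrightarrow> \<omega> i < \<omega> j)"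

section \<open>The closed-loop system\<close>

text \<open>
  Solution on \<open>[0, \<infinity>)\<close> of \<open>x' = f\<close>, \<open>x 0 = x0\<close>, in integrated form, so that discontinuous
  disturbances are admitted. Every classical solution is a solution in this sense.
\<close>

definition solution :: "(real \<Rightarrow> 'a::real_normed_vector) \<Rightarrow> 'a \<Rightarrow> (real \<Rightarrow> 'a) \<Rightarrow> bool" where
  "solution f x0 x \<longleftrightarrow> (\<forall>t\<ge>0. (f has_integral (x t - x0)) {0..t})"

definition structured_disturbance ::
  "nat \<Rightarrow> (nat \<Rightarrow> real) \<Rightarrow> (nat \<Rightarrow> real) \<Rightarrow> (nat \<Rightarrow> real) \<Rightarrow> real \<Rightarrow> real" where
  "structured_disturbance k A \<omega> \<phi> t = (\<Sum>j=1..k. A j * sin (\<omega> j * t + \<phi> j))"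

text \<open>The signal \<open>y i\<close> is the measurement at node \<open>i\<close>.\<close>

definition solver_trajectory ::
  "real^'n^'n \<Rightarrow> real^'m^'n \<Rightarrow> ('n \<Rightarrow> nat) \<Rightarrow> ('n \<Rightarrow> nat \<Rightarrow> real) \<Rightarrow> ('n \<Rightarrow> nat \<Rightarrow> real) \<Rightarrow>
   real \<Rightarrow> real \<Rightarrow> real \<Rightarrow> ('n \<Rightarrow> real \<Rightarrow> real) \<Rightarrow>
   ('n \<Rightarrow> real^'m) \<Rightarrow> ('n \<Rightarrow> real^'m) \<Rightarrow> ('n \<Rightarrow> real Matrix.vec) \<Rightarrow> ('n \<Rightarrow> nat \<Rightarrow> real) \<Rightarrow>
   ('n \<Rightarrow> real \<Rightarrow> real^'m) \<Rightarrow> ('n \<Rightarrow> real \<Rightarrow> real^'m) \<Rightarrow> ('n \<Rightarrow> real \<Rightarrow> real Matrix.vec) \<Rightarrow>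
   ('n \<Rightarrow> real \<Rightarrow> nat \<Rightarrow> real) \<Rightarrow> ('n \<Rightarrow> real \<Rightarrow> nat \<Rightarrow> real) \<Rightarrow> bool" where
  "solver_trajectory a H k \<alpha>f \<beta>f l \<kappa>\<^sub>1 \<kappa>\<^sub>2 y x0 v0 \<eta>0 \<alpha>0 x v \<eta> \<alpha>h \<omega>h \<longleftrightarrow> (\<forall>i.
     solution
       (\<lambda>t. - \<kappa>\<^sub>1 *\<^sub>R ((inner (H $ i) (x i t) - y i t
                      + compensation (k i) (\<alpha>f i) (\<beta>f i) (\<omega>h i t) (\<eta> i t)) *\<^sub>R (H $ i))
            - (\<kappa>\<^sub>1 + \<kappa>\<^sub>2) *\<^sub>R (\<Sum>j\<in>UNIV. a $ i $ j *\<^sub>R (x i t - x j t))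
            - (\<Sum>j\<in>UNIV. a $ i $ j *\<^sub>R (v i t - v j t)))
       (x0 i) (x i) \<and>
     solution
       (\<lambda>t. (\<kappa>\<^sub>1 * \<kappa>\<^sub>2) *\<^sub>R (\<Sum>j\<in>UNIV. a $ i $ j *\<^sub>R (x i t - x j t)))
       (v0 i) (v i) \<and>
     (\<forall>t\<ge>0. \<eta> i t \<in> carrier_vec (2 * k i + 1)) \<and>
     (\<forall>p<2 * k i + 1. solution
       (\<lambda>t. Matrix.vec_index
              (filter_matrix (k i) (\<alpha>f i) (\<beta>f i) *\<^sub>v \<eta> i t + y i t \<cdot>\<^sub>v filter_input (k i)) p)
       (Matrix.vec_index (\<eta>0 i) p) (\<lambda>t. Matrix.vec_index (\<eta> i t) p)) \<and>
     (\<forall>j\<in>{1..k i}. solution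
       (\<lambda>t. l * identifier_error (k i) (\<alpha>f i) (\<beta>f i) (\<alpha>h i t) (\<eta> i t) (y i t)
              * Matrix.vec_index (\<eta> i t) (2 * j - 1))
       (\<alpha>0 i j) (\<lambda>t. \<alpha>h i t j)))"

end

theory Submission
  imports Defs
begin

text \<open>
  The Sylvester solution can be computed blockwise, because the filter matrix is a companion
  matrix: with \<open>p\<close> its characteristic polynomial, the columns belonging to the estimate \<open>\<omega>h j\<close> are
  the real and imaginary parts of \<open>(\<i> \<omega>h j)^q / p (\<i> \<omega>h j)\<close>. It follows that the compensation is
  \<open>y + e - q\<close>, with \<open>e\<close> the identifier error and \<open>q\<close> a combination of the even filter states whose
  coefficients are elementary symmetric functions of the \<open>1 / (\<omega>h j)\<^sup>2\<close>, hence bounded through \<open>\<mu>\<close>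
  alone. So a node sees the disturbance \<open>u = e - (q - z)\<close> only.

  Let \<open>W\<close> be the energy of \<open>w\<close>. The deviation \<open>\<zeta>\<close> of the filter from its steady state and, through
  the Lyapunov function \<open>|\<alpha>h - \<alpha>|\<^sup>2\<close>, the error \<open>e\<close> have energy \<open>O(1 + W)\<close>. The remaining part of
  \<open>q - z\<close> is bounded and also dominated by \<open>|\<alpha>h - \<alpha>|\<close>. A linear estimate in \<open>W\<close> is obtained on windows
  of fixed length: if \<open>\<zeta>\<close> has little energy there, persistence of excitation bounds \<open>|\<alpha>h - \<alpha>|\<close> by
  the local energy of \<open>e\<close>; otherwise the window is charged to the energy of \<open>\<zeta>\<close>.

  The network is a linear system driven by \<open>u\<close>. With \<open>X = x - y*\<close> and \<open>s = (v - v*) + \<kappa>\<^sub>1 X\<close>, the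
  function \<open>|X|\<^sup>2 + \<rho> |s - mean s|\<^sup>2\<close> is dissipated for a suitable \<open>\<rho>\<close>; the nonsymmetric part of the
  Laplacian is controlled by the maximal degree, which is at most the largest eigenvalue of its
  symmetric part. Since the disturbance is only measurable, all derivatives are replaced by
  primitives of locally bounded measurable functions, for which the product rule holds because the
  defect is quadratic in the step length.
\<close>


section \<open>Primitives of locally bounded measurable functions\<close>

text \<open>Filter and identifier of a node depend on its measurement alone and not on
  \<open>x\<close> and \<open>v\<close>. The closed loop is therefore a cascade, and the node
  disturbances can be bounded without any knowledge of the network. All constants have to be fixed
  before the disturbance and the trajectory, so each bound is stated for a whole family of
  trajectories with prescribed initial data and is affine in \<open>W\<close>. The obstacle is the
  parameter error. The Lyapunov function keeps it bounded but does not make it square integrable,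
  and on some stretch of time the disturbance may destroy the excitation of the actual regressor. On
  a window where this happens, \<zeta> spends at least a fixed energy \<theta>, so the number of
  such windows is itself affine in \<open>W\<close>; each of them costs at most its length times a
  bound on \<open>q - z\<close> that does not involve the parameter error. This bound is the place
  where \<mu> enters. On the remaining windows the parameter error is dominated by the energy of
  \<open>e\<close> and of the filter deviation over the same window, and nothing has to be carried
  from one window to the next.\<close>

definition locally_bounded_measurable :: "(real \<Rightarrow> 'a::euclidean_space) \<Rightarrow> bool" where
  "locally_bounded_measurable f \<longleftrightarrow>
     f \<in> borel_measurable (lebesgue_on {0..}) \<and> (\<forall>T. bounded (f ` {0..T}))"

abbreviation "lbm \<equiv> locally_bounded_measurable"

text \<open>A locally bounded density makes \<open>F\<close> locally Lipschitz. The class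
  \<open>lbm\<close> takes the place of mere integrability because it is closed under products,
  which gauge integrable functions are not.\<close>

definition primitive :: "(real \<Rightarrow> 'a::euclidean_space) \<Rightarrow> (real \<Rightarrow> 'a) \<Rightarrow> bool" where
  "primitive f F \<longleftrightarrow> lbm f \<and> (\<forall>t\<ge>0. (f has_integral F t - F 0) {0..t})"

lemma lbm_const: "lbm (\<lambda>t. c)"
  by (auto simp: locally_bounded_measurable_def image_constant_conv)

lemma lbm_add: "lbm f \<Longrightarrow> lbm g \<Longrightarrow> lbm (\<lambda>t. f t + g t)"
  unfolding locally_bounded_measurable_def
  by (intro conjI allI borel_measurable_add bounded_plus_comp) simp_all

lemma lbm_bounded_linear:
  fixes h :: "'a::euclidean_space \<Rightarrow> 'b::euclidean_space"
  assumes "bounded_linear h" "lbm f" shows "lbm (\<lambda>t. h (f t))"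
proof -
  have "h \<in> borel_measurable borel"
    using assms by (intro borel_measurable_continuous_onI linear_continuous_on)
  moreover have "bounded ((\<lambda>t. h (f t)) ` {0..T})" for T
    using bounded_linear_image[OF _ assms(1), of "f ` {0..T}"] assms(2)
    by (auto simp: locally_bounded_measurable_def image_image)
  ultimately show ?thesis
    using assms(2) measurable_compose[of f _ borel h borel]
    by (auto simp: locally_bounded_measurable_def)
qed

lemma lbm_minus: "lbm f \<Longrightarrow> lbm (\<lambda>t. - f t)"
  by (rule lbm_bounded_linear[OF bounded_linear_minus[OF bounded_linear_ident]])

lemma lbm_diff: "lbm f \<Longrightarrow> lbm g \<Longrightarrow> lbm (\<lambda>t. f t - g t)"
  using lbm_add[OF _ lbm_minus, of f g] by simp

lemma lbm_inner:
  assumes "lbm f" "lbm g" shows "lbm (\<lambda>t. inner (f t) (g t))"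
proof -
  have "bounded ((\<lambda>t. inner (f t) (g t)) ` {0..T})" for T
  proof -
    obtain a b where "\<And>t. t \<in> {0..T} \<Longrightarrow> norm (f t) \<le> a" "\<And>t. t \<in> {0..T} \<Longrightarrow> norm (g t) \<le> b"
      using assms unfolding locally_bounded_measurable_def bounded_iff by (metis imageI)
    then have "norm (f t) * norm (g t) \<le> a * b" if "t \<in> {0..T}" for t
      using that by (intro mult_mono) (auto intro: order_trans[OF norm_ge_zero])
    then have "norm (inner (f t) (g t)) \<le> a * b" if "t \<in> {0..T}" for t
      using that Cauchy_Schwarz_ineq2[of "f t" "g t"] by fastforce
    then show ?thesis unfolding bounded_iff by blast
  qed
  then show ?thesis using assms by (auto simp: locally_bounded_measurable_def)
qed

lemma lbm_mult: "lbm f \<Longrightarrow> lbm g \<Longrightarrow> lbm (\<lambda>t. f t * g t :: real)"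
  using lbm_inner[of f g] by simp

lemma lbm_power2: "lbm f \<Longrightarrow> lbm (\<lambda>t. (f t)\<^sup>2 :: real)"
  by (simp add: power2_eq_square lbm_mult)

lemma lbm_cmult: "lbm f \<Longrightarrow> lbm (\<lambda>t. c * f t :: real)"
  by (rule lbm_mult[OF lbm_const])

lemma lbm_scaleR:
  assumes "lbm f" "lbm g" shows "lbm (\<lambda>t. f t *\<^sub>R (g t :: 'a::euclidean_space))"
proof -
  have "bounded ((\<lambda>t. f t *\<^sub>R g t) ` {0..T})" for T
  proof -
    obtain a b where "\<And>t. t \<in> {0..T} \<Longrightarrow> norm (f t) \<le> a" "\<And>t. t \<in> {0..T} \<Longrightarrow> norm (g t) \<le> b"
      using assms unfolding locally_bounded_measurable_def bounded_iff by (metis imageI)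
    then have "norm (f t *\<^sub>R g t) \<le> a * b" if "t \<in> {0..T}" for t
      unfolding norm_scaleR real_norm_def[symmetric]
      using that by (intro mult_mono) (auto intro: order_trans[OF norm_ge_zero] order_trans[OF abs_ge_zero])
    then show ?thesis unfolding bounded_iff by blast
  qed
  then show ?thesis using assms by (auto simp: locally_bounded_measurable_def)
qed

lemma lbm_sum:
  "(\<And>i. i \<in> I \<Longrightarrow> lbm (\<lambda>t. f i t)) \<Longrightarrow> lbm (\<lambda>t. \<Sum>i\<in>I. f i t)"
  by (induction I rule: infinite_finite_induct) (auto intro: lbm_add lbm_const)

lemma lbm_norm: "lbm f \<Longrightarrow> lbm (\<lambda>t. norm (f t))"
  unfolding locally_bounded_measurable_def
  by (intro conjI allI borel_measurable_norm) (auto simp: bounded_iff)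

lemma lbm_continuous:
  assumes "continuous_on {0..} f" shows "lbm f"
proof -
  have "f \<in> borel_measurable (lebesgue_on {0..})"
    using assms by (intro continuous_imp_measurable_on_sets_lebesgue) auto
  moreover have "bounded (f ` {0..T})" for T
    by (intro compact_imp_bounded compact_continuous_image)
       (auto intro: continuous_on_subset[OF assms])
  ultimately show ?thesis by (simp add: locally_bounded_measurable_def)
qed

lemma lbm_integrable:
  assumes "lbm f" "0 \<le> a" shows "f integrable_on {a..b}"
proof -
  obtain B where B: "\<And>t. t \<in> {0..b} \<Longrightarrow> norm (f t) \<le> B"
    using assms unfolding locally_bounded_measurable_def bounded_iff by (metis imageI)
  have meas: "f \<in> borel_measurable (lebesgue_on {a..b})"
    using assms unfolding locally_bounded_measurable_def
    by (auto intro!: measurable_restrict_mono[of f lebesgue "{0..}"])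
  have "norm (f t) \<le> B" if "t \<in> {a..b}" for t
    using B[of t] that assms(2) by simp
  then show ?thesis
    by (rule measurable_bounded_by_integrable_imp_integrable[OF meas, of "\<lambda>_. B", rotated])
       (simp_all add: integrable_const_ivl)
qed

lemmas lbm_intros = lbm_const lbm_add lbm_diff lbm_minus lbm_inner lbm_mult lbm_power2
  lbm_scaleR lbm_sum lbm_norm

lemma integral_mono_lbm:
  fixes f g :: "real \<Rightarrow> real"
  assumes "lbm f" "lbm g" "0 \<le> a" "\<And>t. a \<le> t \<Longrightarrow> t \<le> b \<Longrightarrow> f t \<le> g t"
  shows "integral {a..b} f \<le> integral {a..b} g"
  using assms by (intro integral_le lbm_integrable) auto

lemma integral_nonneg_lbm:
  fixes f :: "real \<Rightarrow> real"
  assumes "lbm f" "0 \<le> a" "\<And>t. a \<le> t \<Longrightarrow> t \<le> b \<Longrightarrow> 0 \<le> f t"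
  shows "0 \<le> integral {a..b} f"
  using assms by (intro integral_nonneg lbm_integrable) auto

lemma integral_mono_interval:
  fixes f :: "real \<Rightarrow> real"
  assumes "lbm f" "0 \<le> a" "a \<le> b" "b \<le> c" "\<And>t. 0 \<le> t \<Longrightarrow> 0 \<le> f t"
  shows "integral {a..b} f \<le> integral {a..c} f"
  using assms by (intro integral_subset_le lbm_integrable) auto

text \<open>The quadratic form in \<open>p\<close> and \<open>q\<close> that arises from integrating
  \<open>(p * f t - q * g t)^2\<close> is nonnegative. The energy of \<open>g\<close> enters through
  an upper bound \<open>G\<close>, the shape in which it is available for the regressor.\<close>

lemma integral_Cauchy_Schwarz:
  fixes f g :: "real \<Rightarrow> real"
  assumes f: "lbm f" and g: "lbm g" and a: "0 \<le> a"
    and G: "integral {a..b} (\<lambda>t. (g t)\<^sup>2) \<le> G"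
  shows "(integral {a..b} (\<lambda>t. f t * g t))\<^sup>2 \<le> G * integral {a..b} (\<lambda>t. (f t)\<^sup>2)"
proof -
  define F where "F = integral {a..b} (\<lambda>t. (f t)\<^sup>2)"
  define J where "J = integral {a..b} (\<lambda>t. (g t)\<^sup>2)"
  define M where "M = integral {a..b} (\<lambda>t. f t * g t)"
  have pos: "0 \<le> J" "0 \<le> F"
    unfolding F_def J_def using f g a by (auto intro!: integral_nonneg_lbm lbm_intros)
  have key: "0 \<le> p\<^sup>2 * F - 2 * p * q * M + q\<^sup>2 * J" for p q
  proof -
    have "0 \<le> integral {a..b} (\<lambda>t. (p * f t - q * g t)\<^sup>2)"
      using f g a by (intro integral_nonneg_lbm lbm_intros) auto
    also have "(\<lambda>t. (p * f t - q * g t)\<^sup>2)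
        = (\<lambda>t. p\<^sup>2 * (f t)\<^sup>2 - (2 * p * q) * (f t * g t) + q\<^sup>2 * (g t)\<^sup>2)"
      by (auto simp: power2_eq_square algebra_simps)
    also have "integral {a..b} \<dots> = p\<^sup>2 * F - 2 * p * q * M + q\<^sup>2 * J"
      unfolding F_def J_def M_def
      by (subst integral_add integral_diff;
          (intro lbm_integrable lbm_intros f g a)?)+ simp
    finally show ?thesis .
  qed
  have "M\<^sup>2 \<le> J * F"
  proof (cases "J = 0")
    case True
    \<comment> \<open>With \<open>J = 0\<close> and \<open>p = 1\<close> the form is affine in
      \<open>q\<close>; if \<open>M\<close> were nonzero, this \<open>q\<close> would give it the
      value -1.\<close>
    then have "M = 0"
      using key[of 1 "(F + 1) / (2 * M)"] by (cases "M = 0") (auto simp: field_simps)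
    then show ?thesis using True by simp
  next
    case False
    have "0 \<le> J * (J * F - M\<^sup>2)"
      using key[of J M] by (simp add: power2_eq_square algebra_simps)
    then show ?thesis using False pos(1) by (simp add: zero_le_mult_iff)
  qed
  also have "\<dots> \<le> G * F" using G pos(2) by (simp add: J_def mult_right_mono)
  finally show ?thesis by (simp add: F_def M_def)
qed

lemma primitive_lbm_density: "primitive f F \<Longrightarrow> lbm f"
  by (simp add: primitive_def)

lemma primitive_integral:
  assumes "primitive f F" "0 \<le> a" "a \<le> b" shows "integral {a..b} f = F b - F a"
proof -
  have *: "integral {0..t} f = F t - F 0" if "0 \<le> t" for t
    using assms(1) that by (auto simp: primitive_def dest: integral_unique)
  have "integral {0..a} f + integral {a..b} f = integral {0..b} f"
    by (rule Henstock_Kurzweil_Integration.integral_combine) (use assms in \<open>auto simp: primitive_def intro: lbm_integrable\<close>)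
  then show ?thesis using *[of a] *[of b] assms(2,3) by (simp add: algebra_simps)
qed

text \<open>Nothing is assumed of \<open>f\<close> beyond the integral identity. This permits a
  bootstrap: the states of a solution are continuous, hence \<open>lbm\<close>, before the
  right-hand side, which is built from the states, is known to be \<open>lbm\<close>.\<close>

lemma integrated_continuous:
  fixes F :: "real \<Rightarrow> 'a::euclidean_space"
  assumes F: "\<And>t. 0 \<le> t \<Longrightarrow> (f has_integral F t - c) {0..t}" shows "continuous_on {0..} F"
proof (clarsimp simp: continuous_on_eq_continuous_within)
  fix t :: real assume t: "0 \<le> t"
  have "continuous_on {0..t + 1} (\<lambda>s. integral {0..s} f)"
    using F[of "t + 1"] t by (intro indefinite_integral_continuous_1) (auto simp: integrable_on_def)
  then have "continuous_on {0..t + 1} (\<lambda>s. c + integral {0..s} f)"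
    by (intro continuous_intros)
  moreover have "c + integral {0..s} f = F s" if "s \<in> {0..t + 1}" for s
    using F[of s] that by (simp add: integral_unique)
  ultimately have "continuous_on {0..t + 1} F"
    using continuous_on_cong by (metis (no_types, lifting))
  then have "continuous (at t within {0..t + 1}) F"
    using t by (auto simp: continuous_on_eq_continuous_within)
  moreover have "at t within {0..t + 1} = at t within {0..}"
    by (rule at_within_nhd[of _ "{..<t + 1}"]) auto
  ultimately show "continuous (at t within {0..}) F" by simp
qed

lemma primitive_continuous: "primitive f F \<Longrightarrow> continuous_on {0..} F"
  by (rule integrated_continuous[of f _ "F 0"]) (simp add: primitive_def)

lemma primitive_lbm: "primitive f F \<Longrightarrow> lbm F"
  by (rule lbm_continuous[OF primitive_continuous])

lemma primitive_const: "primitive (\<lambda>_. 0) (\<lambda>_. c)"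
  by (simp add: primitive_def lbm_const)

lemma primitive_add:
  "primitive f F \<Longrightarrow> primitive g G \<Longrightarrow> primitive (\<lambda>t. f t + g t) (\<lambda>t. F t + G t)"
  unfolding primitive_def add_diff_add by (simp add: lbm_add has_integral_add)

lemma primitive_bounded_linear:
  assumes h: "bounded_linear h" and F: "primitive f F"
  shows "primitive (\<lambda>t. h (f t)) (\<lambda>t. h (F t))"
proof -
  have "((\<lambda>s. h (f s)) has_integral h (F t) - h (F 0)) {0..t}" if "0 \<le> t" for t
    using has_integral_linear[OF _ h, of f "F t - F 0" "{0..t}"] F that
    by (simp add: primitive_def o_def linear_diff[OF bounded_linear.linear[OF h]])
  then show ?thesis using F h by (simp add: primitive_def lbm_bounded_linear)
qed

lemma primitive_cmult: "primitive f F \<Longrightarrow> primitive (\<lambda>t. c * f t :: real) (\<lambda>t. c * F t)"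
  by (rule primitive_bounded_linear[OF bounded_linear_mult_right])

lemma primitive_scaleR: "primitive f F \<Longrightarrow> primitive (\<lambda>t. c *\<^sub>R f t) (\<lambda>t. c *\<^sub>R F t)"
  by (rule primitive_bounded_linear[OF bounded_linear_scaleR_right])

lemma primitive_minus: "primitive f F \<Longrightarrow> primitive (\<lambda>t. - f t) (\<lambda>t. - F t)"
  by (rule primitive_bounded_linear[OF bounded_linear_minus[OF bounded_linear_ident]])

lemma primitive_diff:
  "primitive f F \<Longrightarrow> primitive g G \<Longrightarrow> primitive (\<lambda>t. f t - g t) (\<lambda>t. F t - G t)"
  using primitive_add[OF _ primitive_minus, of f F g G] by simp

lemma primitive_sum:
  "(\<And>i. i \<in> I \<Longrightarrow> primitive (f i) (F i)) \<Longrightarrow> primitive (\<lambda>t. \<Sum>i\<in>I. f i t) (\<lambda>t. \<Sum>i\<in>I. F i t)"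
  by (induction I rule: infinite_finite_induct) (simp_all add: primitive_const primitive_add)

lemma primitive_Lipschitz:
  assumes F: "primitive f F" and B: "\<And>t. t \<in> {0..T} \<Longrightarrow> norm (f t) \<le> B"
    and st: "0 \<le> s" "s \<le> t" "t \<le> T"
  shows "norm (F t - F s) \<le> B * (t - s)"
proof -
  have "0 \<le> B" using order_trans[OF norm_ge_zero B[of s]] st by simp
  moreover have "(f has_integral F t - F s) (cbox s t)"
    using primitive_integral[OF F st(1,2)] lbm_integrable[OF primitive_lbm_density[OF F] st(1)]
    by (simp add: has_integral_integrable_integral)
  ultimately show ?thesis
    using has_integral_bound[of B f "F t - F s" s t] B st by auto
qed

text \<open>The difference quotients of \<open>\<Phi>\<close> are of the order of the step, so its
  derivative vanishes at every point of the interval and no exceptional set has to be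
  discussed.\<close>

lemma quadratic_modulus_imp_constant:
  fixes \<Phi> :: "real \<Rightarrow> real"
  assumes le: "\<And>s t. 0 \<le> s \<Longrightarrow> s \<le> t \<Longrightarrow> t \<le> T \<Longrightarrow> \<bar>\<Phi> t - \<Phi> s\<bar> \<le> K * (t - s)\<^sup>2" and "0 \<le> T"
  shows "\<Phi> T = \<Phi> 0"
proof -
  have "(\<Phi> has_derivative (\<lambda>h. 0)) (at x within {0..T})" if x: "x \<in> {0..T}" for x
  proof (rule has_derivativeI_sandwich[where e=1 and H="\<lambda>y. K * \<bar>y - x\<bar>"])
    show "((\<lambda>y. K * \<bar>y - x\<bar>) \<longlongrightarrow> 0) (at x within {0..T})"
      by (auto intro!: tendsto_eq_intros)
    fix y assume y: "y \<in> {0..T}" "y \<noteq> x"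
    have "\<bar>\<Phi> y - \<Phi> x\<bar> \<le> K * \<bar>y - x\<bar>\<^sup>2"
      using le[of x y] le[of y x] x y by (cases "x \<le> y") (auto simp: power2_commute abs_minus_commute)
    also have "\<dots> = K * \<bar>y - x\<bar> * \<bar>y - x\<bar>" by (simp add: power2_eq_square)
    finally show "norm (\<Phi> y - \<Phi> x - 0) / norm (y - x) \<le> K * \<bar>y - x\<bar>"
      using y by (simp add: divide_le_eq)
  qed auto
  then obtain c where "\<forall>x\<in>{0..T}. \<Phi> x = c"
    using has_derivative_zero_constant[of "{0..T}" \<Phi>] by auto
  then show ?thesis using assms(2) by auto
qed

text \<open>The increment of the product over \<open>{s..t}\<close> is the integral of
  \<open>f\<close> against \<open>G t\<close> plus that of \<open>g\<close> against
  \<open>F s\<close>, both factors frozen at an endpoint. Subtracting the expected density leaves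
  increments of \<open>F\<close> and \<open>G\<close>, which are of order \<open>t - s\<close>,
  against bounded densities: the defect \<open>\<Phi>\<close> has a quadratic modulus and is
  constant.\<close>

lemma primitive_inner:
  fixes F G :: "real \<Rightarrow> 'a::euclidean_space"
  assumes F: "primitive f F" and G: "primitive g G"
  shows "primitive (\<lambda>t. inner (f t) (G t) + inner (F t) (g t)) (\<lambda>t. inner (F t) (G t))"
    (is "primitive ?h _")
proof -
  note lbms = F[THEN primitive_lbm] G[THEN primitive_lbm]
    F[THEN primitive_lbm_density] G[THEN primitive_lbm_density]
  have h: "lbm ?h" by (intro lbm_intros lbms)
  have "integral {0..T} ?h = inner (F T) (G T) - inner (F 0) (G 0)" if T: "0 \<le> T" for T
  proof -
    obtain A where A: "\<And>t. t \<in> {0..T} \<Longrightarrow> norm (f t) \<le> A"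
      using lbms(3) unfolding locally_bounded_measurable_def bounded_iff by (metis imageI)
    obtain B where B: "\<And>t. t \<in> {0..T} \<Longrightarrow> norm (g t) \<le> B"
      using lbms(4) unfolding locally_bounded_measurable_def bounded_iff by (metis imageI)
    have "0 \<le> A" "0 \<le> B"
      using order_trans[OF norm_ge_zero A[of 0]] order_trans[OF norm_ge_zero B[of 0]] T by simp_all
    define \<Phi> where "\<Phi> t = inner (F t) (G t) - integral {0..t} ?h" for t
    have "\<bar>\<Phi> t - \<Phi> s\<bar> \<le> (2 * A * B) * (t - s)\<^sup>2" if st: "0 \<le> s" "s \<le> t" "t \<le> T" for s t
    proof -
      let ?d = "\<lambda>r. inner (f r) (G t - G r) + inner (F s - F r) (g r)"
      have d: "lbm ?d" by (intro lbm_intros lbms)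
      have "(f has_integral F t - F s) {s..t}" "(g has_integral G t - G s) {s..t}"
        using primitive_integral[OF F st(1,2)] primitive_integral[OF G st(1,2)]
          lbm_integrable[OF lbms(3) st(1)] lbm_integrable[OF lbms(4) st(1)]
        by (simp_all add: has_integral_integrable_integral)
      then have "((\<lambda>r. inner (f r) (G t) + inner (F s) (g r)) has_integral
          (inner (F t - F s) (G t) + inner (F s) (G t - G s))) {s..t}"
        by (intro has_integral_add)
           (auto dest: has_integral_linear[OF _ bounded_linear_inner_left, of _ _ _ "G t"]
              has_integral_linear[OF _ bounded_linear_inner_right, of _ _ _ "F s"] simp: o_def)
      moreover have "(?h has_integral integral {s..t} ?h) {s..t}"
        using lbm_integrable[OF h st(1)] by blast
      ultimately have "((\<lambda>r. (inner (f r) (G t) + inner (F s) (g r)) - ?h r) has_integral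
          (inner (F t - F s) (G t) + inner (F s) (G t - G s)) - integral {s..t} ?h) {s..t}"
        by (rule has_integral_diff)
      moreover have "(\<lambda>r. (inner (f r) (G t) + inner (F s) (g r)) - ?h r) = ?d"
        by (auto simp: inner_diff_left inner_diff_right)
      moreover have "integral {0..s} ?h + integral {s..t} ?h = integral {0..t} ?h"
        by (rule Henstock_Kurzweil_Integration.integral_combine) (use st in \<open>auto intro: lbm_integrable[OF h]\<close>)
      then have "(inner (F t - F s) (G t) + inner (F s) (G t - G s)) - integral {s..t} ?h = \<Phi> t - \<Phi> s"
        by (simp add: \<Phi>_def inner_diff_left inner_diff_right)
      ultimately have I: "(?d has_integral (\<Phi> t - \<Phi> s)) (cbox s t)" by simp
      have "norm (?d r) \<le> 2 * A * B * (t - s)" if r: "r \<in> {s..t}" for r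
      proof -
        have "norm (G t - G r) \<le> B * (t - s)" "norm (F s - F r) \<le> A * (t - s)"
          using primitive_Lipschitz[OF G B, of T r t] primitive_Lipschitz[OF F A, of T s r] r st
            \<open>0 \<le> A\<close> \<open>0 \<le> B\<close> mult_left_mono[of "t - r" "t - s" B] mult_left_mono[of "r - s" "t - s" A]
          by (auto simp: norm_minus_commute)
        then have "norm (f r) * norm (G t - G r) \<le> A * (B * (t - s))"
          "norm (F s - F r) * norm (g r) \<le> A * (t - s) * B"
          using A[of r] B[of r] r st \<open>0 \<le> A\<close> \<open>0 \<le> B\<close> by (intro mult_mono; auto)+
        then show ?thesis
          using Cauchy_Schwarz_ineq2[of "f r" "G t - G r"] Cauchy_Schwarz_ineq2[of "F s - F r" "g r"]
          by (auto simp: algebra_simps)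
      qed
      then have "norm (\<Phi> t - \<Phi> s) \<le> 2 * A * B * (t - s) * measure lborel (cbox s t)"
        using st \<open>0 \<le> A\<close> \<open>0 \<le> B\<close> by (intro has_integral_bound[OF _ I]) auto
      then show ?thesis using st by (simp add: power2_eq_square)
    qed
    then have "\<Phi> T = \<Phi> 0" using T by (rule quadratic_modulus_imp_constant)
    then show ?thesis by (simp add: \<Phi>_def)
  qed
  then have "(?h has_integral (inner (F t) (G t) - inner (F 0) (G 0))) {0..t}" if "0 \<le> t" for t
    using that lbm_integrable[OF h, of 0 t] by (simp add: has_integral_integrable_integral)
  with h show ?thesis by (simp add: primitive_def)
qed

lemma primitive_mult:
  "primitive f F \<Longrightarrow> primitive g G \<Longrightarrow> primitive (\<lambda>t. f t * G t + F t * g t :: real) (\<lambda>t. F t * G t)"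
  using primitive_inner[of f F g G] by simp

text \<open>Stands in for the integration of a differential inequality in each of the Lyapunov
  arguments.\<close>

lemma primitive_le_integral:
  fixes F :: "real \<Rightarrow> real"
  assumes "primitive f F" "lbm g" "\<And>t. 0 \<le> t \<Longrightarrow> f t \<le> g t" "0 \<le> T"
  shows "F T - F 0 \<le> integral {0..T} g"
  using primitive_integral[OF assms(1), of 0 T] integral_mono_lbm[of f g 0 T] assms
  by (auto simp: primitive_def)

section \<open>Spectra of symmetric matrices and graph Laplacians\<close>

lemma quadratic_nonneg_imp_linear_zero:
  fixes b c :: real
  assumes "\<And>t. 0 \<le> 2 * t * b + t\<^sup>2 * c"
  shows "b = 0"
proof (rule ccontr)
  assume b: "b \<noteq> 0"
  \<comment> \<open>\<open>C\<close> is positive and dominates \<open>c\<close>, so at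
    \<open>t = - b / C\<close> the linear term outweighs the quadratic one.\<close>
  define C where "C = \<bar>c\<bar> + 1"
  have C: "C > 0" "c \<le> C" by (auto simp: C_def)
  have "(b / C)\<^sup>2 * c \<le> (b / C)\<^sup>2 * C" using C by (intro mult_left_mono) auto
  then have "2 * (- b / C) * b + (- b / C)\<^sup>2 * c \<le> - 2 * b\<^sup>2 / C + b\<^sup>2 / C\<^sup>2 * C"
    by (simp add: power2_eq_square)
  also have "\<dots> = - (b\<^sup>2 / C)" using C by (simp add: power2_eq_square field_simps)
  also have "\<dots> < 0" using b C by simp
  finally show False using assms[of "- b / C"] by simp
qed

lemma symmetric_inner_matrix:
  fixes M :: "real^'n^'n"
  assumes "transpose M = M" shows "inner u (M *v v) = inner v (M *v u)"
  by (metis assms dot_lmul_matrix inner_commute transpose_matrix_vector)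

text \<open>\<open>u\<close> minimises the Rayleigh quotient over the compact unit sphere of
  \<open>S\<close>. Invariance of \<open>S\<close> puts the residual
  \<open>w = M *v u - m *\<^sub>R u\<close> into \<open>S\<close>, so \<open>w\<close> is an
  admissible variation, and stationarity forces \<open>w = 0\<close>. The lemma is applied to the
  whole space and to the hyperplane orthogonal to the all-ones vector.\<close>

lemma symmetric_min_eigenvector:
  fixes M :: "real^'n^'n"
  assumes sym: "transpose M = M" and S: "subspace S" and inv: "\<And>v. v \<in> S \<Longrightarrow> M *v v \<in> S"
    and "\<exists>v\<in>S. v \<noteq> 0"
  obtains m u where "u \<in> S" "u \<noteq> 0" "M *v u = m *\<^sub>R u"
    "\<And>v. v \<in> S \<Longrightarrow> m * inner v v \<le> inner v (M *v v)"
proof -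
  let ?q = "\<lambda>v. inner v (M *v v)" and ?K = "sphere 0 1 \<inter> S"
  have cont: "continuous_on UNIV ?q"
    by (intro continuous_intros linear_continuous_on matrix_vector_mul_bounded_linear)
  obtain v0 where v0: "v0 \<in> S" "v0 \<noteq> 0" using assms(4) by auto
  then have "(1 / norm v0) *\<^sub>R v0 \<in> ?K" using S by (simp add: subspace_mul)
  moreover have "compact ?K" using S by (intro compact_Int_closed closed_subspace) auto
  ultimately obtain u where u: "u \<in> ?K" "\<And>v. v \<in> ?K \<Longrightarrow> ?q u \<le> ?q v"
    using continuous_attains_inf[of ?K ?q] continuous_on_subset[OF cont] by (metis empty_iff subset_UNIV)
  define m where "m = ?q u"
  have le: "m * inner v v \<le> ?q v" if "v \<in> S" for v
  proof (cases "v = 0")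
    case False
    then have "m \<le> ?q ((1 / norm v) *\<^sub>R v)"
      unfolding m_def using that S by (intro u(2)) (simp add: subspace_mul)
    also have "\<dots> = ?q v / inner v v"
      by (simp add: matrix_vector_mult_scaleR power2_norm_eq_inner[symmetric] power2_eq_square)
    finally show ?thesis using False by (simp add: pos_le_divide_eq)
  qed simp
  have uu: "inner u u = 1" using u(1) by (simp add: power2_norm_eq_inner[symmetric])
  define w where "w = M *v u - m *\<^sub>R u"
  have w: "w \<in> S" using u(1) S inv by (auto simp: w_def intro!: subspace_diff subspace_mul)
  \<comment> \<open>The coefficient of the linear term of the variation is exactly the squared norm
    of \<open>w\<close>.\<close>
  have "0 \<le> 2 * t * inner w w + t\<^sup>2 * (?q w - m * inner w w)" for t
  proof -
    have "u + t *\<^sub>R w \<in> S" using u(1) w S by (auto intro!: subspace_add subspace_mul)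
    then have "0 \<le> ?q (u + t *\<^sub>R w) - m * inner (u + t *\<^sub>R w) (u + t *\<^sub>R w)" using le by fastforce
    also have "\<dots> = (?q u - m * inner u u) + 2 * t * (inner w (M *v u) - m * inner w u)
        + t\<^sup>2 * (?q w - m * inner w w)"
      using symmetric_inner_matrix[OF sym, of u w]
      by (simp add: matrix_vector_right_distrib matrix_vector_mult_scaleR inner_add_left inner_add_right
          inner_commute[of u w] power2_eq_square algebra_simps)
    also have "?q u - m * inner u u = 0" by (simp add: m_def uu)
    also have "inner w (M *v u) - m * inner w u = inner w w" by (simp add: w_def inner_diff_right)
    finally show ?thesis by simp
  qed
  then have "inner w w = 0" by (rule quadratic_nonneg_imp_linear_zero)
  then have "M *v u = m *\<^sub>R u" by (simp add: w_def)
  then show ?thesis using that[of u m] u(1) uu le by force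
qed

abbreviation eigenspace :: "real^'n^'n \<Rightarrow> real \<Rightarrow> (real^'n) set" where
  "eigenspace M l \<equiv> {u. M *v u = l *\<^sub>R u}"

text \<open>Eigenvectors of distinct eigenvalues are orthogonal and hence independent. Finiteness
  lets the dimensions of the eigenspaces serve as multiplicities of a multiset.\<close>

lemma symmetric_finite_eigenvalues:
  fixes M :: "real^'n^'n"
  assumes sym: "transpose M = M"
  shows "finite {l. dim (eigenspace M l) \<noteq> 0}"
proof -
  define E where "E = {l. dim (eigenspace M l) \<noteq> 0}"
  have "\<forall>l\<in>E. \<exists>u. M *v u = l *\<^sub>R u \<and> u \<noteq> 0" by (auto simp: E_def dim_eq_0)
  from bchoice[OF this] obtain f where f: "\<And>l. l \<in> E \<Longrightarrow> M *v f l = l *\<^sub>R f l" "\<And>l. l \<in> E \<Longrightarrow> f l \<noteq> 0"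
    by blast
  have orth: "inner (f l) (f k) = 0" if "l \<in> E" "k \<in> E" "l \<noteq> k" for l k
    using symmetric_inner_matrix[OF sym, of "f l" "f k"] f(1)[OF that(1)] f(1)[OF that(2)] that(3)
    by (simp add: inner_commute[of "f k"])
  have "inj_on f E"
  proof (rule inj_onI, rule ccontr)
    fix l k assume lk: "l \<in> E" "k \<in> E" "f l = f k" "l \<noteq> k"
    then have "inner (f l) (f l) = 0" using orth[OF lk(1,2,4)] by simp
    then show False using f(2)[OF lk(1)] by simp
  qed
  moreover have "pairwise real_inner_class.orthogonal (f ` E)"
    unfolding pairwise_image real_inner_class.orthogonal_def by (simp add: pairwise_def orth)
  then have "independent (f ` E)"
    by (rule pairwise_orthogonal_independent) (use f(2) in auto)
  then have "finite (f ` E)" by (rule finiteI_independent)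
  ultimately have "finite E" using finite_imageD by blast
  then show ?thesis by (simp add: E_def)
qed

text \<open>The definite description behind \<open>eigenvalues\<close> is proper for symmetric
  matrices: the dimensions of the eigenspaces form a multiset, and a sorted list is determined by
  its multiset.\<close>

lemma eigenvalues_symmetric:
  fixes M :: "real^'n^'n"
  assumes sym: "transpose M = M"
  shows "sorted (eigenvalues M)" "count_list (eigenvalues M) l = dim (eigenspace M l)"
proof -
  let ?P = "\<lambda>ls. sorted ls \<and> (\<forall>l. count_list ls l = dim (eigenspace M l))"
  define \<Lambda> where "\<Lambda> = Abs_multiset (\<lambda>l. dim (eigenspace M l))"
  have \<Lambda>: "count \<Lambda> l = dim (eigenspace M l)" for l
    using symmetric_finite_eigenvalues[OF sym] unfolding \<Lambda>_def
    by (subst count_Abs_multiset) (simp_all del: dim_eq_0)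
  have "?P (sorted_list_of_multiset \<Lambda>)"
    by (simp flip: count_mset add: \<Lambda>)
  moreover have "ls = sorted_list_of_multiset \<Lambda>" if "?P ls" for ls
  proof -
    have "mset ls = \<Lambda>" using that by (intro multiset_eqI) (simp add: count_mset \<Lambda>)
    then show ?thesis using that by (metis sorted_list_of_multiset_mset sorted_sort_id)
  qed
  ultimately have "?P (eigenvalues M)" unfolding eigenvalues_def by (rule theI)
  then show "sorted (eigenvalues M)" "count_list (eigenvalues M) l = dim (eigenspace M l)" by auto
qed

lemma mem_eigenvalues_iff:
  fixes M :: "real^'n^'n"
  assumes "transpose M = M"
  shows "l \<in> set (eigenvalues M) \<longleftrightarrow> (\<exists>u. u \<noteq> 0 \<and> M *v u = l *\<^sub>R u)"
proof -
  have "l \<in> set (eigenvalues M) \<longleftrightarrow> dim (eigenspace M l) \<noteq> 0"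
    by (metis eigenvalues_symmetric(2)[OF assms] count_list_0_iff)
  then show ?thesis by (auto simp: dim_eq_0)
qed

lemma eigenvalues_nonempty:
  fixes M :: "real^'n^'n"
  assumes "transpose M = M" shows "eigenvalues M \<noteq> []"
proof -
  have "\<exists>v\<in>(UNIV :: (real^'n) set). v \<noteq> 0" by (metis UNIV_I Finite_Cartesian_Product.vec_eq_iff axis_eq_0_iff zero_neq_one)
  then obtain m u where "u \<noteq> 0" "M *v u = m *\<^sub>R u"
    using symmetric_min_eigenvector[OF assms subspace_UNIV] by (metis UNIV_I)
  then show ?thesis using mem_eigenvalues_iff[OF assms, of m] by auto
qed

lemma hd_eigenvalues_pos:
  fixes M :: "real^'n^'n"
  assumes "transpose M = M" "\<And>v. v \<noteq> 0 \<Longrightarrow> 0 < inner v (M *v v)"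
  shows "0 < hd (eigenvalues M)"
proof -
  obtain u where u: "u \<noteq> 0" "M *v u = hd (eigenvalues M) *\<^sub>R u"
    using mem_eigenvalues_iff[OF assms(1)] hd_in_set[OF eigenvalues_nonempty[OF assms(1)]] by metis
  then have "0 < hd (eigenvalues M) * inner u u" using assms(2)[of u] by simp
  then show ?thesis using u(1) by (metis inner_gt_zero_iff zero_less_mult_pos2)
qed

lemma sorted_le_last: "sorted xs \<Longrightarrow> x \<in> set xs \<Longrightarrow> x \<le> last xs"
  by (induction xs) (auto intro: order_trans)

text \<open>A minimal eigenvector of \<open>- M\<close> is an eigenvector of \<open>M\<close> whose
  eigenvalue bounds the Rayleigh quotient from above.\<close>

lemma rayleigh_le_last_eigenvalue:
  fixes M :: "real^'n^'n"
  assumes sym: "transpose M = M"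
  shows "inner v (M *v v) \<le> last (eigenvalues M) * inner v v"
proof -
  have "M $ j $ i = M $ i $ j" for i j using sym by (metis transpose_def vec_lambda_beta)
  then have neg: "transpose (- M) = - M" by (simp add: transpose_def Finite_Cartesian_Product.vec_eq_iff)
  have minus: "(- M) *v v = - (M *v v)" for v
    by (simp add: matrix_vector_mult_def Finite_Cartesian_Product.vec_eq_iff sum_negf)
  have "\<exists>v\<in>(UNIV :: (real^'n) set). v \<noteq> 0" by (metis UNIV_I Finite_Cartesian_Product.vec_eq_iff axis_eq_0_iff zero_neq_one)
  then obtain m u where u: "u \<noteq> 0" "(- M) *v u = m *\<^sub>R u"
    and le: "\<And>v. m * inner v v \<le> inner v ((- M) *v v)"
    using symmetric_min_eigenvector[OF neg subspace_UNIV] by (metis UNIV_I)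
  have "M *v u = (- m) *\<^sub>R u" using u(2) by (metis minus minus_minus scaleR_minus_left)
  then have "- m \<in> set (eigenvalues M)" using u(1) mem_eigenvalues_iff[OF sym] by blast
  then have "- m \<le> last (eigenvalues M)" using eigenvalues_symmetric(1)[OF sym] by (rule sorted_le_last[rotated])
  then have "- m * inner v v \<le> last (eigenvalues M) * inner v v" by (rule mult_right_mono) simp
  then show ?thesis using le[of v] by (simp add: minus)
qed

text \<open>No entry of the sorted list is negative, and 0 occurs exactly once because its
  eigenspace is spanned by the all-ones vector; so index 1 holds the least positive eigenvalue. The
  minimum \<open>m\<close> of the Rayleigh quotient on the orthogonal hyperplane is itself a
  positive eigenvalue and thus not below that entry.\<close>

lemma second_eigenvalue:
  fixes M :: "real^'n^'n"
  assumes sym: "transpose M = M" and one: "M *v 1 = 0" and card: "CARD('n) \<ge> 2"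
    and nonneg: "\<And>v. 0 \<le> inner v (M *v v)"
    and ker: "\<And>v. inner v (M *v v) = 0 \<Longrightarrow> \<exists>c. v = c *\<^sub>R 1"
  shows "0 < eigenvalues M ! 1" "eigenvalues M ! 1 \<le> last (eigenvalues M)"
    "inner v 1 = 0 \<Longrightarrow> eigenvalues M ! 1 * inner v v \<le> inner v (M *v v)"
proof -
  let ?S = "{v :: real^'n. inner 1 v = 0}" and ?ls = "eigenvalues M"
  have oo: "inner (1 :: real^'n) 1 = real CARD('n)" by (simp add: inner_vec_def)
  have one0: "(1 :: real^'n) \<noteq> 0" using oo by auto
  obtain i j :: 'n where ij: "i \<noteq> j" using card card_le_Suc0_iff_eq[of "UNIV :: 'n set"] by fastforce
  \<comment> \<open>Two distinct nodes make the hyperplane orthogonal to the all-ones vector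
    nontrivial.\<close>
  have "axis i 1 - axis j (1 :: real) \<in> ?S" by (simp add: inner_diff_right inner_axis)
  moreover have "axis i 1 - axis j (1 :: real) \<noteq> 0" using ij by (simp add: axis_eq_axis)
  ultimately have ex: "\<exists>v\<in>?S. v \<noteq> 0" by blast
  have inv: "M *v v \<in> ?S" if "v \<in> ?S" for v
    using symmetric_inner_matrix[OF sym, of 1 v] one by simp
  obtain m u where u: "u \<in> ?S" "u \<noteq> 0" "M *v u = m *\<^sub>R u"
    and le: "\<And>v. v \<in> ?S \<Longrightarrow> m * inner v v \<le> inner v (M *v v)"
    using symmetric_min_eigenvector[OF sym subspace_hyperplane inv ex] by metis
  have "m * inner u u = inner u (M *v u)" using u by simp
  moreover have "inner u (M *v u) \<noteq> 0"
  proof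
    assume "inner u (M *v u) = 0"
    then obtain c where "u = c *\<^sub>R 1" using ker by blast
    then show False using u(1,2) oo by auto
  qed
  ultimately have m: "0 < m"
    using nonneg[of u] u(2) zero_less_mult_pos2[of m "inner u u"] by simp
  have eig_nonneg: "0 \<le> x" if x: "x \<in> set ?ls" for x
  proof -
    obtain y where y: "y \<noteq> 0" "M *v y = x *\<^sub>R y" using x mem_eigenvalues_iff[OF sym, of x] by auto
    then have "0 \<le> x * inner y y" using nonneg[of y] by simp
    then show ?thesis using y(1) mult_neg_pos[of x "inner y y"] by fastforce
  qed
  have m_in: "m \<in> set ?ls" using mem_eigenvalues_iff[OF sym, of m] u(2,3) by auto
  have "eigenspace M 0 = span {1}"
  proof
    show "eigenspace M 0 \<subseteq> span {1}"
    proof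
      fix v assume "v \<in> eigenspace M 0"
      then obtain c where "v = c *\<^sub>R 1" using ker[of v] by auto
      then show "v \<in> span {1}" by (simp add: span_mul span_base)
    qed
    show "span {1} \<subseteq> eigenspace M 0" using one by (auto simp: span_singleton matrix_vector_mult_scaleR)
  qed
  then have count0: "count_list ?ls 0 = 1"
    using one0 by (simp add: eigenvalues_symmetric(2)[OF sym])
  then obtain ys where ls: "?ls = 0 # ys"
  proof (cases ?ls)
    case (Cons x ys)
    have "0 \<in> set ?ls" using count0 by (metis count_notin zero_neq_one)
    then have "x \<le> 0" using eigenvalues_symmetric(1)[OF sym] Cons by auto
    then have "x = 0" using eig_nonneg[of x] Cons by simp
    then show ?thesis using that Cons by blast
  qed simp
  have zys: "0 \<notin> set ys" using count0 ls by (simp add: count_list_0_iff)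
  have m_ys: "m \<in> set ys" using m_in ls m by auto
  then obtain y zs where ys: "ys = y # zs" by (cases ys) auto
  have y: "?ls ! 1 = y" using ls ys by simp
  have "y \<noteq> 0" "0 \<le> y" using zys eig_nonneg[of y] ys ls by auto
  then show "0 < ?ls ! 1" using y by simp
  show "?ls ! 1 \<le> last ?ls"
    using sorted_le_last[OF eigenvalues_symmetric(1)[OF sym], of y] ls ys y by simp
  assume v: "inner v 1 = 0"
  have "y \<le> m" using m_ys ys eigenvalues_symmetric(1)[OF sym] ls by auto
  then have "y * inner v v \<le> m * inner v v" by (rule mult_right_mono) simp
  also have "\<dots> \<le> inner v (M *v v)" using le v by (simp add: inner_commute)
  finally show "?ls ! 1 * inner v v \<le> inner v (M *v v)" using y by simp
qed

section \<open>The Laplacian on families of vectors and its quadratic form\<close>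

definition lap :: "real^'n^'n \<Rightarrow> ('n \<Rightarrow> 'v::real_vector) \<Rightarrow> 'n \<Rightarrow> 'v" where
  "lap a X i = (\<Sum>j\<in>UNIV. a $ i $ j *\<^sub>R (X i - X j))"

lemma weight_balanced_sum_swap:
  fixes a :: "real^'n^'n" and f :: "'n \<Rightarrow> 'v::real_vector"
  assumes "weight_balanced a"
  shows "(\<Sum>i\<in>UNIV. \<Sum>j\<in>UNIV. a $ i $ j *\<^sub>R f j) = (\<Sum>i\<in>UNIV. \<Sum>j\<in>UNIV. a $ i $ j *\<^sub>R f i)"
proof -
  have "(\<Sum>i\<in>UNIV. \<Sum>j\<in>UNIV. a $ i $ j *\<^sub>R f j) = (\<Sum>j\<in>UNIV. (\<Sum>i\<in>UNIV. a $ i $ j) *\<^sub>R f j)"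
    by (subst sum.swap) (simp add: scaleR_sum_left)
  also have "\<dots> = (\<Sum>j\<in>UNIV. (\<Sum>i\<in>UNIV. a $ j $ i) *\<^sub>R f j)"
    using assms by (simp add: weight_balanced_def)
  finally show ?thesis by (simp add: scaleR_sum_left)
qed

lemma lap_sum_zero:
  assumes "weight_balanced a" shows "(\<Sum>i\<in>UNIV. lap a X i) = 0"
  using weight_balanced_sum_swap[OF assms, of X]
  by (simp add: lap_def scaleR_diff_right sum_subtractf)

lemma lap_shift: "lap a (\<lambda>i. X i - c) = lap a X"
  by (simp add: lap_def fun_eq_iff)

lemma lap_add: "lap a (\<lambda>i. X i + Y i) i = lap a X i + lap a Y i"
  by (simp add: lap_def algebra_simps sum.distrib sum_subtractf)

lemma lap_scaleR: "lap a (\<lambda>i. c *\<^sub>R X i) i = c *\<^sub>R lap a X i"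
  by (simp add: lap_def algebra_simps scaleR_sum_right)

lemma lap_diff: "lap a (\<lambda>i. X i - Y i) i = lap a X i - lap a Y i"
  by (simp add: lap_def algebra_simps sum.distrib sum_subtractf)

text \<open>Expanding the squared differences leaves squared norms weighted by row sums and by
  column sums, which weight balance identifies.\<close>

lemma sum_inner_lap:
  fixes X :: "'n::finite \<Rightarrow> 'v::real_inner"
  assumes "weight_balanced a"
  shows "(\<Sum>i\<in>UNIV. inner (X i) (lap a X i))
    = (1/2) * (\<Sum>i\<in>UNIV. \<Sum>j\<in>UNIV. a $ i $ j * (norm (X i - X j))\<^sup>2)"
proof -
  have sq: "(norm (X i - X j))\<^sup>2 = inner (X i) (X i) + inner (X j) (X j) - 2 * inner (X i) (X j)" for i j
    by (simp add: power2_norm_eq_inner inner_diff_left inner_diff_right inner_commute)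
  have "(\<Sum>i\<in>UNIV. \<Sum>j\<in>UNIV. a $ i $ j * (norm (X i - X j))\<^sup>2)
    = (\<Sum>i\<in>UNIV. \<Sum>j\<in>UNIV. a $ i $ j * inner (X i) (X i)) + (\<Sum>i\<in>UNIV. \<Sum>j\<in>UNIV. a $ i $ j * inner (X j) (X j))
      - 2 * (\<Sum>i\<in>UNIV. \<Sum>j\<in>UNIV. a $ i $ j * inner (X i) (X j))"
    unfolding sq by (simp add: algebra_simps sum.distrib sum_subtractf sum_distrib_left)
  also have "\<dots> = 2 * ((\<Sum>i\<in>UNIV. \<Sum>j\<in>UNIV. a $ i $ j * inner (X i) (X i))
      - (\<Sum>i\<in>UNIV. \<Sum>j\<in>UNIV. a $ i $ j * inner (X i) (X j)))"
    using weight_balanced_sum_swap[OF assms, of "\<lambda>i. inner (X i) (X i)"] by simp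
  also have "\<dots> = 2 * (\<Sum>i\<in>UNIV. inner (X i) (lap a X i))"
    by (simp add: lap_def inner_sum_right inner_diff_right algebra_simps sum_subtractf)
  finally show ?thesis by simp
qed

text \<open>The eigenvalues of the symmetric part do not control a product of two different
  families, so the estimate works edge by edge with Young's inequality of weight \<open>p\<close>.
  By balance, the bound \<open>d\<close> on the row sums also serves for the column sums.\<close>

lemma sum_inner_lap_cross:
  fixes X s :: "'n::finite \<Rightarrow> 'v::real_inner"
  assumes wb: "weight_balanced a" and adj: "adjacency_matrix a"
    and d: "\<And>i. (\<Sum>j\<in>UNIV. a $ i $ j) \<le> d" and p: "p > 0"
  shows "(\<Sum>i\<in>UNIV. inner (X i) (lap a s i))
    \<le> p * d / 2 * (\<Sum>i\<in>UNIV. (norm (X i))\<^sup>2) + 2 * d / p * (\<Sum>i\<in>UNIV. (norm (s i))\<^sup>2)"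
proof -
  have a: "0 \<le> a $ i $ j" for i j using adj by (simp add: adjacency_matrix_def)
  have deg: "(\<Sum>i\<in>UNIV. \<Sum>j\<in>UNIV. a $ i $ j * (norm (Y i))\<^sup>2) \<le> d * (\<Sum>i\<in>UNIV. (norm (Y i))\<^sup>2)"
    for Y :: "'n \<Rightarrow> 'v"
    unfolding sum_distrib_left sum_distrib_right[symmetric]
    by (intro sum_mono mult_right_mono d) auto
  have pt: "inner (X i) (s i - s j)
      \<le> p / 2 * (norm (X i))\<^sup>2 + 1 / p * (norm (s i))\<^sup>2 + 1 / p * (norm (s j))\<^sup>2" for i j
  proof -
    let ?x = "norm (X i)" and ?y = "norm (s i - s j)"
    have "0 \<le> (p * ?x - ?y)\<^sup>2" by simp
    then have "2 * p * (?x * ?y) \<le> p\<^sup>2 * ?x\<^sup>2 + ?y\<^sup>2"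
      by (simp add: power2_eq_square algebra_simps)
    also have "?y\<^sup>2 \<le> 2 * (norm (s i))\<^sup>2 + 2 * (norm (s j))\<^sup>2"
    proof -
      have "?y\<^sup>2 \<le> (norm (s i) + norm (s j))\<^sup>2" by (intro power_mono norm_triangle_ineq4) simp
      also have "\<dots> \<le> 2 * (norm (s i))\<^sup>2 + 2 * (norm (s j))\<^sup>2" using sum_squares_ge_zero[of "norm (s i) - norm (s j)" 0] by (simp add: power2_eq_square algebra_simps)
      finally show ?thesis .
    qed
    finally have "?x * ?y \<le> (p\<^sup>2 * ?x\<^sup>2 + (2 * (norm (s i))\<^sup>2 + 2 * (norm (s j))\<^sup>2)) / (2 * p)"
      using p by (simp add: pos_le_divide_eq algebra_simps)
    also have "\<dots> = p / 2 * ?x\<^sup>2 + 1 / p * (norm (s i))\<^sup>2 + 1 / p * (norm (s j))\<^sup>2"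
      using p by (simp add: field_simps power2_eq_square)
    finally show ?thesis using norm_cauchy_schwarz[of "X i" "s i - s j"] by linarith
  qed
  have "(\<Sum>i\<in>UNIV. inner (X i) (lap a s i)) = (\<Sum>i\<in>UNIV. \<Sum>j\<in>UNIV. a $ i $ j * inner (X i) (s i - s j))"
    by (simp add: lap_def inner_sum_right)
  also have "\<dots> \<le> (\<Sum>i\<in>UNIV. \<Sum>j\<in>UNIV. a $ i $ j *
      (p / 2 * (norm (X i))\<^sup>2 + 1 / p * (norm (s i))\<^sup>2 + 1 / p * (norm (s j))\<^sup>2))"
    by (intro sum_mono mult_left_mono pt a)
  also have "\<dots> = p / 2 * (\<Sum>i\<in>UNIV. \<Sum>j\<in>UNIV. a $ i $ j * (norm (X i))\<^sup>2)
      + 1 / p * (\<Sum>i\<in>UNIV. \<Sum>j\<in>UNIV. a $ i $ j * (norm (s i))\<^sup>2)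
      + 1 / p * (\<Sum>i\<in>UNIV. \<Sum>j\<in>UNIV. a $ i $ j * (norm (s j))\<^sup>2)"
    by (simp add: distrib_left sum.distrib sum_distrib_left mult_ac)
  also have "\<dots> \<le> p / 2 * (d * (\<Sum>i\<in>UNIV. (norm (X i))\<^sup>2))
      + 1 / p * (d * (\<Sum>i\<in>UNIV. (norm (s i))\<^sup>2)) + 1 / p * (d * (\<Sum>i\<in>UNIV. (norm (s i))\<^sup>2))"
    using weight_balanced_sum_swap[OF wb, of "\<lambda>i. (norm (s i))\<^sup>2"] p
    by (intro add_mono mult_left_mono deg) (simp_all add: deg)
  finally show ?thesis by (simp add: algebra_simps)
qed

lemma inner_sym_part: "inner v (sym_part A *v v) = inner v (A *v v)"
proof -
  have "inner v (transpose A *v v) = inner v (A *v v)"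
    by (metis dot_lmul_matrix inner_commute transpose_matrix_vector)
  then show ?thesis
    by (simp add: sym_part_def scaleR_matrix_vector_assoc[symmetric] matrix_vector_mult_add_rdistrib
        inner_add_right)
qed

lemma transpose_sym_part: "transpose (sym_part A) = sym_part A"
  by (simp add: sym_part_def transpose_def Finite_Cartesian_Product.vec_eq_iff add.commute)

lemma laplacian_mult: "(laplacian a *v v) $ i = lap a (\<lambda>i. v $ i) i"
proof -
  have "(laplacian a *v v) $ i
      = (\<Sum>j\<in>UNIV. (if i = j then (\<Sum>l\<in>UNIV. a $ i $ l) * v $ j else 0) - a $ i $ j * v $ j)"
    by (simp add: laplacian_def matrix_vector_mult_def left_diff_distrib if_distrib[of "\<lambda>x. x * _"] cong: if_cong)
  also have "\<dots> = (\<Sum>l\<in>UNIV. a $ i $ l) * v $ i - (\<Sum>j\<in>UNIV. a $ i $ j * v $ j)"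
    by (simp add: sum_subtractf)
  also have "\<dots> = lap a (\<lambda>i. v $ i) i"
    by (simp add: lap_def algebra_simps sum_subtractf sum_distrib_left)
  finally show ?thesis .
qed

lemma inner_laplacian:
  assumes "weight_balanced a"
  shows "inner v (sym_part (laplacian a) *v v)
    = (1/2) * (\<Sum>i\<in>UNIV. \<Sum>j\<in>UNIV. a $ i $ j * (v $ i - v $ j)\<^sup>2)"
  using sum_inner_lap[OF assms, of "\<lambda>i. v $ i"]
  unfolding inner_sym_part by (simp add: inner_vec_def laplacian_mult)

text \<open>A vanishing quadratic form forces equal values at the two ends of every edge, and a
  directed path joins any two nodes.\<close>

lemma laplacian_kernel:
  assumes adj: "adjacency_matrix a" and wb: "weight_balanced a" and sc: "strongly_connected a"
    and zero: "inner v (sym_part (laplacian a) *v v) = 0"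
  shows "\<exists>c. v = c *\<^sub>R 1"
proof -
  have a: "0 \<le> a $ i $ j" for i j using adj by (simp add: adjacency_matrix_def)
  have "(\<Sum>i\<in>UNIV. \<Sum>j\<in>UNIV. a $ i $ j * (v $ i - v $ j)\<^sup>2) = 0"
    using zero by (simp add: inner_laplacian[OF wb])
  then have "(\<Sum>j\<in>UNIV. a $ i $ j * (v $ i - v $ j)\<^sup>2) = 0" for i
    using a by (subst (asm) sum_nonneg_eq_0_iff) (auto intro!: sum_nonneg)
  then have "a $ i $ j * (v $ i - v $ j)\<^sup>2 = 0" for i j
    using a by (subst (asm) sum_nonneg_eq_0_iff) auto
  then have edge: "v $ j = v $ i" if "(j, i) \<in> edges a" for i j
    using that by (auto simp: edges_def) (metis less_irrefl)
  have path: "v $ j = v $ i" if "(j, i) \<in> (edges a)\<^sup>*" for i j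
    using that by (induction) (auto simp: edge)
  \<comment> \<open>\<open>undefined\<close> is an arbitrary reference node.\<close>
  have "v = (v $ undefined) *\<^sub>R 1"
    using path sc by (auto simp: Finite_Cartesian_Product.vec_eq_iff strongly_connected_def)
  then show ?thesis by blast
qed

lemma norm_power2_Basis:
  fixes x :: "'v::euclidean_space"
  shows "(norm x)\<^sup>2 = (\<Sum>b\<in>Basis. (inner x b)\<^sup>2)"
  unfolding power2_norm_eq_inner by (subst euclidean_inner) (simp add: power2_eq_square)

context
  fixes a :: "real^'n^'n"
  assumes card: "CARD('n) \<ge> 2" and adj: "adjacency_matrix a" and wb: "weight_balanced a"
    and sc: "strongly_connected a"
begin

text \<open>The row sums of the Laplacian vanish by construction and its column sums by weight
  balance, so the all-ones vector is in the kernel of the symmetric part.\<close>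

lemma laplacian_second_eigenvalue:
  shows "0 < eigenvalues (sym_part (laplacian a)) ! 1"
    "eigenvalues (sym_part (laplacian a)) ! 1 \<le> last (eigenvalues (sym_part (laplacian a)))"
    "inner v 1 = 0 \<Longrightarrow> eigenvalues (sym_part (laplacian a)) ! 1 * inner v v
      \<le> inner v (sym_part (laplacian a) *v v)"
proof -
  let ?M = "sym_part (laplacian a)"
  have a: "0 \<le> a $ i $ j" for i j using adj by (simp add: adjacency_matrix_def)
  have "?M *v 1 = 0"
  proof -
    have "laplacian a *v 1 = 0"
      by (simp add: Finite_Cartesian_Product.vec_eq_iff laplacian_mult lap_def)
    moreover have "transpose (laplacian a) *v 1 = 0"
    proof -
      have "(transpose (laplacian a) *v 1) $ i = (\<Sum>j\<in>UNIV. a $ i $ j) - (\<Sum>j\<in>UNIV. a $ j $ i)" for i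
        by (simp add: transpose_def laplacian_def matrix_vector_mult_def sum_subtractf)
      then show ?thesis
        using wb by (simp add: Finite_Cartesian_Product.vec_eq_iff weight_balanced_def)
    qed
    ultimately show ?thesis
      by (simp add: sym_part_def scaleR_matrix_vector_assoc[symmetric] matrix_vector_mult_add_rdistrib)
  qed
  moreover have "0 \<le> inner v (?M *v v)" for v
    by (auto simp: inner_laplacian[OF wb] intro!: sum_nonneg mult_nonneg_nonneg a)
  ultimately show "0 < eigenvalues ?M ! 1" "eigenvalues ?M ! 1 \<le> last (eigenvalues ?M)"
    "inner v 1 = 0 \<Longrightarrow> eigenvalues ?M ! 1 * inner v v \<le> inner v (?M *v v)"
    using second_eigenvalue[OF transpose_sym_part _ card _ laplacian_kernel[OF adj wb sc]] by blast+
qed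

text \<open>Without self-loops the in-degree is a diagonal entry of the symmetric part, and a
  diagonal entry is the Rayleigh quotient of a basis vector.\<close>

lemma degree_le_last_eigenvalue:
  "(\<Sum>j\<in>UNIV. a $ i $ j) \<le> last (eigenvalues (sym_part (laplacian a)))"
proof -
  have "(\<Sum>j\<in>UNIV. a $ i $ j) = (laplacian a *v axis i 1) $ i"
    using adj by (simp add: laplacian_def matrix_vector_mult_basis column_def adjacency_matrix_def)
  also have "\<dots> = inner (axis i 1) (sym_part (laplacian a) *v axis i 1)"
    by (simp add: inner_sym_part inner_axis')
  also have "\<dots> \<le> last (eigenvalues (sym_part (laplacian a)))"
    using rayleigh_le_last_eigenvalue[OF transpose_sym_part, of "axis i 1" "laplacian a"]
    by (simp add: inner_axis')
  finally show ?thesis .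
qed

text \<open>The scalar spectral gap, applied in every coordinate. On the right-hand side
  \<open>X\<close> is not centred because the quadratic form sees differences only.\<close>

lemma lap_poincare:
  fixes X :: "'n \<Rightarrow> 'v::euclidean_space"
  defines "m \<equiv> (1 / real CARD('n)) *\<^sub>R (\<Sum>i\<in>UNIV. X i)"
  shows "eigenvalues (sym_part (laplacian a)) ! 1 * (\<Sum>i\<in>UNIV. (norm (X i - m))\<^sup>2)
    \<le> (\<Sum>i\<in>UNIV. inner (X i) (lap a X i))"
proof -
  let ?l = "eigenvalues (sym_part (laplacian a)) ! 1"
  have m: "(\<Sum>i\<in>UNIV. X i - m) = 0"
    by (simp add: m_def sum_subtractf sum_constant_scaleR)
  have b: "?l * (\<Sum>i\<in>UNIV. (inner (X i - m) b)\<^sup>2)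
      \<le> (1/2) * (\<Sum>i\<in>UNIV. \<Sum>j\<in>UNIV. a $ i $ j * (inner (X i - X j) b)\<^sup>2)" for b
  proof -
    define v :: "real^'n" where "v = (\<chi> i. inner (X i - m) b)"
    have "inner v 1 = inner (\<Sum>i\<in>UNIV. X i - m) b"
      by (simp add: v_def inner_vec_def inner_sum_left)
    then have "inner v 1 = 0" by (simp only: m inner_zero_left)
    from laplacian_second_eigenvalue(3)[OF this] show ?thesis
      by (simp add: inner_laplacian[OF wb]) (simp add: v_def inner_vec_def power2_eq_square inner_diff_left)
  qed
  have "?l * (\<Sum>i\<in>UNIV. (norm (X i - m))\<^sup>2) = (\<Sum>b\<in>Basis. ?l * (\<Sum>i\<in>UNIV. (inner (X i - m) b)\<^sup>2))"
    unfolding norm_power2_Basis sum_distrib_left by (rule sum.swap)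
  also have "\<dots> \<le> (\<Sum>b\<in>Basis. (1/2) * (\<Sum>i\<in>UNIV. \<Sum>j\<in>UNIV. a $ i $ j * (inner (X i - X j) b)\<^sup>2))"
    by (intro sum_mono b)
  also have "\<dots> = (1/2) * (\<Sum>i\<in>UNIV. \<Sum>j\<in>UNIV. a $ i $ j * (norm (X i - X j))\<^sup>2)"
    unfolding norm_power2_Basis sum_distrib_left
    by (subst sum.swap, rule sum.cong[OF refl], subst sum.swap, rule refl)
  also have "\<dots> = (\<Sum>i\<in>UNIV. inner (X i) (lap a X i))" by (rule sum_inner_lap[OF wb, symmetric])
  finally show ?thesis .
qed

text \<open>Adding the sum over all nodes to the Laplacian removes its kernel: a zero of the new map
  has zero sum, and the Poincare inequality makes it vanish. The map is then onto, and for a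
  right-hand side of zero sum the added term is zero at the solution. This provides the equilibrium
  of the \<open>v\<close> states.\<close>

lemma lap_solve:
  fixes b :: "'n \<Rightarrow> real^'m"
  assumes "(\<Sum>i\<in>UNIV. b i) = 0"
  obtains Y where "\<And>i. lap a Y i = b i"
proof -
  let ?N = "real CARD('n)"
  define f :: "(real^'m)^'n \<Rightarrow> (real^'m)^'n" where "f Y = (\<chi> i. lap a (($) Y) i + (\<Sum>j\<in>UNIV. Y $ j))" for Y
  have sum_f: "(\<Sum>i\<in>UNIV. f Y $ i) = ?N *\<^sub>R (\<Sum>j\<in>UNIV. Y $ j)" for Y
    by (simp add: f_def sum.distrib lap_sum_zero[OF wb] sum_constant_scaleR del: sum_constant)
  have lin: "linear f"
    by (rule linearI)
       (simp_all add: f_def Finite_Cartesian_Product.vec_eq_iff lap_def algebra_simps sum.distrib sum_subtractf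
         sum_distrib_left)
  have "Y = 0" if "f Y = 0" for Y
  proof -
    have "?N *\<^sub>R (\<Sum>j\<in>UNIV. Y $ j) = 0" using sum_f[of Y] that by simp
    then have s: "(\<Sum>j\<in>UNIV. Y $ j) = 0" by simp
    have "lap a (($) Y) i = f Y $ i" for i by (simp add: f_def s)
    then have "eigenvalues (sym_part (laplacian a)) ! 1 * (\<Sum>i\<in>UNIV. (norm (Y $ i))\<^sup>2) \<le> 0"
      using lap_poincare[of "($) Y"] that by (simp add: s)
    then have "(\<Sum>i\<in>UNIV. (norm (Y $ i))\<^sup>2) \<le> 0"
      using laplacian_second_eigenvalue(1) by (simp add: mult_le_0_iff)
    then have "(\<Sum>i\<in>UNIV. (norm (Y $ i))\<^sup>2) = 0" by (intro antisym sum_nonneg) auto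
    then show ?thesis
      by (subst (asm) sum_nonneg_eq_0_iff) (auto simp: Finite_Cartesian_Product.vec_eq_iff)
  qed
  then have "inj f" using lin by (simp add: linear_injective_0)
  then have "surj f" using lin linear_injective_imp_surjective by blast
  then obtain Y where Y: "f Y = (\<chi> i. b i)" by (metis surjD)
  then have "?N *\<^sub>R (\<Sum>j\<in>UNIV. Y $ j) = 0" using sum_f[of Y] assms by simp
  then have s: "(\<Sum>j\<in>UNIV. Y $ j) = 0" by simp
  have "lap a (($) Y) i = f Y $ i" for i by (simp add: f_def s)
  then show ?thesis using Y by (intro that[of "($) Y"]) simp
qed

end

section \<open>The Gram matrix of the measurement rows\<close>

lemma gram_inner:
  fixes H :: "real^'m^'n"
  shows "inner v (transpose H ** H *v v) = (\<Sum>i\<in>UNIV. (inner (H $ i) v)\<^sup>2)"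
proof -
  have "inner v (transpose H ** H *v v) = inner ((H *v v) v* H) v"
    by (simp add: matrix_vector_mul_assoc[symmetric] inner_commute del: matrix_vector_mul_assoc)
  also have "\<dots> = inner (H *v v) (H *v v)" by (rule dot_lmul_matrix)
  also have "\<dots> = (\<Sum>i\<in>UNIV. (inner (H $ i) v)\<^sup>2)"
    by (simp add: inner_vec_def matrix_vector_mult_def power2_eq_square)
  finally show ?thesis .
qed

lemma gram_symmetric: "transpose (transpose H ** H) = transpose H ** (H :: real^'m^'n)"
  by (simp add: matrix_transpose_mul)

text \<open>Tested with the vector \<open>H $ i\<close> itself, the quadratic form of the Gram
  matrix contains the fourth power of the norm of that row as one summand.\<close>

lemma row_le_last_eigenvalue:
  fixes H :: "real^'m^'n"
  shows "(norm (H $ i))\<^sup>2 \<le> last (eigenvalues (transpose H ** H))"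
proof (cases "H $ i = 0")
  case True
  have "0 \<le> last (eigenvalues (transpose H ** H)) * inner v v" for v :: "real^'m"
    using rayleigh_le_last_eigenvalue[OF gram_symmetric, of v H]
      sum_nonneg[of UNIV "\<lambda>i. (inner (H $ i) v)\<^sup>2"] by (simp add: gram_inner)
  \<comment> \<open>For a zero row it remains to see that the largest eigenvalue is nonnegative; the
    all-ones vector is a nonzero test vector.\<close>
  from this[of 1] have "0 \<le> last (eigenvalues (transpose H ** H))"
    by (simp add: inner_vec_def zero_le_mult_iff)
  then show ?thesis using True by simp
next
  case False
  let ?v = "H $ i"
  have "(inner ?v ?v)\<^sup>2 \<le> (\<Sum>j\<in>UNIV. (inner (H $ j) ?v)\<^sup>2)"
    by (rule member_le_sum) auto
  also have "\<dots> \<le> last (eigenvalues (transpose H ** H)) * inner ?v ?v"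
    using rayleigh_le_last_eigenvalue[OF gram_symmetric, of ?v H] by (simp add: gram_inner)
  finally have "inner ?v ?v * inner ?v ?v \<le> last (eigenvalues (transpose H ** H)) * inner ?v ?v"
    by (simp add: power2_eq_square)
  then show ?thesis using False by (simp add: power2_norm_eq_inner mult_le_cancel_right)
qed

lemma full_rank_gram_pos:
  fixes H :: "real^'m^'n"
  assumes "rank H = CARD('m)" "v \<noteq> 0"
  shows "0 < (\<Sum>i\<in>UNIV. (inner (H $ i) v)\<^sup>2)"
proof -
  have "H *v v \<noteq> 0"
    using assms full_rank_injective[of H] by (metis injD matrix_vector_mult_0_right)
  then obtain i where "inner (H $ i) v \<noteq> 0"
    by (auto simp: Finite_Cartesian_Product.vec_eq_iff matrix_vector_mult_def inner_vec_def)
  then show ?thesis by (intro sum_pos2[of _ i]) auto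
qed

text \<open>Written as a sum over the nodes, the normal equation becomes the solvability condition
  of the Laplacian equation that defines the equilibrium.\<close>

lemma least_squares_normal_equation:
  fixes H :: "real^'m^'n"
  assumes "rank H = CARD('m)"
  shows "(\<Sum>i\<in>UNIV. (inner (H $ i) (least_squares H z) - z $ i) *\<^sub>R H $ i) = 0"
proof -
  let ?G = "transpose H ** H" and ?y = "least_squares H z"
  have "v = 0" if "?G *v v = 0" for v
    using full_rank_gram_pos[OF assms, of v] gram_inner[of v H] that by (cases "v = 0") auto
  then have "invertible ?G"
    by (simp add: invertible_left_inverse matrix_left_invertible_ker)
  then have "?G ** matrix_inv ?G = Finite_Cartesian_Product.mat 1"
    unfolding matrix_inv_def invertible_def by (rule someI2_ex) simp
  then have "?G *v ?y = transpose H *v z"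
    unfolding least_squares_def matrix_vector_mul_assoc[of ?G] by simp
  then have "transpose H *v (H *v ?y - z) = 0"
    by (simp add: matrix_vector_mul_assoc matrix_vector_mult_diff_distrib)
  moreover have "(transpose H *v (H *v ?y - z)) $ j
      = (\<Sum>i\<in>UNIV. (inner (H $ i) ?y - z $ i) *\<^sub>R H $ i) $ j" for j
    by (simp add: matrix_vector_mult_def transpose_def inner_vec_def mult.commute)
  ultimately show ?thesis by (simp add: Finite_Cartesian_Product.vec_eq_iff)
qed

lemma lambda_bounds:
  fixes a :: "real^'n^'n" and H :: "real^'m^'n"
  assumes "CARD('n) \<ge> 2" "adjacency_matrix a" "weight_balanced a" "strongly_connected a"
    and rank: "rank H = CARD('m)"
  shows "0 < lambda_lower a H" "lambda_lower a H \<le> eigenvalues (sym_part (laplacian a)) ! 1"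
    "lambda_lower a H \<le> lambda_upper a H" "(\<Sum>j\<in>UNIV. a $ i $ j) \<le> lambda_upper a H"
    "(norm (H $ i))\<^sup>2 \<le> lambda_upper a H"
proof -
  note graph = assms(1-4)
  have "0 < hd (eigenvalues (transpose H ** H))"
    using full_rank_gram_pos[OF rank] by (intro hd_eigenvalues_pos[OF gram_symmetric]) (simp add: gram_inner)
  then show "0 < lambda_lower a H"
    using laplacian_second_eigenvalue(1)[OF graph] by (simp add: lambda_lower_def)
  show "lambda_lower a H \<le> eigenvalues (sym_part (laplacian a)) ! 1"
    by (simp add: lambda_lower_def)
  then show "lambda_lower a H \<le> lambda_upper a H"
    using laplacian_second_eigenvalue(2)[OF graph] by (simp add: lambda_upper_def)
  show "(\<Sum>j\<in>UNIV. a $ i $ j) \<le> lambda_upper a H"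
    using degree_le_last_eigenvalue[OF graph, of i] by (simp add: lambda_upper_def)
  show "(norm (H $ i))\<^sup>2 \<le> lambda_upper a H"
    using row_le_last_eigenvalue[of H i] by (simp add: lambda_upper_def)
qed

section \<open>Dissipativity of the network\<close>

lemma gram_coercive:
  fixes H :: "real^'m^'n"
  assumes "rank H = CARD('m)"
  obtains g where "g > 0" "\<And>y. g * (norm y)\<^sup>2 \<le> (\<Sum>i\<in>UNIV. (inner (H $ i) y)\<^sup>2)"
proof -
  have "(1 :: real^'m) \<noteq> 0" by (simp add: Finite_Cartesian_Product.vec_eq_iff)
  then have "\<exists>v\<in>(UNIV :: (real^'m) set). v \<noteq> 0" by blast
  then obtain m u where u: "u \<noteq> 0" "(transpose H ** H) *v u = m *\<^sub>R u"
    "\<And>v. m * inner v v \<le> inner v ((transpose H ** H) *v v)"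
    by (rule symmetric_min_eigenvector[OF gram_symmetric[of H] subspace_UNIV UNIV_I]) simp
  have "0 < m * inner u u"
    using full_rank_gram_pos[OF assms u(1)] gram_inner[of u H] u(2) by simp
  then have "0 < m" by (rule zero_less_mult_pos2) (simp add: u(1))
  then show ?thesis using u(3) that[of m] by (simp add: gram_inner power2_norm_eq_inner)
qed

text \<open>Each of the two sums alone is degenerate: node \<open>i\<close> measures
  \<open>X i\<close> in one direction at most, and the deviation is blind to a common value. Full
  column rank recovers the common vector \<open>y\<close> from the measurements up to the deviation,
  and \<open>X i\<close> is \<open>y\<close> plus its own deviation.\<close>

lemma rank_deviation_coercive:
  fixes H :: "real^'m^'n"
  assumes rank: "rank H = CARD('m)" and up: "\<And>i. (norm (H $ i))\<^sup>2 \<le> up"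
  obtains c where "c > 0" "\<And>X y. c * (\<Sum>i\<in>UNIV. (norm (X i))\<^sup>2)
    \<le> (\<Sum>i\<in>UNIV. (inner (H $ i) (X i))\<^sup>2) + (\<Sum>i\<in>UNIV. (norm (X i - y))\<^sup>2)"
proof -
  obtain g where g: "g > 0" "\<And>y. g * (norm y)\<^sup>2 \<le> (\<Sum>i\<in>UNIV. (inner (H $ i) y)\<^sup>2)"
    using gram_coercive[OF rank] by blast
  define N where "N = real CARD('n)"
  have N: "0 < N" by (simp add: N_def)
  have L0: "0 \<le> up" using up[of undefined] zero_le_power2 order_trans by blast
  define K where "K = 4 * N / g + 4 * N * up / g + 2"
  have K: "0 < K" using g(1) N L0 by (auto simp: K_def intro!: add_nonneg_pos add_nonneg_nonneg)
  have "(\<Sum>i\<in>UNIV. (norm (X i))\<^sup>2)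
    \<le> K * ((\<Sum>i\<in>UNIV. (inner (H $ i) (X i))\<^sup>2) + (\<Sum>i\<in>UNIV. (norm (X i - y))\<^sup>2))" for X y
  proof -
    define \<alpha> where "\<alpha> = (\<Sum>i\<in>UNIV. (inner (H $ i) (X i))\<^sup>2)"
    define b where "b = (\<Sum>i\<in>UNIV. (norm (X i - y))\<^sup>2)"
    have pos: "0 \<le> \<alpha>" "0 \<le> b" by (auto simp: \<alpha>_def b_def intro: sum_nonneg)
    have sq: "(p + q)\<^sup>2 \<le> 2 * p\<^sup>2 + 2 * q\<^sup>2" for p q :: real
      using zero_le_power2[of "p - q"] by (simp add: power2_eq_square algebra_simps)
    have "(inner (H $ i) y)\<^sup>2 \<le> 2 * (inner (H $ i) (X i))\<^sup>2 + 2 * up * (norm (X i - y))\<^sup>2" for i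
    proof -
      have "(inner (H $ i) y)\<^sup>2 = (inner (H $ i) (X i) + inner (H $ i) (y - X i))\<^sup>2"
        by (simp add: inner_diff_right)
      also have "\<dots> \<le> 2 * (inner (H $ i) (X i))\<^sup>2 + 2 * (inner (H $ i) (y - X i))\<^sup>2" by (rule sq)
      also have "(inner (H $ i) (y - X i))\<^sup>2 \<le> (norm (H $ i))\<^sup>2 * (norm (X i - y))\<^sup>2"
        using Cauchy_Schwarz_ineq[of "H $ i" "y - X i"]
        by (simp add: power2_norm_eq_inner norm_minus_commute[of "X i"])
      also have "\<dots> \<le> up * (norm (X i - y))\<^sup>2" by (intro mult_right_mono up) simp
      finally show ?thesis by simp
    qed
    then have "(\<Sum>i\<in>UNIV. (inner (H $ i) y)\<^sup>2)
        \<le> (\<Sum>i\<in>UNIV. 2 * (inner (H $ i) (X i))\<^sup>2 + 2 * up * (norm (X i - y))\<^sup>2)" by (rule sum_mono)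
    also have "\<dots> = 2 * \<alpha> + 2 * up * b"
      by (simp add: \<alpha>_def b_def sum.distrib sum_distrib_left)
    finally have y: "(norm y)\<^sup>2 \<le> (2 * \<alpha> + 2 * up * b) / g"
      using g(2)[of y] g(1) by (simp add: pos_le_divide_eq mult.commute)
    have "(norm (X i))\<^sup>2 \<le> 2 * (norm y)\<^sup>2 + 2 * (norm (X i - y))\<^sup>2" for i
    proof -
      have "(norm (X i))\<^sup>2 \<le> (norm y + norm (X i - y))\<^sup>2"
        using norm_triangle_ineq[of y "X i - y"] by (intro power_mono) auto
      also note sq
      finally show ?thesis .
    qed
    then have "(\<Sum>i\<in>UNIV. (norm (X i))\<^sup>2) \<le> (\<Sum>i\<in>UNIV. 2 * (norm y)\<^sup>2 + 2 * (norm (X i - y))\<^sup>2)"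
      by (rule sum_mono)
    also have "\<dots> = 2 * N * (norm y)\<^sup>2 + 2 * b"
      by (simp add: b_def N_def sum.distrib sum_distrib_left)
    also have "\<dots> \<le> 2 * N * ((2 * \<alpha> + 2 * up * b) / g) + 2 * b"
      using y N by (intro add_right_mono mult_left_mono) auto
    also have "\<dots> = 4 * N / g * \<alpha> + (4 * N * up / g + 2) * b"
      by (simp add: add_divide_distrib algebra_simps)
    also have "\<dots> \<le> K * \<alpha> + K * b"
      using pos g(1) N L0 unfolding K_def by (intro add_mono mult_right_mono) auto
    finally show ?thesis by (simp add: \<alpha>_def b_def distrib_left)
  qed
  then show ?thesis using K that[of "1 / K"] by (simp add: pos_divide_le_eq mult.commute)
qed

text \<open>Three quantities are damped: the measured part \<open>\<alpha>\<close> through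
  \<open>\<kappa>\<^sub>1\<close>, the disagreement \<open>b\<close> of \<open>X\<close> through
  \<open>\<kappa>\<^sub>2\<close>, and the disagreement \<open>q\<close> of \<open>s\<close> at the
  rate \<open>Q\<close>. Once the cross terms are paid for, the coercivity of
  \<open>\<alpha> + b\<close> yields the full norm of \<open>X\<close>.\<close>

lemma lyapunov_dissipation:
  fixes a :: "real^'n^'n" and H :: "real^'m^'n"
  assumes graph: "CARD('n) \<ge> 2" "adjacency_matrix a" "weight_balanced a" "strongly_connected a"
    and rank: "rank H = CARD('m)"
    and \<kappa>: "\<kappa>\<^sub>1 \<ge> 1"
      "\<kappa>\<^sub>2 \<ge> 6 * real CARD('n) * lambda_upper a H ^ 4 * \<kappa>\<^sub>1\<^sup>2 / lambda_lower a H ^ 4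
                * max 1 (1 / lambda_lower a H)"
  obtains \<rho> c C where "\<rho> > 0" "c > 0" "C > 0"
    "\<And>(X :: 'n \<Rightarrow> real^'m) s u.
      (\<Sum>i\<in>UNIV. inner (X i) (- \<kappa>\<^sub>1 *\<^sub>R ((inner (H $ i) (X i) + u i) *\<^sub>R H $ i) - \<kappa>\<^sub>2 *\<^sub>R lap a X i - lap a s i))
      + \<rho> * (\<Sum>i\<in>UNIV. inner (s i - (1 / real CARD('n)) *\<^sub>R (\<Sum>j\<in>UNIV. s j))
          (- \<kappa>\<^sub>1\<^sup>2 *\<^sub>R ((inner (H $ i) (X i) + u i) *\<^sub>R H $ i) - \<kappa>\<^sub>1 *\<^sub>R lap a s i))
      \<le> - c * (\<Sum>i\<in>UNIV. (norm (X i))\<^sup>2) + C * (\<Sum>i\<in>UNIV. (u i)\<^sup>2)"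
proof -
  define lo where "lo = lambda_lower a H"
  define up where "up = lambda_upper a H"
  note lb = lambda_bounds[OF graph rank, folded lo_def up_def]
  have lo: "0 < lo" "lo \<le> up" "0 < up" using lb(1,3) by auto
  have k1: "0 < \<kappa>\<^sub>1" using \<kappa>(1) by simp
  obtain c0 where c0: "c0 > 0" "\<And>X y. c0 * (\<Sum>i\<in>UNIV. (norm (X i))\<^sup>2)
    \<le> (\<Sum>i\<in>UNIV. (inner (H $ i) (X i))\<^sup>2) + (\<Sum>i\<in>UNIV. (norm (X i - y))\<^sup>2)"
    by (rule rank_deviation_coercive[OF rank lb(5)]) blast
  \<comment> \<open>\<open>\<rho>\<close> is tuned so that the damping
    \<open>\<rho> * \<kappa>\<^sub>1 * lo\<close> of \<open>q\<close> and the cost of coupling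
    \<open>s\<close> to the measurements, before Young factors, are both equal to \<open>Q\<close>.
    The two cross terms then take \<open>5/8 * Q\<close> and \<open>Q / 8\<close> and leave
    \<open>Q / 4\<close>. The weight \<open>p\<close> is determined by
    \<open>2 * up / p = Q / 8\<close>, and \<open>e\<close> is the reserve of damping kept for
    \<open>b\<close>.\<close>
  define Q where "Q = lo\<^sup>2 / (\<kappa>\<^sub>1 * up)"
  define \<rho> where "\<rho> = lo / (\<kappa>\<^sub>1\<^sup>2 * up)"
  define p where "p = 16 * up / Q"
  define e where "e = 4 * \<kappa>\<^sub>1 * up ^ 3 / lo\<^sup>2"
  define r where "r = lo / up"
  have pos: "0 < Q" "0 < \<rho>" "0 < p" "0 < e" "0 < r"
    using lo k1 by (auto simp: Q_def \<rho>_def p_def e_def r_def)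
  have rho1: "\<rho> * \<kappa>\<^sub>1\<^sup>2 = r" "\<rho> * \<kappa>\<^sub>1 * lo = Q"
    using lo k1 by (simp_all add: \<rho>_def r_def Q_def power2_eq_square)
  have rQ: "r\<^sup>2 * up / \<kappa>\<^sub>1 = Q"
    using lo k1 by (simp add: r_def Q_def power2_eq_square field_simps)
  have pQ: "2 * up / p = Q / 8" using pos lo by (simp add: p_def field_simps)
  \<comment> \<open>The two summands are 8 and 4 times
    \<open>\<kappa>\<^sub>1 * up ^ 3 / lo ^ 2\<close>. Having at least two nodes turns 12 into
    \<open>6 * CARD('n)\<close>; \<open>\<kappa>\<^sub>1 \<ge> 1\<close> and
    \<open>lo \<le> up\<close> supply the remaining factors.\<close>
  have k2: "p * up / 2 + e \<le> \<kappa>\<^sub>2 * lo"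
  proof -
    have "p * up / 2 + e = 12 * \<kappa>\<^sub>1 * up ^ 3 / lo ^ 2"
      using lo k1 by (simp add: p_def Q_def e_def power2_eq_square power3_eq_cube field_simps)
    also have "\<dots> = 12 * (\<kappa>\<^sub>1 * 1) * (up ^ 3 * lo) / lo ^ 4 * lo"
      using lo by (simp add: power2_eq_square power4_eq_xxxx)
    also have "\<dots> \<le> (6 * real CARD('n)) * (\<kappa>\<^sub>1 * \<kappa>\<^sub>1) * (up ^ 3 * up) / lo ^ 4 * lo"
      using lo \<kappa>(1) graph(1) by (intro mult_right_mono divide_right_mono mult_mono) auto
    also have "\<dots> = (6 * real CARD('n) * up ^ 4 * \<kappa>\<^sub>1\<^sup>2 / lo ^ 4) * 1 * lo"
      by (simp add: power2_eq_square power3_eq_cube power4_eq_xxxx mult_ac)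
    also have "\<dots> \<le> (6 * real CARD('n) * up ^ 4 * \<kappa>\<^sub>1\<^sup>2 / lo ^ 4) * max 1 (1 / lo) * lo"
      using lo by (intro mult_right_mono mult_left_mono) auto
    also have "\<dots> \<le> \<kappa>\<^sub>2 * lo"
      using \<kappa>(2) lo by (intro mult_right_mono) (auto simp: lo_def up_def)
    finally show ?thesis .
  qed
  define c where "c = min (\<kappa>\<^sub>1 / 4) e * c0"
  have c: "0 < c" using k1 pos c0 by (simp add: c_def)
  have main: "(\<Sum>i\<in>UNIV. inner (X i) (- \<kappa>\<^sub>1 *\<^sub>R ((inner (H $ i) (X i) + u i) *\<^sub>R H $ i) - \<kappa>\<^sub>2 *\<^sub>R lap a X i - lap a s i))
      + \<rho> * (\<Sum>i\<in>UNIV. inner (s i - (1 / real CARD('n)) *\<^sub>R (\<Sum>j\<in>UNIV. s j))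
          (- \<kappa>\<^sub>1\<^sup>2 *\<^sub>R ((inner (H $ i) (X i) + u i) *\<^sub>R H $ i) - \<kappa>\<^sub>1 *\<^sub>R lap a s i))
      \<le> - c * (\<Sum>i\<in>UNIV. (norm (X i))\<^sup>2) + (3 * \<kappa>\<^sub>1) * (\<Sum>i\<in>UNIV. (u i)\<^sup>2)"
    (is "?E1 + \<rho> * ?E2 \<le> _") for X :: "'n \<Rightarrow> real^'m" and s u
  proof -
    define m where "m = (1 / real CARD('n)) *\<^sub>R (\<Sum>j\<in>UNIV. X j)"
    define ms where "ms = (1 / real CARD('n)) *\<^sub>R (\<Sum>j\<in>UNIV. s j)"
    define S where "S i = s i - ms" for i
    define \<alpha> where "\<alpha> = (\<Sum>i\<in>UNIV. (inner (H $ i) (X i))\<^sup>2)"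
    define b where "b = (\<Sum>i\<in>UNIV. (norm (X i - m))\<^sup>2)"
    define q where "q = (\<Sum>i\<in>UNIV. (norm (S i))\<^sup>2)"
    define \<upsilon> where "\<upsilon> = (\<Sum>i\<in>UNIV. (u i)\<^sup>2)"
    define h where "h i = inner (H $ i) (X i)" for i
    define y where "y i = inner (H $ i) (S i)" for i
    have nn: "0 \<le> \<alpha>" "0 \<le> b" "0 \<le> q" "0 \<le> \<upsilon>"
      by (auto simp: \<alpha>_def b_def q_def \<upsilon>_def intro: sum_nonneg)
    have lapS: "lap a S = lap a s" by (simp add: S_def[abs_def] lap_shift)
    have orth: "(\<Sum>i\<in>UNIV. inner w (lap a s i)) = 0" for w
      by (simp add: inner_sum_right[symmetric] lap_sum_zero[OF graph(3)])
    have E1: "?E1 = - \<kappa>\<^sub>1 * (\<Sum>i\<in>UNIV. (h i + u i) * h i) - \<kappa>\<^sub>2 * (\<Sum>i\<in>UNIV. inner (X i) (lap a X i))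
        - (\<Sum>i\<in>UNIV. inner (X i) (lap a s i))"
      by (simp add: inner_diff_right sum_subtractf sum_distrib_left sum_negf h_def inner_commute[of "X _" "H $ _"]
          mult.assoc)
    have E2: "?E2 = - \<kappa>\<^sub>1\<^sup>2 * (\<Sum>i\<in>UNIV. (h i + u i) * y i) - \<kappa>\<^sub>1 * (\<Sum>i\<in>UNIV. inner (S i) (lap a s i))"
      unfolding ms_def[symmetric] S_def[symmetric]
      by (simp add: inner_diff_right sum_subtractf sum_distrib_left sum_negf h_def y_def
          inner_commute[of "S _" "H $ _"] mult.assoc)
    have P1: "lo * b \<le> (\<Sum>i\<in>UNIV. inner (X i) (lap a X i))"
    proof -
      have "lo * b \<le> eigenvalues (sym_part (laplacian a)) ! 1 * b"
        using lb(2) nn by (intro mult_right_mono)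
      then show ?thesis using lap_poincare[OF graph, of X] by (simp add: b_def m_def)
    qed
    have P2: "lo * q \<le> (\<Sum>i\<in>UNIV. inner (S i) (lap a s i))"
    proof -
      have "lo * q \<le> eigenvalues (sym_part (laplacian a)) ! 1 * q"
        using lb(2) nn by (intro mult_right_mono)
      also have "\<dots> \<le> (\<Sum>i\<in>UNIV. inner (s i) (lap a s i))"
        using lap_poincare[OF graph, of s] by (simp add: q_def S_def ms_def)
      also have "\<dots> = (\<Sum>i\<in>UNIV. inner (S i) (lap a s i))"
        using orth[of ms] by (simp add: S_def inner_diff_left sum_subtractf)
      finally show ?thesis .
    qed
    \<comment> \<open>The image of the Laplacian has zero sum and constants are in its kernel, so
      \<open>X\<close> and \<open>s\<close> may be replaced by their deviations. The cost then falls
      on \<open>b\<close>, which \<open>\<kappa>\<^sub>2\<close> damps, and not on the whole of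
      \<open>X\<close>.\<close>
    have P3: "- (\<Sum>i\<in>UNIV. inner (X i) (lap a s i)) \<le> p * up / 2 * b + Q / 8 * q"
    proof -
      have "- (\<Sum>i\<in>UNIV. inner (X i) (lap a s i)) = (\<Sum>i\<in>UNIV. inner (m - X i) (lap a S i))"
        using orth[of m] by (simp add: lapS inner_diff_left sum_subtractf)
      also have "\<dots> \<le> p * up / 2 * (\<Sum>i\<in>UNIV. (norm (m - X i))\<^sup>2) + 2 * up / p * (\<Sum>i\<in>UNIV. (norm (S i))\<^sup>2)"
        by (rule sum_inner_lap_cross[OF graph(3,2) lb(4) pos(3)])
      finally show ?thesis by (simp add: b_def q_def pQ norm_minus_commute)
    qed
    have P4: "- \<kappa>\<^sub>1 * (\<Sum>i\<in>UNIV. (h i + u i) * h i) \<le> - (3 / 4) * \<kappa>\<^sub>1 * \<alpha> + \<kappa>\<^sub>1 * \<upsilon>"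
    proof -
      have "- ((h i + u i) * h i) \<le> - (3 / 4) * (h i)\<^sup>2 + (u i)\<^sup>2" for i
        using zero_le_power2[of "h i / 2 + u i"] by (simp add: power2_eq_square algebra_simps)
      then have "(\<Sum>i\<in>UNIV. - ((h i + u i) * h i)) \<le> (\<Sum>i\<in>UNIV. - (3 / 4) * (h i)\<^sup>2 + (u i)\<^sup>2)"
        by (rule sum_mono)
      also have "\<dots> = - (3 / 4) * \<alpha> + \<upsilon>"
        by (simp only: sum.distrib sum_distrib_left[symmetric]) (simp add: \<alpha>_def \<upsilon>_def h_def)
      finally have "\<kappa>\<^sub>1 * (\<Sum>i\<in>UNIV. - ((h i + u i) * h i)) \<le> \<kappa>\<^sub>1 * (- (3 / 4) * \<alpha> + \<upsilon>)"
        using k1 by (intro mult_left_mono) auto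
      then show ?thesis unfolding sum_negf by (simp add: algebra_simps)
    qed
    have P5: "- r * (\<Sum>i\<in>UNIV. (h i + u i) * y i) \<le> \<kappa>\<^sub>1 / 2 * \<alpha> + 2 * \<kappa>\<^sub>1 * \<upsilon> + 5 / 8 * Q * q"
    proof -
      have "- r * ((h i + u i) * y i) \<le> \<kappa>\<^sub>1 / 2 * (h i)\<^sup>2 + 2 * \<kappa>\<^sub>1 * (u i)\<^sup>2 + 5 / 8 * Q * (norm (S i))\<^sup>2" for i
      proof -
        have A: "0 \<le> (\<kappa>\<^sub>1 * h i + r * y i)\<^sup>2 / (2 * \<kappa>\<^sub>1)" "0 \<le> (4 * \<kappa>\<^sub>1 * u i + r * y i)\<^sup>2 / (8 * \<kappa>\<^sub>1)"
          using k1 by auto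
        have B: "(\<kappa>\<^sub>1 * h i + r * y i)\<^sup>2 / (2 * \<kappa>\<^sub>1) = \<kappa>\<^sub>1 / 2 * (h i)\<^sup>2 + r * (h i * y i) + r\<^sup>2 * (y i)\<^sup>2 / (2 * \<kappa>\<^sub>1)"
          "(4 * \<kappa>\<^sub>1 * u i + r * y i)\<^sup>2 / (8 * \<kappa>\<^sub>1) = 2 * \<kappa>\<^sub>1 * (u i)\<^sup>2 + r * (u i * y i) + r\<^sup>2 * (y i)\<^sup>2 / (8 * \<kappa>\<^sub>1)"
          using k1 by (simp_all add: power2_eq_square field_simps)
        have "(y i)\<^sup>2 \<le> (norm (H $ i))\<^sup>2 * (norm (S i))\<^sup>2"
          using Cauchy_Schwarz_ineq[of "H $ i" "S i"] by (simp add: y_def power2_norm_eq_inner)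
        also have "\<dots> \<le> up * (norm (S i))\<^sup>2" by (intro mult_right_mono lb(5)) simp
        finally have "r\<^sup>2 / \<kappa>\<^sub>1 * (y i)\<^sup>2 \<le> r\<^sup>2 / \<kappa>\<^sub>1 * (up * (norm (S i))\<^sup>2)"
          using k1 by (intro mult_left_mono) auto
        also have "\<dots> = Q * (norm (S i))\<^sup>2" by (simp add: rQ[symmetric])
        finally have C: "r\<^sup>2 * (y i)\<^sup>2 / \<kappa>\<^sub>1 \<le> Q * (norm (S i))\<^sup>2" by simp
        have "- r * ((h i + u i) * y i) = - (r * (h i * y i)) - r * (u i * y i)" by (simp add: algebra_simps)
        also have "\<dots> \<le> \<kappa>\<^sub>1 / 2 * (h i)\<^sup>2 + 2 * \<kappa>\<^sub>1 * (u i)\<^sup>2 + 5 / 8 * (r\<^sup>2 * (y i)\<^sup>2 / \<kappa>\<^sub>1)"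
          using A unfolding B by simp
        finally show ?thesis using C by simp
      qed
      then have "(\<Sum>i\<in>UNIV. - r * ((h i + u i) * y i))
          \<le> (\<Sum>i\<in>UNIV. \<kappa>\<^sub>1 / 2 * (h i)\<^sup>2 + 2 * \<kappa>\<^sub>1 * (u i)\<^sup>2 + 5 / 8 * Q * (norm (S i))\<^sup>2)" by (rule sum_mono)
      then show ?thesis
        by (simp only: sum.distrib sum_distrib_left[symmetric]) (simp add: \<alpha>_def \<upsilon>_def q_def h_def)
    qed
    have "?E1 + \<rho> * ?E2 = - \<kappa>\<^sub>1 * (\<Sum>i\<in>UNIV. (h i + u i) * h i)
        - \<kappa>\<^sub>2 * (\<Sum>i\<in>UNIV. inner (X i) (lap a X i)) - (\<Sum>i\<in>UNIV. inner (X i) (lap a s i))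
        - r * (\<Sum>i\<in>UNIV. (h i + u i) * y i) - \<rho> * \<kappa>\<^sub>1 * (\<Sum>i\<in>UNIV. inner (S i) (lap a s i))"
      unfolding E1 E2 rho1(1)[symmetric] by (simp add: algebra_simps)
    also have "\<dots> \<le> (- (3 / 4) * \<kappa>\<^sub>1 * \<alpha> + \<kappa>\<^sub>1 * \<upsilon>) - \<kappa>\<^sub>2 * (lo * b) + (p * up / 2 * b + Q / 8 * q)
        + (\<kappa>\<^sub>1 / 2 * \<alpha> + 2 * \<kappa>\<^sub>1 * \<upsilon> + 5 / 8 * Q * q) - \<rho> * \<kappa>\<^sub>1 * (lo * q)"
    proof -
      have "0 < p * up / 2 + e" using pos lo by (intro add_pos_pos) auto
      then have "0 \<le> \<kappa>\<^sub>2" using k2 mult_neg_pos[of \<kappa>\<^sub>2 lo] lo by linarith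
      then have "\<kappa>\<^sub>2 * (lo * b) \<le> \<kappa>\<^sub>2 * (\<Sum>i\<in>UNIV. inner (X i) (lap a X i))"
        by (rule mult_left_mono[OF P1])
      moreover have "\<rho> * \<kappa>\<^sub>1 * (lo * q) \<le> \<rho> * \<kappa>\<^sub>1 * (\<Sum>i\<in>UNIV. inner (S i) (lap a s i))"
        using pos k1 by (intro mult_left_mono[OF P2]) auto
      ultimately show ?thesis using P3 P4 P5 by linarith
    qed
    also have "\<dots> = - (\<kappa>\<^sub>1 / 4) * \<alpha> - (\<kappa>\<^sub>2 * lo - p * up / 2) * b - Q / 4 * q + 3 * \<kappa>\<^sub>1 * \<upsilon>"
      by (simp add: rho1(2)[symmetric] algebra_simps)
    also have "\<dots> \<le> - (min (\<kappa>\<^sub>1 / 4) e) * \<alpha> - min (\<kappa>\<^sub>1 / 4) e * b + 3 * \<kappa>\<^sub>1 * \<upsilon>"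
    proof -
      have "min (\<kappa>\<^sub>1 / 4) e * \<alpha> \<le> \<kappa>\<^sub>1 / 4 * \<alpha>" using nn by (intro mult_right_mono) auto
      moreover have "min (\<kappa>\<^sub>1 / 4) e * b \<le> (\<kappa>\<^sub>2 * lo - p * up / 2) * b"
        using nn k2 by (intro mult_right_mono) auto
      moreover have "0 \<le> Q / 4 * q" using nn pos by auto
      ultimately show ?thesis by linarith
    qed
    also have "\<dots> \<le> - c * (\<Sum>i\<in>UNIV. (norm (X i))\<^sup>2) + 3 * \<kappa>\<^sub>1 * \<upsilon>"
    proof -
      have "min (\<kappa>\<^sub>1 / 4) e * (c0 * (\<Sum>i\<in>UNIV. (norm (X i))\<^sup>2)) \<le> min (\<kappa>\<^sub>1 / 4) e * (\<alpha> + b)"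
        using c0(2)[of X m] pos k1 by (intro mult_left_mono) (auto simp: \<alpha>_def b_def)
      then show ?thesis by (simp add: c_def algebra_simps)
    qed
    finally show ?thesis by (simp add: \<upsilon>_def)
  qed
  show ?thesis using that[OF pos(2) c _ main] k1 by simp
qed

text \<open>A predicate in \<open>K\<close>, so that \<open>K\<close> can be chosen from the data
  and the initial values, ahead of all trajectories, inputs \<open>u\<close> and energy bounds
  \<open>W\<close>.\<close>

definition network_gain ::
  "real^'n^'n \<Rightarrow> real^'m^'n \<Rightarrow> real \<Rightarrow> real \<Rightarrow> real^'n \<Rightarrow> ('n \<Rightarrow> real^'m) \<Rightarrow> ('n \<Rightarrow> real^'m) \<Rightarrow> real \<Rightarrow> bool" where
  "network_gain a H \<kappa>\<^sub>1 \<kappa>\<^sub>2 z x0 v0 K \<longleftrightarrow> (\<forall>x v u W.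
     (\<forall>i. primitive (\<lambda>t. - \<kappa>\<^sub>1 *\<^sub>R ((inner (H $ i) (x i t) - z $ i + u i t) *\<^sub>R (H $ i))
            - (\<kappa>\<^sub>1 + \<kappa>\<^sub>2) *\<^sub>R lap a (\<lambda>j. x j t) i - lap a (\<lambda>j. v j t) i) (x i)) \<longrightarrow>
     (\<forall>i. primitive (\<lambda>t. (\<kappa>\<^sub>1 * \<kappa>\<^sub>2) *\<^sub>R lap a (\<lambda>j. x j t) i) (v i)) \<longrightarrow>
     (\<forall>i. x i 0 = x0 i) \<longrightarrow> (\<forall>i. v i 0 = v0 i) \<longrightarrow> (\<forall>i. lbm (u i)) \<longrightarrow>
     (\<forall>i. \<forall>T\<ge>0. integral {0..T} (\<lambda>t. (u i t)\<^sup>2) \<le> W) \<longrightarrow>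
     (\<forall>i. \<forall>T\<ge>0. integral {0..T} (\<lambda>t. (norm (x i t - least_squares H z))\<^sup>2) \<le> K * (1 + W)))"

lemma network_L2_gain:
  fixes a :: "real^'n^'n" and H :: "real^'m^'n" and z :: "real^'n" and x0 v0 :: "'n \<Rightarrow> real^'m"
  assumes graph: "CARD('n) \<ge> 2" "adjacency_matrix a" "weight_balanced a" "strongly_connected a"
    and rank: "rank H = CARD('m)"
    and \<kappa>: "\<kappa>\<^sub>1 \<ge> 1"
      "\<kappa>\<^sub>2 \<ge> 6 * real CARD('n) * lambda_upper a H ^ 4 * \<kappa>\<^sub>1\<^sup>2 / lambda_lower a H ^ 4
                * max 1 (1 / lambda_lower a H)"
  shows "\<exists>K. network_gain a H \<kappa>\<^sub>1 \<kappa>\<^sub>2 z x0 v0 K"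
proof -
  define N where "N = real CARD('n)"
  have N: "0 < N" by (simp add: N_def)
  obtain \<rho> c C where pos: "\<rho> > 0" "c > 0" "C > 0" and diss: "\<And>(X :: 'n \<Rightarrow> real^'m) s u.
      (\<Sum>i\<in>UNIV. inner (X i) (- \<kappa>\<^sub>1 *\<^sub>R ((inner (H $ i) (X i) + u i) *\<^sub>R H $ i) - \<kappa>\<^sub>2 *\<^sub>R lap a X i - lap a s i))
      + \<rho> * (\<Sum>i\<in>UNIV. inner (s i - (1 / real CARD('n)) *\<^sub>R (\<Sum>j\<in>UNIV. s j))
          (- \<kappa>\<^sub>1\<^sup>2 *\<^sub>R ((inner (H $ i) (X i) + u i) *\<^sub>R H $ i) - \<kappa>\<^sub>1 *\<^sub>R lap a s i))
      \<le> - c * (\<Sum>i\<in>UNIV. (norm (X i))\<^sup>2) + C * (\<Sum>i\<in>UNIV. (u i)\<^sup>2)"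
    by (rule lyapunov_dissipation[OF graph rank \<kappa>]) blast
  define ys where "ys = least_squares H z"
  \<comment> \<open>At the least squares solution the residuals of the individual nodes need not
    vanish, only their weighted sum does. The equilibrium \<open>vs\<close> balances them node by
    node.\<close>
  have "(\<Sum>i\<in>UNIV. - \<kappa>\<^sub>1 *\<^sub>R ((inner (H $ i) ys - z $ i) *\<^sub>R H $ i)) = 0"
    using least_squares_normal_equation[OF rank, of z]
    by (simp add: ys_def sum_negf scaleR_sum_right[symmetric] del: scaleR_scaleR)
  then obtain vs where vs: "\<And>i. lap a vs i = - \<kappa>\<^sub>1 *\<^sub>R ((inner (H $ i) ys - z $ i) *\<^sub>R H $ i)"
    by (rule lap_solve[OF graph]) blast
  \<comment> \<open>The mean of \<open>s\<close> is not damped and has no influence on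
    \<open>X\<close>, so only the deviation from it enters the storage function
    \<open>U\<close>.\<close>
  define dev where "dev s i = s i - (1 / N) *\<^sub>R (\<Sum>j\<in>UNIV. s j)" for s :: "'n \<Rightarrow> real^'m" and i
  have dev_sum: "(\<Sum>i\<in>UNIV. dev s i) = 0" for s
    using N by (simp add: dev_def N_def sum_subtractf sum_constant_scaleR del: sum_constant)
  define U where "U X s = (1/2) * (\<Sum>i\<in>UNIV. inner (X i) (X i)) + \<rho> / 2 * (\<Sum>i\<in>UNIV. inner (dev s i) (dev s i))"
    for X s :: "'n \<Rightarrow> real^'m"
  define U0 where "U0 = U (\<lambda>i. x0 i - ys) (\<lambda>i. v0 i - vs i + \<kappa>\<^sub>1 *\<^sub>R (x0 i - ys))"
  have U_nonneg: "0 \<le> U X s" for X s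
    using pos by (auto simp: U_def intro!: add_nonneg_nonneg mult_nonneg_nonneg sum_nonneg)
  define K where "K = (U0 + C * N) / c"
  show ?thesis
    unfolding network_gain_def
  proof (intro exI[of _ K] allI impI)
    fix x v :: "'n \<Rightarrow> real \<Rightarrow> real^'m" and u :: "'n \<Rightarrow> real \<Rightarrow> real" and W T :: real and i0 :: 'n
    assume *: "\<forall>i. primitive (\<lambda>t. - \<kappa>\<^sub>1 *\<^sub>R ((inner (H $ i) (x i t) - z $ i + u i t) *\<^sub>R (H $ i))
            - (\<kappa>\<^sub>1 + \<kappa>\<^sub>2) *\<^sub>R lap a (\<lambda>j. x j t) i - lap a (\<lambda>j. v j t) i) (x i)"
      "\<forall>i. primitive (\<lambda>t. (\<kappa>\<^sub>1 * \<kappa>\<^sub>2) *\<^sub>R lap a (\<lambda>j. x j t) i) (v i)"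
      "\<forall>i. x i 0 = x0 i" "\<forall>i. v i 0 = v0 i" "\<forall>i. lbm (u i)"
      "\<forall>i. \<forall>T\<ge>0. integral {0..T} (\<lambda>t. (u i t)\<^sup>2) \<le> W" and T: "0 \<le> T"
    note px = *(1)[THEN spec] and pv = *(2)[THEN spec] and init = *(3)[THEN spec] *(4)[THEN spec]
      and u = *(5)[THEN spec] and W = *(6)[rule_format]
    define X where "X t i = x i t - ys" for t i
    \<comment> \<open>With this combination the terms in \<open>\<kappa>\<^sub>2\<close> cancel from
      the derivative \<open>ds\<close>: \<open>s\<close> is driven by the measurement residual and
      damped by \<open>\<kappa>\<^sub>1\<close> times the Laplacian.\<close>
    define s where "s t i = v i t - vs i + \<kappa>\<^sub>1 *\<^sub>R X t i" for t i
    define dX where "dX t i = - \<kappa>\<^sub>1 *\<^sub>R ((inner (H $ i) (X t i) + u i t) *\<^sub>R H $ i)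
      - \<kappa>\<^sub>2 *\<^sub>R lap a (X t) i - lap a (s t) i" for t i
    define ds where "ds t i = - \<kappa>\<^sub>1\<^sup>2 *\<^sub>R ((inner (H $ i) (X t i) + u i t) *\<^sub>R H $ i)
      - \<kappa>\<^sub>1 *\<^sub>R lap a (s t) i" for t i
    have lapX: "lap a (\<lambda>j. x j t) = lap a (X t)" for t
      unfolding X_def[abs_def] by (simp add: lap_shift)
    have laps: "lap a (s t) i = lap a (\<lambda>j. v j t) i - lap a vs i + \<kappa>\<^sub>1 *\<^sub>R lap a (X t) i" for t i
      by (simp add: s_def[abs_def] lap_add lap_diff lap_scaleR)
    have eX: "- \<kappa>\<^sub>1 *\<^sub>R ((inner (H $ i) (x i t) - z $ i + u i t) *\<^sub>R (H $ i))
            - (\<kappa>\<^sub>1 + \<kappa>\<^sub>2) *\<^sub>R lap a (\<lambda>j. x j t) i - lap a (\<lambda>j. v j t) i = dX t i" for t i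
      unfolding dX_def laps vs lapX by (simp add: X_def inner_diff_right algebra_simps)
    have pX: "primitive (\<lambda>t. dX t i) (\<lambda>t. X t i)" for i
      using primitive_diff[OF px[of i] primitive_const[of ys]] unfolding eX X_def by simp
    have eS: "(\<kappa>\<^sub>1 * \<kappa>\<^sub>2) *\<^sub>R lap a (\<lambda>j. x j t) i - 0 + \<kappa>\<^sub>1 *\<^sub>R dX t i = ds t i" for t i
      unfolding dX_def ds_def lapX by (simp add: algebra_simps power2_eq_square)
    have ps: "primitive (\<lambda>t. ds t i) (\<lambda>t. s t i)" for i
      using primitive_add[OF primitive_diff[OF pv[of i] primitive_const[of "vs i"]] primitive_scaleR[OF pX[of i], of \<kappa>\<^sub>1]]
      by (simp only: eS s_def[symmetric])
    have pdev: "primitive (\<lambda>t. dev (ds t) i) (\<lambda>t. dev (s t) i)" for i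
      unfolding dev_def by (intro primitive_diff primitive_scaleR primitive_sum ps)
    define g where "g t = (1/2) * (\<Sum>i\<in>UNIV. inner (dX t i) (X t i) + inner (X t i) (dX t i))
      + \<rho> / 2 * (\<Sum>i\<in>UNIV. inner (dev (ds t) i) (dev (s t) i) + inner (dev (s t) i) (dev (ds t) i))" for t
    have pU: "primitive g (\<lambda>t. U (X t) (s t))"
      unfolding U_def g_def
      by (intro primitive_add primitive_cmult primitive_sum primitive_inner pX pdev)
    have g: "g t \<le> - c * (\<Sum>i\<in>UNIV. (norm (X t i))\<^sup>2) + C * (\<Sum>i\<in>UNIV. (u i t)\<^sup>2)" for t
    proof -
      have "(\<Sum>i\<in>UNIV. inner (dev (s t) i) (dev (ds t) i)) = (\<Sum>i\<in>UNIV. inner (dev (s t) i) (ds t i))"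
      proof -
        have "(\<Sum>i\<in>UNIV. inner (dev (s t) i) ((1 / N) *\<^sub>R (\<Sum>j\<in>UNIV. ds t j))) = 0"
          by (subst inner_sum_left[symmetric]) (simp add: dev_sum)
        then show ?thesis
          by (simp add: dev_def[of "ds t"] inner_diff_right sum_subtractf)
      qed
      then have "g t = (\<Sum>i\<in>UNIV. inner (X t i) (dX t i)) + \<rho> * (\<Sum>i\<in>UNIV. inner (dev (s t) i) (ds t i))"
        by (simp add: g_def inner_commute[of "dX t _"] inner_commute[of "dev (ds t) _"]
            sum_distrib_left[symmetric])
      also have "\<dots> \<le> - c * (\<Sum>i\<in>UNIV. (norm (X t i))\<^sup>2) + C * (\<Sum>i\<in>UNIV. (u i t)\<^sup>2)"
        unfolding dX_def ds_def dev_def N_def by (rule diss)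
      finally show ?thesis .
    qed
    define n where "n t = (\<Sum>i\<in>UNIV. (norm (X t i))\<^sup>2)" for t
    define w where "w t = (\<Sum>i\<in>UNIV. (u i t)\<^sup>2)" for t
    have lX: "lbm (\<lambda>t. X t i)" for i by (rule primitive_lbm[OF pX])
    have ln: "lbm n" and lw: "lbm w"
      unfolding n_def w_def by (intro lbm_intros lX u)+
    have "U (X T) (s T) - U (X 0) (s 0) \<le> integral {0..T} (\<lambda>t. - c * n t + C * w t)"
      using g by (intro primitive_le_integral[OF pU _ _ T] lbm_add lbm_cmult ln lw) (simp add: n_def w_def)
    also have "\<dots> = - c * integral {0..T} n + C * integral {0..T} w"
      by (subst integral_add) (auto intro!: lbm_integrable lbm_cmult lbm_minus ln lw)
    also have "integral {0..T} w = (\<Sum>i\<in>UNIV. integral {0..T} (\<lambda>t. (u i t)\<^sup>2))"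
      unfolding w_def by (intro integral_sum) (auto intro!: lbm_integrable lbm_power2 u)
    also have "\<dots> \<le> (\<Sum>i\<in>(UNIV::'n set). W)" by (intro sum_mono W T)
    also have "U (X 0) (s 0) = U0"
      by (simp add: U0_def X_def[abs_def] s_def[abs_def] init)
    finally have "c * integral {0..T} n \<le> U0 + C * N * W"
      using U_nonneg[of "X T" "s T"] pos by (simp add: N_def mult_ac)
    also have "\<dots> \<le> (U0 + C * N) * (1 + W)"
    proof -
      have "0 \<le> W" using integral_nonneg_lbm[OF lbm_power2[OF u[of i0]], of 0 0] W[of 0 i0] by simp
      moreover have "0 \<le> U0" by (simp add: U0_def U_nonneg)
      ultimately have "0 \<le> U0 * W" "0 \<le> C * N" using pos N by auto
      then show ?thesis by (simp add: algebra_simps)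
    qed
    finally have "integral {0..T} n \<le> K * (1 + W)"
      using pos by (simp add: K_def pos_le_divide_eq mult.commute)
    moreover have "integral {0..T} (\<lambda>t. (norm (X t i0))\<^sup>2) \<le> integral {0..T} n"
      unfolding n_def
      by (rule integral_mono_lbm[OF _ ln[unfolded n_def]]) (auto intro!: lbm_power2 lbm_norm lX member_le_sum)
    ultimately show "integral {0..T} (\<lambda>t. (norm (x i0 t - least_squares H z))\<^sup>2) \<le> K * (1 + W)"
      by (simp add: X_def ys_def)
  qed
qed

section \<open>Square integrability uniform in the disturbance\<close>

text \<open>\<open>p\<close> stands for a whole trajectory and \<open>S p W\<close> for its
  admissibility with disturbance energy at most \<open>W\<close>; \<open>K\<close> is chosen before
  both. Measurability and \<open>0 \<le> W\<close> belong to the predicate, so that sums and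
  multiples of families come without side conditions.\<close>

definition L2_family :: "('p \<Rightarrow> real \<Rightarrow> bool) \<Rightarrow> ('p \<Rightarrow> real \<Rightarrow> 'a::euclidean_space) \<Rightarrow> bool" where
  "L2_family S f \<longleftrightarrow> (\<exists>K\<ge>0. \<forall>p W. S p W \<longrightarrow>
     0 \<le> W \<and> lbm (f p) \<and> (\<forall>T\<ge>0. integral {0..T} (\<lambda>t. (norm (f p t))\<^sup>2) \<le> K * (1 + W)))"

lemma L2_familyI:
  assumes "K \<ge> 0" "\<And>p W. S p W \<Longrightarrow> 0 \<le> W" "\<And>p W. S p W \<Longrightarrow> lbm (f p)"
    "\<And>p W T. S p W \<Longrightarrow> 0 \<le> T \<Longrightarrow> integral {0..T} (\<lambda>t. (norm (f p t))\<^sup>2) \<le> K * (1 + W)"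
  shows "L2_family S f"
  unfolding L2_family_def using assms by (intro exI[of _ K]) simp

lemma L2_family_lbm: "L2_family S f \<Longrightarrow> S p W \<Longrightarrow> lbm (f p)"
  by (auto simp: L2_family_def)

lemma L2_family_dominated:
  fixes f :: "'p \<Rightarrow> real \<Rightarrow> 'a::euclidean_space" and g :: "'p \<Rightarrow> real \<Rightarrow> 'b::euclidean_space"
  assumes g: "L2_family S g" and f: "\<And>p W. S p W \<Longrightarrow> lbm (f p)"
    and le: "\<And>p W t. S p W \<Longrightarrow> 0 \<le> t \<Longrightarrow> norm (f p t) \<le> B * norm (g p t)"
  shows "L2_family S f"
proof -
  obtain K where K: "K \<ge> 0" "\<And>p W. S p W \<Longrightarrow> 0 \<le> W" "\<And>p W. S p W \<Longrightarrow> lbm (g p)"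
    "\<And>p W T. S p W \<Longrightarrow> 0 \<le> T \<Longrightarrow> integral {0..T} (\<lambda>t. (norm (g p t))\<^sup>2) \<le> K * (1 + W)"
    using g unfolding L2_family_def by auto
  show ?thesis
  proof (rule L2_familyI[of "B\<^sup>2 * K"])
    fix p W T assume S: "S p W" and T: "0 \<le> (T::real)"
    have "integral {0..T} (\<lambda>t. (norm (f p t))\<^sup>2) \<le> integral {0..T} (\<lambda>t. B\<^sup>2 * (norm (g p t))\<^sup>2)"
      by (rule integral_mono_lbm)
         (use power_mono[OF le[OF S]] in \<open>auto intro!: lbm_power2 lbm_norm lbm_cmult f[OF S] K(3)[OF S] simp: power_mult_distrib\<close>)
    also have "\<dots> \<le> B\<^sup>2 * (K * (1 + W))"
      using K(4)[OF S T] by (simp add: mult_left_mono)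
    finally show "integral {0..T} (\<lambda>t. (norm (f p t))\<^sup>2) \<le> B\<^sup>2 * K * (1 + W)" by (simp add: mult.assoc)
  qed (use K f in auto)
qed

lemma L2_family_add:
  fixes f g :: "'p \<Rightarrow> real \<Rightarrow> 'a::euclidean_space"
  assumes f: "L2_family S f" and g: "L2_family S g"
  shows "L2_family S (\<lambda>p t. f p t + g p t)"
proof -
  obtain K where K: "K \<ge> 0" "\<And>p W. S p W \<Longrightarrow> 0 \<le> W" "\<And>p W. S p W \<Longrightarrow> lbm (f p)"
    "\<And>p W T. S p W \<Longrightarrow> 0 \<le> T \<Longrightarrow> integral {0..T} (\<lambda>t. (norm (f p t))\<^sup>2) \<le> K * (1 + W)"
    using f unfolding L2_family_def by auto
  obtain L where L: "L \<ge> 0" "\<And>p W. S p W \<Longrightarrow> 0 \<le> W" "\<And>p W. S p W \<Longrightarrow> lbm (g p)"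
    "\<And>p W T. S p W \<Longrightarrow> 0 \<le> T \<Longrightarrow> integral {0..T} (\<lambda>t. (norm (g p t))\<^sup>2) \<le> L * (1 + W)"
    using g unfolding L2_family_def by auto
  show ?thesis
  proof (rule L2_familyI[of "2 * K + 2 * L"])
    fix p W T assume S: "S p W" and T: "0 \<le> (T::real)"
    have sq: "(norm (x + y))\<^sup>2 \<le> 2 * (norm x)\<^sup>2 + 2 * (norm y)\<^sup>2" for x y :: 'a
    proof -
      have "(norm (x + y))\<^sup>2 \<le> (norm x + norm y)\<^sup>2" by (intro power_mono norm_triangle_ineq) simp
      then show ?thesis
        using zero_le_power2[of "norm x - norm y"] by (simp add: power2_eq_square algebra_simps)
    qed
    note l = K(3)[OF S] L(3)[OF S]
    have "integral {0..T} (\<lambda>t. (norm (f p t + g p t))\<^sup>2)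
        \<le> integral {0..T} (\<lambda>t. 2 * (norm (f p t))\<^sup>2 + 2 * (norm (g p t))\<^sup>2)"
      by (rule integral_mono_lbm[OF _ _ _ sq]) (auto intro!: lbm_power2 lbm_norm lbm_cmult lbm_add l)
    also have "\<dots> = 2 * integral {0..T} (\<lambda>t. (norm (f p t))\<^sup>2) + 2 * integral {0..T} (\<lambda>t. (norm (g p t))\<^sup>2)"
      by (subst integral_add) (auto intro!: lbm_integrable lbm_power2 lbm_norm lbm_cmult l)
    also have "\<dots> \<le> 2 * (K * (1 + W)) + 2 * (L * (1 + W))"
      using K(4)[OF S T] L(4)[OF S T] by simp
    finally show "integral {0..T} (\<lambda>t. (norm (f p t + g p t))\<^sup>2) \<le> (2 * K + 2 * L) * (1 + W)"
      by (simp add: algebra_simps)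
  qed (use K L in \<open>auto intro!: lbm_add\<close>)
qed

lemma L2_family_mult_left:
  fixes f :: "'p \<Rightarrow> real \<Rightarrow> 'a::{euclidean_space, real_normed_algebra}"
  assumes "L2_family S f" shows "L2_family S (\<lambda>p t. c * f p t)"
  by (rule L2_family_dominated[OF assms, of _ "norm c"])
     (auto intro!: lbm_bounded_linear[OF bounded_linear_mult_right] L2_family_lbm[OF assms] norm_mult_ineq)

lemma L2_family_minus: "L2_family S f \<Longrightarrow> L2_family S (\<lambda>p t. - f p t)"
  by (rule L2_family_dominated[where B=1]) (auto intro!: lbm_minus dest: L2_family_lbm)

lemma L2_family_diff: "L2_family S f \<Longrightarrow> L2_family S g \<Longrightarrow> L2_family S (\<lambda>p t. f p t - g p t)"
  using L2_family_add[OF _ L2_family_minus, of S f g] by simp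

lemma L2_family_zero:
  assumes "L2_family S g" shows "L2_family S (\<lambda>p t. 0)"
  by (rule L2_family_dominated[OF assms, of _ 0]) (auto intro: lbm_const)

lemma L2_family_sum:
  assumes "L2_family S g" and f: "\<And>i. i \<in> I \<Longrightarrow> L2_family S (f i)"
  shows "L2_family S (\<lambda>p t. \<Sum>i\<in>I. f i p t)"
  using f by (induction I rule: infinite_finite_induct)
    (simp_all add: L2_family_zero[OF assms(1)] L2_family_add)

text \<open>The squared modulus of \<open>g\<close> is a Lyapunov function, and Young's inequality
  splits the input term. Complex values are used because \<open>c\<close> will be a root of a real
  polynomial.\<close>

lemma first_order_L2:
  fixes g u :: "'p \<Rightarrow> real \<Rightarrow> complex"
  assumes neg: "Re c < 0" and u: "L2_family S u"
    and g: "\<And>p W. S p W \<Longrightarrow> primitive (\<lambda>t. c * g p t + u p t) (g p)" "\<And>p W. S p W \<Longrightarrow> g p 0 = g0"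
  shows "L2_family S g"
proof -
  obtain K where K: "K \<ge> 0" "\<And>p W. S p W \<Longrightarrow> 0 \<le> W" "\<And>p W. S p W \<Longrightarrow> lbm (u p)"
    "\<And>p W T. S p W \<Longrightarrow> 0 \<le> T \<Longrightarrow> integral {0..T} (\<lambda>t. (norm (u p t))\<^sup>2) \<le> K * (1 + W)"
    using u unfolding L2_family_def by auto
  define r where "r = - Re c"
  have r: "0 < r" using neg by (simp add: r_def)
  show ?thesis
  proof (rule L2_familyI[of "((norm g0)\<^sup>2 + K / r) / r"])
    show "((norm g0)\<^sup>2 + K / r) / r \<ge> 0" using K(1) r by auto
  next
    fix p W T assume S: "S p W" and T: "0 \<le> (T::real)"
    note pr = g(1)[OF S]
    have lg: "lbm (g p)" by (rule primitive_lbm[OF pr])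
    let ?rhs = "\<lambda>t. (1 / r) * (norm (u p t))\<^sup>2 - r * (norm (g p t))\<^sup>2"
    have le: "inner (c * x + y) x + inner x (c * x + y) \<le> (1 / r) * (norm y)\<^sup>2 - r * (norm x)\<^sup>2"
      for x y :: complex
    proof -
      have "inner x (c * x) = - r * (norm x)\<^sup>2"
        unfolding cmod_power2 by (simp add: inner_complex_def r_def power2_eq_square algebra_simps)
      then have "inner (c * x + y) x + inner x (c * x + y) = - 2 * r * (norm x)\<^sup>2 + 2 * inner x y"
        by (simp add: inner_commute[of _ x] inner_add_right)
      also have "inner x y \<le> norm x * norm y" by (rule norm_cauchy_schwarz)
      also have "2 * (norm x * norm y) \<le> r * (norm x)\<^sup>2 + (1 / r) * (norm y)\<^sup>2"
      proof -
        have "0 \<le> (r * norm x - norm y)\<^sup>2 / r" using r by simp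
        also have "\<dots> = r * (norm x)\<^sup>2 + (1 / r) * (norm y)\<^sup>2 - 2 * (norm x * norm y)"
          using r by (simp add: power2_eq_square field_simps)
        finally show ?thesis by simp
      qed
      finally show ?thesis by simp
    qed
    have "inner (g p T) (g p T) - inner (g p 0) (g p 0) \<le> integral {0..T} ?rhs"
      by (rule primitive_le_integral[OF primitive_inner[OF pr pr] _ le T])
         (intro lbm_diff lbm_cmult lbm_power2 lbm_norm lg K(3)[OF S])
    also have "\<dots> = (1 / r) * integral {0..T} (\<lambda>t. (norm (u p t))\<^sup>2) - r * integral {0..T} (\<lambda>t. (norm (g p t))\<^sup>2)"
      by (subst integral_diff)
         (simp_all only: integral_mult_right, (intro lbm_integrable lbm_cmult lbm_power2 lbm_norm lg K(3)[OF S] order_refl)+)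
    finally have "r * integral {0..T} (\<lambda>t. (norm (g p t))\<^sup>2)
        \<le> (norm g0)\<^sup>2 + (1 / r) * integral {0..T} (\<lambda>t. (norm (u p t))\<^sup>2)"
      using inner_ge_zero[of "g p T"] unfolding g(2)[OF S] power2_norm_eq_inner by linarith
    also have "\<dots> \<le> (norm g0)\<^sup>2 + (1 / r) * (K * (1 + W))"
      using K(4)[OF S T] r by (intro add_left_mono mult_left_mono) auto
    also have "\<dots> \<le> ((norm g0)\<^sup>2 + K / r) * (1 + W)"
      using K(2)[OF S] by (simp add: algebra_simps add_divide_distrib)
    finally show "integral {0..T} (\<lambda>t. (norm (g p t))\<^sup>2) \<le> ((norm g0)\<^sup>2 + K / r) / r * (1 + W)"
      using r by (simp add: pos_le_divide_eq mult.commute)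
  qed (auto intro: K(2) primitive_lbm[OF g(1)])
qed

section \<open>Companion systems with stable characteristic polynomial\<close>

definition char_fun :: "nat \<Rightarrow> (nat \<Rightarrow> real) \<Rightarrow> complex \<Rightarrow> complex" where
  "char_fun n c s = s ^ n + (\<Sum>q<n. complex_of_real (c q) * s ^ q)"

text \<open>If the states are read as a signal and its successive derivatives,
  \<open>\<Phi> F\<close> is the differential operator with symbol \<open>F\<close> applied to that
  signal. The characteristic polynomial \<open>P\<close> gives \<open>\<Phi> P = w\<close>, and
  removing one linear factor amounts to a stable scalar equation: \<open>\<Phi> Q\<close> has the
  derivative \<open>r * \<Phi> Q + \<Phi> (Q * [:-r, 1:])\<close>. Repeated roots are treated like
  simple ones, and nothing has to be diagonalised.\<close>

lemma companion_L2:
  fixes w :: "'p \<Rightarrow> real \<Rightarrow> real" and \<zeta> :: "'p \<Rightarrow> nat \<Rightarrow> real \<Rightarrow> real"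
  assumes n: "0 < n" and roots: "\<And>s. char_fun n c s = 0 \<Longrightarrow> Re s < 0"
    and w: "L2_family S w"
    and \<zeta>: "\<And>p W q. S p W \<Longrightarrow> q < n \<Longrightarrow> primitive
        (\<lambda>t. if Suc q < n then \<zeta> p (Suc q) t else w p t - (\<Sum>i<n. c i * \<zeta> p i t)) (\<zeta> p q)"
      "\<And>p W q. S p W \<Longrightarrow> q < n \<Longrightarrow> \<zeta> p q 0 = \<zeta>0 q"
    and q: "q < n"
  shows "L2_family S (\<lambda>p. \<zeta> p q)"
proof -
  \<comment> \<open>Index \<open>n\<close> is the derivative of the last state, so \<open>y\<close>
    lists the signal and its first \<open>n\<close> derivatives.\<close>
  define y where "y p i t = (if i < n then \<zeta> p i t else w p t - (\<Sum>i<n. c i * \<zeta> p i t))" for p i t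
  define \<Phi> where "\<Phi> F p t = (\<Sum>i\<le>n. coeff F i * complex_of_real (y p i t))" for F p t
  define P where "P = monom 1 n + (\<Sum>i<n. monom (complex_of_real (c i)) i)"
  have coeffP: "coeff P i = (if i = n then 1 else if i < n then complex_of_real (c i) else 0)" for i
    unfolding P_def by (auto simp: coeff_sum)
  have degP: "degree P = n"
    by (intro antisym degree_le le_degree) (auto simp: coeffP)
  have P0: "P \<noteq> 0" using coeffP[of n] by auto
  have polyP: "poly P s = char_fun n c s" for s
    by (simp add: P_def char_fun_def poly_monom poly_sum)
  have \<Phi>_add: "\<Phi> (F + G) p t = \<Phi> F p t + \<Phi> G p t" for F G p t
    by (simp add: \<Phi>_def sum.distrib distrib_right)
  have \<Phi>_smult: "\<Phi> (Polynomial.smult b F) p t = b * \<Phi> F p t" for F b p t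
    by (simp add: \<Phi>_def sum_distrib_left mult.assoc)
  have \<Phi>P: "\<Phi> P p t = complex_of_real (w p t)" for p t
    by (simp add: \<Phi>_def coeffP lessThan_Suc_atMost[symmetric] y_def)
  have prim: "primitive (\<Phi> (pCons 0 F) p) (\<Phi> F p)" if S: "S p W" and F: "degree F < n" for F p W
  proof -
    have "primitive (\<lambda>t. \<Sum>i<n. coeff F i * complex_of_real (y p (Suc i) t))
        (\<lambda>t. \<Sum>i<n. coeff F i * complex_of_real (y p i t))"
    proof (intro primitive_sum primitive_bounded_linear[OF bounded_linear_mult_right]
        primitive_bounded_linear[OF bounded_linear_of_real])
      fix i assume i: "i \<in> {..<n}"
      then have "(\<lambda>t. y p i t) = \<zeta> p i" by (simp add: y_def)
      moreover have "(\<lambda>t. y p (Suc i) t)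
          = (\<lambda>t. if Suc i < n then \<zeta> p (Suc i) t else w p t - (\<Sum>i<n. c i * \<zeta> p i t))"
        by (simp add: y_def)
      ultimately show "primitive (\<lambda>t. y p (Suc i) t) (\<lambda>t. y p i t)" using \<zeta>(1)[OF S, of i] i by simp
    qed
    moreover have "(\<lambda>t. \<Sum>i<n. coeff F i * complex_of_real (y p i t)) = \<Phi> F p"
      using F by (simp add: \<Phi>_def fun_eq_iff lessThan_Suc_atMost[symmetric] coeff_eq_0)
    moreover have "(\<lambda>t. \<Sum>i<n. coeff F i * complex_of_real (y p (Suc i) t)) = \<Phi> (pCons 0 F) p"
      unfolding \<Phi>_def fun_eq_iff by (simp add: sum.atMost_shift)
    ultimately show ?thesis by simp
  qed
  have step: "L2_family S (\<Phi> Q)" if L: "L2_family S (\<Phi> (Q * [:-r, 1:]))" and "Re r < 0" "degree Q < n" for Q r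
  proof (rule first_order_L2[OF that(2) L])
    fix p W assume S: "S p W"
    have eq: "Q * [:-r, 1:] = pCons 0 Q + Polynomial.smult (- r) Q" by simp
    have "\<Phi> (Q * [:-r, 1:]) p t = \<Phi> (pCons 0 Q) p t + - r * \<Phi> Q p t" for t
      by (simp only: eq \<Phi>_add \<Phi>_smult)
    then have "r * \<Phi> Q p t + \<Phi> (Q * [:-r, 1:]) p t = \<Phi> (pCons 0 Q) p t" for t by simp
    then show "primitive (\<lambda>t. r * \<Phi> Q p t + \<Phi> (Q * [:-r, 1:]) p t) (\<Phi> Q p)"
      using prim[OF S that(3)] by simp
    show "\<Phi> Q p 0 = (\<Sum>i<n. coeff Q i * complex_of_real (\<zeta>0 i))"
      using \<zeta>(2)[OF S] that(3) by (simp add: \<Phi>_def lessThan_Suc_atMost[symmetric] coeff_eq_0 y_def)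
  qed
  \<comment> \<open>The induction moves from \<open>Q\<close> close to \<open>P\<close>, where the
    input \<open>w\<close> is reached, down to \<open>Q = 1\<close>. There \<open>F\<close> may be
    any power of the variable below \<open>n\<close>, which singles out one state.\<close>
  have main: "L2_family S (\<Phi> (Q * F))" if "P = Q * R" "degree F < degree R" for Q R F
    using that
  proof (induction "degree R" arbitrary: Q R F rule: less_induct)
    case less
    have nz: "Q \<noteq> 0" "R \<noteq> 0" using less.prems(1) P0 by auto
    have "\<not> constant (poly R)" using less.prems(2) by (simp add: constant_degree)
    then obtain r where "poly R r = 0" using fundamental_theorem_of_algebra by blast
    then obtain R' where R': "R = [:-r, 1:] * R'" by (metis dvdE poly_eq_0_iff_dvd)
    have P': "P = (Q * [:-r, 1:]) * R'" using less.prems(1) R' by (simp only: mult.assoc)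
    have "poly P r = 0" unfolding P' by simp
    then have r: "Re r < 0" using roots polyP by simp
    have R'0: "R' \<noteq> 0" using R' nz by auto
    then have degR: "degree R = Suc (degree R')" unfolding R' by (subst degree_mult_eq) auto
    have degQ: "degree Q < n"
      using degree_mult_eq[OF nz] degP less.prems by (simp add: degR)
    have Q: "L2_family S (\<Phi> Q)"
    proof (rule step[OF _ r degQ], cases "degree R' = 0")
      case True
      then obtain b where b: "R' = [:b:]" by (metis degree_eq_zeroE)
      then have "b \<noteq> 0" using R'0 by auto
      then have "Q * [:-r, 1:] = Polynomial.smult (1 / b) P" unfolding P' b by (simp add: mult.commute)
      then have "\<Phi> (Q * [:-r, 1:]) = (\<lambda>p t. (1 / b) * complex_of_real (w p t))"
        by (simp only: \<Phi>_smult \<Phi>P fun_eq_iff) simp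
      moreover have "L2_family S (\<lambda>p t. complex_of_real (w p t))"
        by (rule L2_family_dominated[OF w, of _ 1])
           (auto intro!: lbm_bounded_linear[OF bounded_linear_of_real] L2_family_lbm[OF w])
      ultimately show "L2_family S (\<Phi> (Q * [:-r, 1:]))" by (simp only: L2_family_mult_left)
    next
      case False
      then show "L2_family S (\<Phi> (Q * [:-r, 1:]))"
        using less.hyps[OF _ P', of 1] degR by simp
    qed
    \<comment> \<open>Division with remainder: the multiple of the linear factor is covered by the
      induction hypothesis, the constant remainder by the bound on \<open>\<Phi> Q\<close>.\<close>
    obtain F' f0 where F: "F = [:-r, 1:] * F' + [:f0:]"
      using synthetic_div_correct'[of r F] by metis
    have "L2_family S (\<Phi> ((Q * [:-r, 1:]) * F'))"
    proof (cases "F' = 0")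
      case True
      then show ?thesis by (simp add: \<Phi>_def[abs_def] L2_family_zero[OF w])
    next
      case False
      have "degree F = Suc (degree F')"
        unfolding F using False
        by (subst degree_add_eq_left) (auto simp: degree_mult_eq simp del: mult_pCons_left)
      then show ?thesis using less.hyps[OF _ P', of F'] less.prems(2) degR by simp
    qed
    then have "L2_family S (\<lambda>p t. \<Phi> ((Q * [:-r, 1:]) * F') p t + f0 * \<Phi> Q p t)"
      using Q by (intro L2_family_add L2_family_mult_left)
    moreover have QF: "Q * F = (Q * [:-r, 1:]) * F' + Polynomial.smult f0 Q"
      unfolding F by (simp add: algebra_simps)
    have "\<Phi> (Q * F) = (\<lambda>p t. \<Phi> ((Q * [:-r, 1:]) * F') p t + f0 * \<Phi> Q p t)"
      unfolding QF fun_eq_iff \<Phi>_add \<Phi>_smult by (intro allI refl)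
    ultimately show ?case by (simp only:)
  qed
  have "L2_family S (\<Phi> (1 * monom 1 q))"
    by (rule main[of 1 P]) (use q in \<open>auto simp: degP degree_monom_eq\<close>)
  then show ?thesis
  proof (rule L2_family_dominated[where B=1])
    fix p W assume "S p W"
    then show "lbm (\<zeta> p q)" using \<zeta>(1) q primitive_lbm by blast
  next
    fix p W t
    have "\<Phi> (1 * monom 1 q) p t = complex_of_real (\<zeta> p q t)"
      using q by (simp add: \<Phi>_def y_def if_distrib[of "\<lambda>x. x * _"] cong: if_cong)
    then show "norm (\<zeta> p q t) \<le> 1 * norm (\<Phi> (1 * monom 1 q) p t)" by simp
  qed
qed

text \<open>The powers \<open>1, s, ..., s ^ (2 * k)\<close> of a root form an eigenvector of the
  companion matrix.\<close>

lemma hurwitz_char_fun: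
  assumes "hurwitz (filter_matrix k \<alpha>f \<beta>f)" "char_fun (2 * k + 1) (interleave \<beta>f \<alpha>f) s = 0"
  shows "Re s < 0"
proof -
  let ?n = "2 * k + 1" and ?A = "map_mat complex_of_real (filter_matrix k \<alpha>f \<beta>f)"
  define v where "v = Matrix.vec ?n (\<lambda>p. s ^ p)"
  have A: "?A \<in> carrier_mat ?n ?n" by (simp add: filter_matrix_def)
  have "?A *\<^sub>v v = s \<cdot>\<^sub>v v"
  proof (rule eq_vecI)
    fix p assume "p < dim_vec (s \<cdot>\<^sub>v v)"
    then have p: "p < ?n" by (simp add: v_def)
    have "vec_index (?A *\<^sub>v v) p
        = (\<Sum>q<?n. complex_of_real (if p < 2 * k then (if q = Suc p then 1 else 0) else - interleave \<beta>f \<alpha>f q) * s ^ q)"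
      using p A by (simp add: v_def filter_matrix_def scalar_prod_def lessThan_atLeast0)
    also have "\<dots> = s * s ^ p"
    proof (cases "p < 2 * k")
      case True
      then have "(\<Sum>q<?n. complex_of_real (if p < 2 * k then (if q = Suc p then 1 else 0) else - interleave \<beta>f \<alpha>f q) * s ^ q)
        = (\<Sum>q<?n. if q = Suc p then s ^ q else 0)" by (intro sum.cong) auto
      then show ?thesis using True by simp
    next
      case False
      then have "p = 2 * k" using p by simp
      then show ?thesis
        using assms(2) by (simp add: char_fun_def sum_negf neg_eq_iff_add_eq_0 add.commute del: sum.lessThan_Suc)
    qed
    finally show "vec_index (?A *\<^sub>v v) p = vec_index (s \<cdot>\<^sub>v v) p" using p by (simp add: v_def)
  qed (use A in \<open>simp add: v_def\<close>)
  moreover have "v \<noteq> 0\<^sub>v ?n"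
  proof
    assume "v = 0\<^sub>v ?n"
    then have "vec_index v 0 = vec_index (0\<^sub>v ?n) 0" by simp
    then show False by (simp add: v_def)
  qed
  ultimately have "eigenvalue ?A s"
    using A unfolding eigenvalue_def eigenvector_def by (intro exI[of _ v]) (auto simp: v_def)
  then show ?thesis using assms(1) by (simp add: hurwitz_def)
qed

section \<open>The compensator\<close>

lemma sum_even_odd:
  fixes f :: "nat \<Rightarrow> 'a::comm_monoid_add"
  shows "(\<Sum>p<2 * k + 1. f p) = (\<Sum>m\<le>k. f (2 * m)) + (\<Sum>m<k. f (2 * m + 1))"
  by (induction k) (simp_all add: ac_simps)

text \<open>Coefficients of the product of the factors \<open>X + (\<omega>h j)\<^sup>2\<close> in
  the variable \<open>X\<close>, indexed from 0 and completed by the leading coefficient 1.\<close>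

definition sq_coeff :: "nat \<Rightarrow> (nat \<Rightarrow> real) \<Rightarrow> nat \<Rightarrow> real" where
  "sq_coeff k \<alpha> m = (if m < k then \<alpha> (Suc m) else 1)"

text \<open>Read as a polynomial, the identifier row has the even coefficients of the characteristic
  polynomial, while its odd ones are lowered by the parameters; the leading terms cancel. The two
  polynomials agree at 0 and at the imaginary frequencies that belong to the parameters.\<close>

lemma char_fun_interleave_diff:
  "(\<Sum>p<2 * k + 1. complex_of_real (interleave \<beta>f (\<lambda>j. \<alpha>f j - \<alpha> j) p) * s ^ p)
    = char_fun (2 * k + 1) (interleave \<beta>f \<alpha>f) s
      - s * (\<Sum>m\<le>k. complex_of_real (sq_coeff k \<alpha> m) * (s\<^sup>2) ^ m)"
proof -
  have "(\<Sum>m\<le>k. complex_of_real (sq_coeff k \<alpha> m) * (s\<^sup>2) ^ m)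
      = (\<Sum>m<k. complex_of_real (\<alpha> (Suc m)) * s ^ (2 * m)) + s ^ (2 * k)"
    by (simp add: lessThan_Suc_atMost[symmetric] sq_coeff_def power_mult)
  then show ?thesis
    unfolding char_fun_def sum_even_odd
    by (simp add: interleave_def algebra_simps sum_subtractf sum_distrib_left)
qed

text \<open>The estimates are defined by an identity for real \<open>s\<close>, that is, for
  \<open>X = s\<^sup>2 \<ge> 0\<close>. Infinitely many points give an identity of polynomials,
  which can then be used at imaginary \<open>s\<close>.\<close>

lemma estimate_factorization:
  assumes "\<forall>s::real. (\<Prod>j=1..k. s ^ 2 + (\<omega>h j) ^ 2)
      = s ^ (2 * k) + (\<Sum>j=1..k. \<alpha>h j * s ^ (2 * (j - 1)))"
  shows "(\<Prod>j=1..k. [:(\<omega>h j)\<^sup>2, 1:]) = (\<Sum>m\<le>k. monom (sq_coeff k \<alpha>h m) m)" (is "?P = ?Q")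
proof -
  have eq: "poly ?P X = poly ?Q X" if "X \<in> {0..}" for X :: real
  proof -
    have X: "(sqrt X)\<^sup>2 = X" using that by simp
    have "poly ?P X = (\<Prod>j=1..k. (sqrt X)\<^sup>2 + (\<omega>h j)\<^sup>2)" by (simp add: poly_prod X add.commute)
    also have "\<dots> = (sqrt X)\<^sup>2 ^ k + (\<Sum>j=1..k. \<alpha>h j * (sqrt X)\<^sup>2 ^ (j - 1))"
      using assms by (simp add: power_mult)
    also have "(\<Sum>j=1..k. \<alpha>h j * (sqrt X)\<^sup>2 ^ (j - 1)) = (\<Sum>m<k. \<alpha>h (Suc m) * X ^ m)"
      unfolding X by (rule sum.reindex_bij_witness[of _ Suc "\<lambda>j. j - 1"]) auto
    finally show ?thesis
      by (simp add: X poly_sum poly_monom lessThan_Suc_atMost[symmetric] sq_coeff_def)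
  qed
  have "?P - ?Q = 0"
  proof (rule ccontr)
    assume "?P - ?Q \<noteq> 0"
    then have "finite {x. poly (?P - ?Q) x = 0}" by (rule poly_roots_finite)
    moreover have "{0..} \<subseteq> {x. poly (?P - ?Q) x = 0}" using eq by auto
    ultimately show False using finite_subset infinite_Ici by blast
  qed
  then show ?thesis by simp
qed

lemma estimate_poly:
  assumes "frequency_estimates k \<omega> \<mu> \<alpha>h \<omega>h"
  shows "(\<Prod>j=1..k. X + (\<omega>h j)\<^sup>2) = (\<Sum>m\<le>k. sq_coeff k \<alpha>h m * X ^ m)"
proof -
  have "poly (\<Prod>j=1..k. [:(\<omega>h j)\<^sup>2, 1:]) X = poly (\<Sum>m\<le>k. monom (sq_coeff k \<alpha>h m) m) X"
    using assms by (subst estimate_factorization) (auto simp: frequency_estimates_def)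
  then show ?thesis by (simp add: poly_prod poly_sum poly_monom add.commute)
qed

lemma estimate_root:
  assumes "frequency_estimates k \<omega> \<mu> \<alpha>h \<omega>h" "j \<in> {1..k}"
  shows "(\<Sum>m\<le>k. complex_of_real (sq_coeff k \<alpha>h m) * ((\<i> * complex_of_real (\<omega>h j))\<^sup>2) ^ m) = 0"
proof -
  have "(\<Prod>i=1..k. - (\<omega>h j)\<^sup>2 + (\<omega>h i)\<^sup>2) = 0"
    using assms(2) by (intro prod_zero) auto
  then have "(\<Sum>m\<le>k. sq_coeff k \<alpha>h m * (- (\<omega>h j)\<^sup>2) ^ m) = 0"
    by (simp only: estimate_poly[OF assms(1)])
  then have "complex_of_real (\<Sum>m\<le>k. sq_coeff k \<alpha>h m * (- (\<omega>h j)\<^sup>2) ^ m) = 0" by simp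
  then show ?thesis by (simp add: power_mult_distrib)
qed

text \<open>The coefficients are nonnegative, so each is at most their sum, the value of the product
  at \<open>X = 1\<close>; there each factor is at most
  \<open>(\<omega>h j)\<^sup>2 * (1 + 1 / \<mu>\<^sup>2)\<close>. The ratios thus stay bounded even
  if the estimates grow.\<close>

lemma estimate_coeff_bounds:
  assumes est: "frequency_estimates k \<omega> \<mu> \<alpha>h \<omega>h" and \<mu>: "\<mu> > 0"
  shows "\<mu> ^ (2 * k) \<le> sq_coeff k \<alpha>h 0"
    "m \<le> k \<Longrightarrow> \<bar>sq_coeff k \<alpha>h m / sq_coeff k \<alpha>h 0\<bar> \<le> (1 + 1 / \<mu>\<^sup>2) ^ k"
proof -
  have lo: "\<mu>\<^sup>2 \<le> (\<omega>h j)\<^sup>2" "0 < \<omega>h j" if "j \<in> {1..k}" for j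
    using est that \<mu> by (force simp: frequency_estimates_def intro: power_mono)+
  have A0: "sq_coeff k \<alpha>h 0 = (\<Prod>j=1..k. (\<omega>h j)\<^sup>2)"
    using estimate_poly[OF est, of 0] by (simp add: power_0_left if_distrib cong: if_cong)
  have "(\<mu>\<^sup>2) ^ k = (\<Prod>j=1..k. \<mu>\<^sup>2)" by simp
  also have "\<dots> \<le> sq_coeff k \<alpha>h 0" unfolding A0 by (intro prod_mono) (auto intro: lo)
  finally show lo0: "\<mu> ^ (2 * k) \<le> sq_coeff k \<alpha>h 0" by (simp add: power_mult)
  then have pos: "0 < sq_coeff k \<alpha>h 0" using \<mu> by (meson less_le_trans zero_less_power)
  have nonneg: "0 \<le> sq_coeff k \<alpha>h m" if "m \<le> k" for m
  proof -
    have "\<forall>i. 0 \<le> coeff (\<Prod>j\<in>J. [:(\<omega>h j)\<^sup>2, 1:]) i" if "finite J" for J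
      using that
    proof induction
      case (insert x F)
      then show ?case
        by (auto simp: coeff_pCons split: nat.splits intro!: add_nonneg_nonneg mult_nonneg_nonneg)
    qed (auto simp: coeff_pCons split: nat.splits)
    then have "0 \<le> coeff (\<Prod>j=1..k. [:(\<omega>h j)\<^sup>2, 1:]) m" by simp
    also have "(\<Prod>j=1..k. [:(\<omega>h j)\<^sup>2, 1:]) = (\<Sum>m\<le>k. monom (sq_coeff k \<alpha>h m) m)"
      using est by (intro estimate_factorization) (simp add: frequency_estimates_def)
    finally have "0 \<le> coeff (\<Sum>m\<le>k. monom (sq_coeff k \<alpha>h m) m) m" .
    then show ?thesis using that by (simp add: coeff_sum)
  qed
  show "\<bar>sq_coeff k \<alpha>h m / sq_coeff k \<alpha>h 0\<bar> \<le> (1 + 1 / \<mu>\<^sup>2) ^ k" if m: "m \<le> k"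
  proof -
    have "sq_coeff k \<alpha>h m \<le> (\<Sum>i\<le>k. sq_coeff k \<alpha>h i)"
      using m nonneg by (intro member_le_sum) auto
    also have "\<dots> = (\<Prod>j=1..k. 1 + (\<omega>h j)\<^sup>2)" using estimate_poly[OF est, of 1] by simp
    also have "\<dots> \<le> (\<Prod>j=1..k. (\<omega>h j)\<^sup>2 * (1 + 1 / \<mu>\<^sup>2))"
    proof (intro prod_mono conjI)
      fix j assume j: "j \<in> {1..k}"
      have "1 = \<mu>\<^sup>2 * (1 / \<mu>\<^sup>2)" using \<mu> by simp
      also have "\<dots> \<le> (\<omega>h j)\<^sup>2 * (1 / \<mu>\<^sup>2)" by (intro mult_right_mono lo(1) j) simp
      finally show "1 + (\<omega>h j)\<^sup>2 \<le> (\<omega>h j)\<^sup>2 * (1 + 1 / \<mu>\<^sup>2)" by (simp add: distrib_left)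
    qed simp
    also have "\<dots> = (1 + 1 / \<mu>\<^sup>2) ^ k * sq_coeff k \<alpha>h 0" by (simp add: prod.distrib A0)
    finally show ?thesis using pos nonneg[OF m] by (simp add: pos_divide_le_eq)
  qed
qed

section \<open>Entries of the compensator and columns of the Sylvester equation\<close>

lemma diag_block_mat_pairs_Suc:
  "diag_block_mat (map f [a..<a + Suc k]) = (let B = diag_block_mat (map f [Suc a..<Suc a + k])
    in four_block_mat (f a) (0\<^sub>m (dim_row (f a)) (dim_col B)) (0\<^sub>m (dim_row B) (dim_col (f a))) B)"
  by (simp add: upt_conv_Cons Let_def del: upt_Suc)

lemma diag_block_mat_pairs_carrier:
  assumes "\<And>j. f j \<in> carrier_mat 2 2"
  shows "diag_block_mat (map f [a..<a + k]) \<in> carrier_mat (2 * k) (2 * k)"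
proof (induction k arbitrary: a)
  case (Suc k)
  have "diag_block_mat (map f [a..<a + Suc k]) \<in> carrier_mat (2 + 2 * k) (2 + 2 * k)"
    unfolding diag_block_mat_pairs_Suc Let_def by (rule four_block_carrier_mat[OF assms Suc])
  then show ?case by (simp del: upt_Suc)
qed simp

lemma diag_block_mat_pairs_index:
  assumes f: "\<And>j. f j \<in> carrier_mat 2 2" and "p < 2 * k" "q < 2 * k"
  shows "diag_block_mat (map f [a..<a + k]) $$ (p, q)
    = (if p div 2 = q div 2 then f (a + p div 2) $$ (p mod 2, q mod 2) else 0)"
  using assms(2,3)
proof (induction k arbitrary: a p q)
  case (Suc k)
  define B where "B = diag_block_mat (map f [Suc a..<Suc a + k])"
  have dims: "dim_row (f a) = 2" "dim_col (f a) = 2" "dim_row B = 2 * k" "dim_col B = 2 * k"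
    using f[of a] diag_block_mat_pairs_carrier[where f=f and a="Suc a" and k=k, OF f] unfolding B_def by auto
  have index: "diag_block_mat (map f [a..<a + Suc k]) $$ (p, q) = (if p < 2 then
      if q < 2 then f a $$ (p, q) else 0 else if q < 2 then 0 else B $$ (p - 2, q - 2))"
    unfolding diag_block_mat_pairs_Suc Let_def B_def[symmetric]
    using Suc.prems by (subst index_mat_four_block) (auto simp: dims)
  have ge: "x - 2 < 2 * k" "x div 2 = Suc ((x - 2) div 2)" "x mod 2 = (x - 2) mod 2"
    if "\<not> x < 2" "x < 2 * Suc k" for x
    using that by presburger+
  show ?case
  proof (cases "p < 2 \<or> q < 2")
    case True
    then show ?thesis unfolding index by auto
  next
    case False
    then have "B $$ (p - 2, q - 2) = (if (p - 2) div 2 = (q - 2) div 2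
        then f (Suc a + (p - 2) div 2) $$ ((p - 2) mod 2, (q - 2) mod 2) else 0)"
      unfolding B_def using Suc.prems ge by (intro Suc.IH) auto
    then show ?thesis unfolding index using False Suc.prems ge[of p] ge[of q] by simp
  qed
qed simp

lemma compensator_matrix_carrier: "compensator_matrix k \<omega>h \<in> carrier_mat (2 * k + 1) (2 * k + 1)"
  and compensator_matrix_index:
    "p < 2 * k + 1 \<Longrightarrow> q < 2 * k + 1 \<Longrightarrow> compensator_matrix k \<omega>h $$ (p, q)
      = (if odd p \<and> q = Suc p then \<omega>h (Suc p div 2) else if odd q \<and> p = Suc q then - \<omega>h (Suc q div 2) else 0)"
proof -
  define f where "f j = mat_of_rows_list 2 [[0, \<omega>h j], [- \<omega>h j, 0]]" for j
  have f: "f j \<in> carrier_mat 2 2" for j by (rule carrier_matI) (simp_all add: f_def mat_of_rows_list_def)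
  define B where "B = diag_block_mat (map f [1..<1 + k])"
  have B: "B \<in> carrier_mat (2 * k) (2 * k)"
    unfolding B_def by (rule diag_block_mat_pairs_carrier[OF f])
  have eq: "compensator_matrix k \<omega>h = four_block_mat (0\<^sub>m 1 1) (0\<^sub>m 1 (2 * k)) (0\<^sub>m (2 * k) 1) B"
    unfolding compensator_matrix_def f_def[symmetric] using B by (simp add: B_def Let_def del: upt_Suc)
  have "compensator_matrix k \<omega>h \<in> carrier_mat (1 + 2 * k) (1 + 2 * k)"
    unfolding eq by (rule four_block_carrier_mat[OF zero_carrier_mat B])
  then show "compensator_matrix k \<omega>h \<in> carrier_mat (2 * k + 1) (2 * k + 1)" by simp
  assume pq: "p < 2 * k + 1" "q < 2 * k + 1"
  have index: "compensator_matrix k \<omega>h $$ (p, q) = (if p = 0 \<or> q = 0 then 0 else B $$ (p - 1, q - 1))"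
    unfolding eq using pq B by (subst index_mat_four_block) auto
  show "compensator_matrix k \<omega>h $$ (p, q)
      = (if odd p \<and> q = Suc p then \<omega>h (Suc p div 2) else if odd q \<and> p = Suc q then - \<omega>h (Suc q div 2) else 0)"
  proof (cases "p = 0 \<or> q = 0")
    case True
    then show ?thesis unfolding index by auto
  next
    case False
    then obtain p' q' where p': "p = Suc p'" and q': "q = Suc q'" by (metis not0_implies_Suc)
    have Bpq: "B $$ (p', q') = (if p' div 2 = q' div 2 then f (1 + p' div 2) $$ (p' mod 2, q' mod 2) else 0)"
      unfolding B_def using pq p' q' by (intro diag_block_mat_pairs_index f) auto
    have fj: "f j $$ (x mod 2, y mod 2)
        = (if even x \<and> odd y then \<omega>h j else if odd x \<and> even y then - \<omega>h j else 0)" for j x y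
      by (cases "even x"; cases "even y") (auto simp: f_def mat_of_rows_list_def odd_iff_mod_2_eq_one even_iff_mod_2_eq_zero)
    have "B $$ (p', q') = (if even p' \<and> q' = Suc p' then \<omega>h (Suc (p' div 2))
        else if even q' \<and> p' = Suc q' then - \<omega>h (Suc (q' div 2)) else 0)"
    proof (cases "p' div 2 = q' div 2")
      case True
      have "even p' \<and> q' = Suc p' \<longleftrightarrow> even p' \<and> odd q'" "even q' \<and> p' = Suc q' \<longleftrightarrow> odd p' \<and> even q'"
        using True by presburger+
      then show ?thesis using True by (simp add: Bpq fj)
    next
      case False
      have "\<not> (even p' \<and> q' = Suc p')" "\<not> (even q' \<and> p' = Suc q')" using False by presburger+
      then show ?thesis using False by (simp only: Bpq if_False)
    qed
    then show ?thesis using index unfolding p' q' by simp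
  qed
qed

lemma all_le_iff_zero_or_pos: "(\<forall>j\<le>k. P j) \<longleftrightarrow> P (0::nat) \<and> (\<forall>j\<in>{1..k}. P j)"
  by (metis One_nat_def Suc_leI atLeastAtMost_iff gr0I le0)

text \<open>The pair of columns \<open>2 j - 1\<close>, \<open>2 j\<close> of a solution of the Sylvester equation is read as one complex
  column, on which the \<open>j\<close>-th block of the compensator acts as multiplication by \<open>\<i> \<omega>h j\<close>.\<close>

definition sylvester_column :: "real Matrix.mat \<Rightarrow> nat \<Rightarrow> nat \<Rightarrow> complex" where
  "sylvester_column T j p = (if j = 0 then complex_of_real (T $$ (p, 0))
     else Complex (T $$ (p, 2 * j - 1)) (T $$ (p, 2 * j)))"

definition sylvester_root :: "(nat \<Rightarrow> real) \<Rightarrow> nat \<Rightarrow> complex" where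
  "sylvester_root \<omega>h j = (if j = 0 then 0 else \<i> * complex_of_real (\<omega>h j))"

text \<open>By the companion form, all rows but the last are a recursion along each column, and the
  last row is a normalisation. Multiplication by a rotation block from the right turns into
  multiplication by \<open>\<i> * \<omega>h j\<close>, and the entries \<open>1, 0\<close> of the
  output row into the complex number 1.\<close>

lemma sylvester_equation_iff:
  assumes T: "T \<in> carrier_mat (2 * k + 1) (2 * k + 1)"
  shows "T * compensator_matrix k \<omega>h - filter_matrix k \<alpha>f \<beta>f * T =
        mat_of_cols (2 * k + 1) [filter_input k] * mat_of_rows (2 * k + 1) [output_row k]
    \<longleftrightarrow> (\<forall>j\<le>k. (\<forall>p<2 * k. sylvester_column T j (Suc p) = sylvester_root \<omega>h j * sylvester_column T j p) \<and>
        sylvester_root \<omega>h j * sylvester_column T j (2 * k)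
          + (\<Sum>q<2 * k + 1. complex_of_real (interleave \<beta>f \<alpha>f q) * sylvester_column T j q) = 1)"
proof -
  let ?n = "2 * k + 1" and ?c = "interleave \<beta>f \<alpha>f"
  let ?L = "T * compensator_matrix k \<omega>h - filter_matrix k \<alpha>f \<beta>f * T"
  let ?R = "mat_of_cols ?n [filter_input k] * mat_of_rows ?n [output_row k]"
  define F where "F p q = (if p < 2 * k then T $$ (Suc p, q) else - (\<Sum>r<?n. ?c r * T $$ (r, q)))" for p q
  define G where "G p q = (\<Sum>r<?n. T $$ (p, r) * compensator_matrix k \<omega>h $$ (r, q))" for p q
  have carr: "filter_matrix k \<alpha>f \<beta>f \<in> carrier_mat ?n ?n" by (simp add: filter_matrix_def)
  note carrs = T carr compensator_matrix_carrier[of k \<omega>h]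
  have L: "?L $$ (p, q) = G p q - F p q" if "p < ?n" "q < ?n" for p q
  proof -
    have "(filter_matrix k \<alpha>f \<beta>f * T) $$ (p, q)
        = (\<Sum>r<?n. (if p < 2 * k then (if r = Suc p then 1 else 0) else - ?c r) * T $$ (r, q))"
      using that T by (simp add: filter_matrix_def scalar_prod_def lessThan_atLeast0 del: sum.op_ivl_Suc sum.lessThan_Suc)
    also have "\<dots> = F p q"
    proof (cases "p < 2 * k")
      case True
      then have "(\<Sum>r<?n. (if p < 2 * k then (if r = Suc p then 1 else 0) else - ?c r) * T $$ (r, q))
          = (\<Sum>r<?n. if r = Suc p then T $$ (r, q) else 0)" by (intro sum.cong) auto
      then show ?thesis using True by (simp add: F_def del: sum.lessThan_Suc)
    qed (simp add: F_def sum_negf del: sum.lessThan_Suc)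
    finally show ?thesis
      using that carrs by (simp add: G_def scalar_prod_def lessThan_atLeast0 del: sum.op_ivl_Suc sum.lessThan_Suc)
  qed
  have R: "?R $$ (p, q) = (if p = 2 * k \<and> (q = 0 \<or> odd q) then 1 else 0)" if "p < ?n" "q < ?n" for p q
    using that by (simp add: mat_of_cols_def mat_of_rows_def scalar_prod_def filter_input_def output_row_def)
  have dims: "?L \<in> carrier_mat ?n ?n" "?R \<in> carrier_mat ?n ?n" using carrs by auto
  have "?L = ?R \<longleftrightarrow> (\<forall>p<?n. \<forall>q<?n. ?L $$ (p, q) = ?R $$ (p, q))"
  proof
    assume "\<forall>p<?n. \<forall>q<?n. ?L $$ (p, q) = ?R $$ (p, q)"
    then show "?L = ?R" using dims by (intro eq_matI) auto
  qed simp
  also have "\<dots> \<longleftrightarrow> (\<forall>q<?n. \<forall>p<?n. G p q - F p q = (if p = 2 * k \<and> (q = 0 \<or> odd q) then 1 else 0))"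
    using L R by auto
  also have "\<dots> \<longleftrightarrow> (\<forall>q<?n. (\<forall>p<2 * k. G p q = F p q) \<and> G (2 * k) q - F (2 * k) q = (if q = 0 \<or> odd q then 1 else 0))"
    (is "_ \<longleftrightarrow> (\<forall>q<?n. ?E q)")
    by (auto simp: less_Suc_eq)
  also have "\<dots> \<longleftrightarrow> ?E 0 \<and> (\<forall>j\<in>{1..k}. ?E (2 * j - 1) \<and> ?E (2 * j))"
  proof
    assume E: "\<forall>q<?n. ?E q"
    show "?E 0 \<and> (\<forall>j\<in>{1..k}. ?E (2 * j - 1) \<and> ?E (2 * j))"
      by (rule conjI[OF E[rule_format] ballI[OF conjI[OF E[rule_format] E[rule_format]]]]) auto
  next
    assume E: "?E 0 \<and> (\<forall>j\<in>{1..k}. ?E (2 * j - 1) \<and> ?E (2 * j))"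
    have "?E q" if q: "q < ?n" for q
    proof -
    consider "q = 0" | "odd q" | "even q" "q \<noteq> 0" by blast
    then show "?E q"
    proof cases
      case 2
      then have "Suc q div 2 \<in> {1..k}" "q = 2 * (Suc q div 2) - 1" using q by (auto elim!: oddE)
      then show ?thesis using E by metis
    next
      case 3
      then have "q div 2 \<in> {1..k}" "q = 2 * (q div 2)" using q by (auto elim!: evenE)
      then show ?thesis using E by metis
    qed (use E in simp)
    qed
    then show "\<forall>q<?n. ?E q" by blast
  qed
  also have "\<dots> \<longleftrightarrow> (\<forall>j\<le>k. (\<forall>p<2 * k. sylvester_column T j (Suc p) = sylvester_root \<omega>h j * sylvester_column T j p) \<and>
        sylvester_root \<omega>h j * sylvester_column T j (2 * k)
          + (\<Sum>q<?n. complex_of_real (?c q) * sylvester_column T j q) = 1)" (is "_ \<longleftrightarrow> (\<forall>j\<le>k. ?C j)")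
  proof -
    have G0: "G p 0 = 0" if "p < ?n" for p
      unfolding G_def by (rule sum.neutral) (simp add: compensator_matrix_index)
    have Codd: "compensator_matrix k \<omega>h $$ (r, 2 * j - 1) = (if r = 2 * j then - \<omega>h j else 0)"
      and Ceven: "compensator_matrix k \<omega>h $$ (r, 2 * j) = (if r = 2 * j - 1 then \<omega>h j else 0)"
      if rj: "r < ?n" "j \<in> {1..k}" for r j
    proof -
      obtain i where "j = Suc i" using rj by (cases j) auto
      then show "compensator_matrix k \<omega>h $$ (r, 2 * j - 1) = (if r = 2 * j then - \<omega>h j else 0)"
        "compensator_matrix k \<omega>h $$ (r, 2 * j) = (if r = 2 * j - 1 then \<omega>h j else 0)"
        using rj by (auto simp: compensator_matrix_index)
    qed
    have Godd: "G p (2 * j - 1) = - \<omega>h j * T $$ (p, 2 * j)" if "p < ?n" "j \<in> {1..k}" for p j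
    proof -
      have "G p (2 * j - 1) = (\<Sum>r<?n. if r = 2 * j then - \<omega>h j * T $$ (p, 2 * j) else 0)"
        unfolding G_def by (intro sum.cong refl) (simp only: Codd[OF _ that(2)] lessThan_iff, simp)
      then show ?thesis using that by (simp del: sum.lessThan_Suc)
    qed
    have Geven: "G p (2 * j) = \<omega>h j * T $$ (p, 2 * j - 1)" if "p < ?n" "j \<in> {1..k}" for p j
    proof -
      have "G p (2 * j) = (\<Sum>r<?n. if r = 2 * j - 1 then \<omega>h j * T $$ (p, 2 * j - 1) else 0)"
        unfolding G_def by (intro sum.cong refl) (simp only: Ceven[OF _ that(2)] lessThan_iff, simp)
      moreover have "2 * j - 1 < ?n" using that by auto
      ultimately show ?thesis by (simp del: sum.lessThan_Suc)
    qed
    have C0: "?E 0 \<longleftrightarrow> ?C 0"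
      using G0 by (auto simp: F_def sylvester_column_def sylvester_root_def simp del: sum.lessThan_Suc
          simp flip: of_real_mult of_real_sum)
    have Cj: "?E (2 * j - 1) \<and> ?E (2 * j) \<longleftrightarrow> ?C j" if "j \<in> {1..k}" for j
    proof -
      have "odd (2 * j - 1)" "j \<noteq> 0" "2 * j - 1 \<noteq> 0" using that by auto
      then show ?thesis
        using that Godd Geven
        by (auto simp: F_def sylvester_column_def sylvester_root_def complex_eq_iff simp del: sum.lessThan_Suc)
    qed
    show ?thesis unfolding all_le_iff_zero_or_pos by (rule conj_cong[OF C0 ball_cong[OF refl Cj]])
  qed
  finally show ?thesis .
qed

text \<open>The same pairing for an arbitrary row vector. It is real linear, so it commutes with the
  sums over rows that form a matrix product.\<close>

definition cpair :: "(nat \<Rightarrow> real) \<Rightarrow> nat \<Rightarrow> complex" where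
  "cpair f j = (if j = 0 then complex_of_real (f 0) else Complex (f (2 * j - 1)) (f (2 * j)))"

lemma sylvester_column_cpair: "sylvester_column T j p = cpair (\<lambda>q. T $$ (p, q)) j"
  by (simp add: sylvester_column_def cpair_def)

lemma cpair_inject:
  assumes "\<And>j. j \<le> k \<Longrightarrow> cpair f j = cpair g j" "q < 2 * k + 1"
  shows "f q = g q"
proof -
  consider "q = 0" | i where "q = 2 * i + 1" | i where "q = 2 * Suc i"
    by (metis oddE evenE add.commute mult_0_right not0_implies_Suc)
  then show ?thesis
  proof cases
    case 1
    then show ?thesis using assms(1)[of 0] by (simp add: cpair_def)
  next
    case (2 i)
    then show ?thesis using assms(1)[of "Suc i"] assms(2) by (simp add: cpair_def)
  next
    case (3 i)
    then show ?thesis using assms(1)[of "Suc i"] assms(2) by (simp add: cpair_def)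
  qed
qed

lemma cpair_sum:
  "cpair (\<lambda>q. \<Sum>p\<in>P. w p * f p q) j = (\<Sum>p\<in>P. complex_of_real (w p) * cpair (f p) j)"
  by (simp add: cpair_def complex_eq_iff)

lemma Re_sylvester_root: "Re (sylvester_root \<omega>h j) = 0"
  by (simp add: sylvester_root_def)

context
  fixes k :: nat and \<alpha>f \<beta>f :: "nat \<Rightarrow> real"
  assumes hurwitz: "hurwitz (filter_matrix k \<alpha>f \<beta>f)"
begin

abbreviation (input) "pchar \<equiv> char_fun (2 * k + 1) (interleave \<beta>f \<alpha>f)"

lemma pchar_nonzero: "0 \<le> Re s \<Longrightarrow> pchar s \<noteq> 0"
  using hurwitz_char_fun[OF hurwitz, of s] by auto

lemma pchar_0: "0 < n \<Longrightarrow> char_fun n (interleave \<beta>f \<alpha>f) 0 = complex_of_real (\<beta>f 0)"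
  by (cases n) (simp_all add: char_fun_def sum.lessThan_Suc_shift interleave_def del: sum.lessThan_Suc)

text \<open>This is the characteristic polynomial at 0, a point outside the open left half-plane. It
  gives the filter a constant steady state \<open>z / \<beta>f 0\<close>.\<close>

lemma \<beta>f_nonzero: "\<beta>f 0 \<noteq> 0"
  using pchar_nonzero[of 0] by (simp add: pchar_0)

text \<open>The recursion makes each column the powers of its root times the top entry, and the last
  row states that \<open>pchar\<close> at the root times the top entry is 1. Stability permits the
  division, because the roots lie on the imaginary axis.\<close>

lemma sylvester_equation_columns:
  assumes T: "T \<in> carrier_mat (2 * k + 1) (2 * k + 1)"
  shows "T * compensator_matrix k \<omega>h - filter_matrix k \<alpha>f \<beta>f * T =
        mat_of_cols (2 * k + 1) [filter_input k] * mat_of_rows (2 * k + 1) [output_row k]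
    \<longleftrightarrow> (\<forall>j\<le>k. \<forall>p<2 * k + 1. sylvester_column T j p = sylvester_root \<omega>h j ^ p / pchar (sylvester_root \<omega>h j))"
  unfolding sylvester_equation_iff[OF T]
proof (intro all_cong1 imp_cong refl iffI)
  fix j
  define r where "r = sylvester_root \<omega>h j"
  define y where "y = sylvester_column T j"
  have nz: "pchar r \<noteq> 0" by (intro pchar_nonzero) (simp add: r_def Re_sylvester_root)
  {
    assume A: "(\<forall>p<2 * k. sylvester_column T j (Suc p) = sylvester_root \<omega>h j * sylvester_column T j p) \<and>
        sylvester_root \<omega>h j * sylvester_column T j (2 * k)
          + (\<Sum>q<2 * k + 1. complex_of_real (interleave \<beta>f \<alpha>f q) * sylvester_column T j q) = 1"
    have pw: "y p = r ^ p * y 0" if "p < 2 * k + 1" for p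
      using that A by (induction p) (auto simp: y_def r_def)
    have "1 = r * y (2 * k) + (\<Sum>q<2 * k + 1. complex_of_real (interleave \<beta>f \<alpha>f q) * y q)"
      unfolding y_def r_def by (rule A[THEN conjunct2, symmetric])
    also have "(\<Sum>q<2 * k + 1. complex_of_real (interleave \<beta>f \<alpha>f q) * y q)
        = (\<Sum>q<2 * k + 1. complex_of_real (interleave \<beta>f \<alpha>f q) * (r ^ q * y 0))"
      by (intro sum.cong refl arg_cong2[where f="(*)"] pw) simp
    also have "y (2 * k) = r ^ (2 * k) * y 0" by (rule pw) simp
    also have "r * (r ^ (2 * k) * y 0)
        + (\<Sum>q<2 * k + 1. complex_of_real (interleave \<beta>f \<alpha>f q) * (r ^ q * y 0)) = pchar r * y 0"
      by (simp add: char_fun_def distrib_right sum_distrib_right mult.assoc del: sum.lessThan_Suc)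
    finally have "y 0 = 1 / pchar r" using nz by (simp add: field_simps)
    then have "y p = r ^ p / pchar r" if "p < 2 * k + 1" for p using pw[OF that] by simp
    then show "\<forall>p<2 * k + 1. sylvester_column T j p = sylvester_root \<omega>h j ^ p / pchar (sylvester_root \<omega>h j)"
      by (simp add: y_def r_def)
  next
    assume A: "\<forall>p<2 * k + 1. sylvester_column T j p = sylvester_root \<omega>h j ^ p / pchar (sylvester_root \<omega>h j)"
    then have y: "y p = r ^ p / pchar r" if "p < 2 * k + 1" for p using that by (simp add: y_def r_def)
    define P where "P = pchar r"
    have P: "r * r ^ (2 * k) + (\<Sum>q<2 * k + 1. complex_of_real (interleave \<beta>f \<alpha>f q) * r ^ q) = P"
      by (simp add: P_def char_fun_def del: sum.lessThan_Suc)
    have "(\<Sum>q<2 * k + 1. complex_of_real (interleave \<beta>f \<alpha>f q) * y q)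
        = (\<Sum>q<2 * k + 1. complex_of_real (interleave \<beta>f \<alpha>f q) * r ^ q) / P"
      unfolding sum_divide_distrib by (intro sum.cong refl) (simp add: y P_def)
    moreover have "r * y (2 * k) = r * r ^ (2 * k) / P" by (simp add: y P_def)
    ultimately have "r * y (2 * k) + (\<Sum>q<2 * k + 1. complex_of_real (interleave \<beta>f \<alpha>f q) * y q) = 1"
      using nz[folded P_def] by (simp only: add_divide_distrib[symmetric] P) simp
    then show "(\<forall>p<2 * k. sylvester_column T j (Suc p) = sylvester_root \<omega>h j * sylvester_column T j p) \<and>
        sylvester_root \<omega>h j * sylvester_column T j (2 * k)
          + (\<Sum>q<2 * k + 1. complex_of_real (interleave \<beta>f \<alpha>f q) * sylvester_column T j q) = 1"
      using y by (simp add: y_def[symmetric] r_def[symmetric] del: sum.lessThan_Suc)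
  }
qed

text \<open>All columns are prescribed, so the equation has exactly one solution and the definite
  description is proper.\<close>

lemma sylvester_solution_columns:
  "sylvester_solution k \<alpha>f \<beta>f \<omega>h \<in> carrier_mat (2 * k + 1) (2 * k + 1)"
  "j \<le> k \<Longrightarrow> p < 2 * k + 1 \<Longrightarrow> sylvester_column (sylvester_solution k \<alpha>f \<beta>f \<omega>h) j p
    = sylvester_root \<omega>h j ^ p / pchar (sylvester_root \<omega>h j)"
proof -
  let ?n = "2 * k + 1"
  define y where "y j p = sylvester_root \<omega>h j ^ p / pchar (sylvester_root \<omega>h j)" for j p
  define T where "T = Matrix.mat ?n ?n (\<lambda>(p, q). if odd q then Re (y (Suc q div 2) p)
    else if q = 0 then Re (y 0 p) else Im (y (q div 2) p))"
  let ?P = "\<lambda>T. T \<in> carrier_mat ?n ?n \<and> (\<forall>j\<le>k. \<forall>p<?n. sylvester_column T j p = y j p)"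
  have T: "T \<in> carrier_mat ?n ?n" by (simp add: T_def)
  \<comment> \<open>The column of the scalar block has to be real in order to fit into a real
    matrix.\<close>
  have y0: "Im (y 0 p) = 0" for p
    by (simp add: y_def sylvester_root_def pchar_0 power_0_left)
  have "?P T"
  proof (intro conjI T allI impI)
    fix j p assume "j \<le> k" "p < ?n"
    then show "sylvester_column T j p = y j p"
      using y0 by (cases j) (auto simp: sylvester_column_def T_def complex_eq_iff)
  qed
  moreover have "T' = T" if "?P T'" for T'
  proof (rule eq_matI)
    fix p q assume "p < dim_row T" "q < dim_col T"
    then have pq: "p < ?n" "q < ?n" using T by auto
    then have "cpair (\<lambda>q. T' $$ (p, q)) j = cpair (\<lambda>q. T $$ (p, q)) j" if "j \<le> k" for j
      using \<open>?P T\<close> \<open>?P T'\<close> that by (simp add: sylvester_column_cpair)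
    then show "T' $$ (p, q) = T $$ (p, q)" using pq(2) by (rule cpair_inject)
  qed (use that T in auto)
  ultimately have "?P (THE T. ?P T)" by (rule theI)
  moreover have "sylvester_solution k \<alpha>f \<beta>f \<omega>h = (THE T. ?P T)"
    unfolding sylvester_solution_def y_def
    by (rule arg_cong[of _ _ The], intro ext conj_cong refl sylvester_equation_columns)
  ultimately have P: "?P (sylvester_solution k \<alpha>f \<beta>f \<omega>h)" by simp
  show "sylvester_solution k \<alpha>f \<beta>f \<omega>h \<in> carrier_mat ?n ?n" using P by blast
  show "j \<le> k \<Longrightarrow> p < ?n \<Longrightarrow> sylvester_column (sylvester_solution k \<alpha>f \<beta>f \<omega>h) j p
    = sylvester_root \<omega>h j ^ p / pchar (sylvester_root \<omega>h j)" using P by (simp add: y_def)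
qed

text \<open>0, the points \<open>\<i> * \<omega>h j\<close> and their conjugates are
  \<open>2 * k + 1\<close> distinct roots, one more than the degree allows. This yields the
  invertibility of the Sylvester solution \<open>T\<close>.\<close>

lemma real_poly_roots_imp_zero:
  fixes u :: "nat \<Rightarrow> real"
  assumes \<omega>h: "\<And>j. j \<in> {1..k} \<Longrightarrow> 0 < \<omega>h j" "inj_on \<omega>h {1..k}"
    and zero: "\<And>j. j \<le> k \<Longrightarrow> (\<Sum>p<2 * k + 1. complex_of_real (u p) * sylvester_root \<omega>h j ^ p) = 0"
    and p: "p < 2 * k + 1"
  shows "u p = 0"
proof -
  let ?r = "sylvester_root \<omega>h"
  define U where "U = (\<Sum>p<2 * k + 1. monom (complex_of_real (u p)) p)"
  have coeffU: "coeff U i = (if i < 2 * k + 1 then complex_of_real (u i) else 0)" for i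
    by (simp add: U_def coeff_sum del: sum.lessThan_Suc)
  have polyU: "poly U s = (\<Sum>p<2 * k + 1. complex_of_real (u p) * s ^ p)" for s
    by (simp add: U_def poly_sum poly_monom del: sum.lessThan_Suc)
  have "U = 0"
  proof (rule ccontr)
    assume U: "U \<noteq> 0"
    have cnj: "poly U (cnj s) = cnj (poly U s)" for s by (simp add: polyU del: sum.lessThan_Suc)
    let ?A = "?r ` {..k}" and ?B = "(\<lambda>j. cnj (?r j)) ` {1..k}"
    have inj: "inj_on ?r {..k}"
    proof (rule inj_onI)
      fix i j assume ij: "i \<in> {..k}" "j \<in> {..k}" "?r i = ?r j"
      then show "i = j"
        using \<omega>h(1)[of i] \<omega>h(1)[of j] inj_onD[OF \<omega>h(2), of i j]
        by (auto simp: sylvester_root_def split: if_splits)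
    qed
    have "inj_on (\<lambda>j. cnj (?r j)) {1..k}"
      using inj by (auto simp: inj_on_def)
    then have "card ?B = k" by (simp add: card_image)
    moreover have "card ?A = Suc k" using inj by (simp add: card_image)
    moreover have "?A \<inter> ?B = {}"
    proof -
      have "0 \<le> Im s" if "s \<in> ?A" for s
        using that less_imp_le[OF \<omega>h(1)] by (auto simp: sylvester_root_def)
      moreover have "Im s < 0" if "s \<in> ?B" for s
        using that \<omega>h(1) by (auto simp: sylvester_root_def)
      ultimately show ?thesis by force
    qed
    ultimately have "card (?A \<union> ?B) = 2 * k + 1" by (subst card_Un_disjoint) auto
    moreover have "poly U (?r j) = 0" if "j \<le> k" for j
      using zero[OF that] by (simp only: polyU)
    then have "?A \<union> ?B \<subseteq> {s. poly U s = 0}" by (auto simp: cnj)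
    then have "card (?A \<union> ?B) \<le> card {s. poly U s = 0}"
      by (rule card_mono[OF poly_roots_finite[OF U]])
    moreover have "card {s. poly U s = 0} \<le> degree U" by (rule card_poly_roots_bound[OF U])
    moreover have "degree U \<le> 2 * k" by (rule degree_le) (simp add: coeffU)
    ultimately show False by simp
  qed
  then show ?thesis using coeffU[of p] p by simp
qed

text \<open>The inverse is never computed; it suffices to find the row \<open>u\<close> whose
  product with \<open>T\<close> is \<open>output_row0\<close>. As a polynomial, \<open>u\<close> has
  to vanish at 0 and to agree with \<open>pchar\<close> at the points
  \<open>\<i> * \<omega>h j\<close>. Subtracting from \<open>pchar\<close> the polynomial of the
  estimates, taken at \<open>s\<^sup>2\<close> and multiplied by
  \<open>s + \<beta>f 0 / sq_coeff k \<alpha>h 0\<close>, achieves both and lowers the degree to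
  \<open>2 * k\<close>. The factor \<open>s\<close> produces the identifier row, the constant the
  combination of even states.\<close>

lemma compensation_formula:
  assumes est: "frequency_estimates k \<omega> \<mu> \<alpha>h \<omega>h" and \<mu>: "\<mu> > 0" and \<eta>: "\<eta> \<in> carrier_vec (2 * k + 1)"
  shows "compensation k \<alpha>f \<beta>f \<omega>h \<eta>
    = (\<Sum>p<2 * k + 1. interleave \<beta>f (\<lambda>j. \<alpha>f j - \<alpha>h j) p * vec_index \<eta> p)
      - \<beta>f 0 * (\<Sum>m\<le>k. sq_coeff k \<alpha>h m / sq_coeff k \<alpha>h 0 * vec_index \<eta> (2 * m))"
proof -
  let ?n = "2 * k + 1" and ?r = "sylvester_root \<omega>h"
  define T where "T = sylvester_solution k \<alpha>f \<beta>f \<omega>h"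
  note T = sylvester_solution_columns[where \<omega>h=\<omega>h, folded T_def]
  have pos: "0 < \<omega>h j" if "j \<in> {1..k}" for j
    using est that \<mu> by (force simp: frequency_estimates_def)
  have inj: "inj_on \<omega>h {1..k}" using est by (simp add: frequency_estimates_def)
  have A0: "0 < sq_coeff k \<alpha>h 0"
    using estimate_coeff_bounds(1)[OF est \<mu>] \<mu> zero_less_power[OF \<mu>, of "2 * k"] by linarith
  have nz: "pchar (?r j) \<noteq> 0" for j by (intro pchar_nonzero) (simp add: Re_sylvester_root)
  have mult: "cpair (vec_index (transpose_mat T *\<^sub>v u)) j
      = (\<Sum>p<?n. complex_of_real (vec_index u p) * ?r j ^ p) / pchar (?r j)"
    if u: "u \<in> carrier_vec ?n" and j: "j \<le> k" for u j
  proof -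
    have "vec_index (transpose_mat T *\<^sub>v u) q = (\<Sum>p<?n. vec_index u p * T $$ (p, q))" if "q < ?n" for q
      using that T(1) u by (simp add: scalar_prod_def lessThan_atLeast0 mult.commute del: sum.op_ivl_Suc sum.lessThan_Suc)
    then have "cpair (vec_index (transpose_mat T *\<^sub>v u)) j = cpair (\<lambda>q. \<Sum>p<?n. vec_index u p * T $$ (p, q)) j"
      using j by (simp add: cpair_def del: sum.lessThan_Suc)
    also have "\<dots> = (\<Sum>p<?n. complex_of_real (vec_index u p) * (?r j ^ p / pchar (?r j)))"
      unfolding cpair_sum using j T(2) by (simp add: sylvester_column_cpair del: sum.lessThan_Suc)
    finally show ?thesis by (simp add: sum_divide_distrib del: sum.lessThan_Suc)
  qed
  \<comment> \<open>A kernel vector of the transpose is the coefficient vector of a polynomial that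
    vanishes at all the roots.\<close>
  have "Determinant.det (transpose_mat T) \<noteq> 0"
  proof
    assume "Determinant.det (transpose_mat T) = 0"
    then obtain u where u: "u \<in> carrier_vec ?n" "u \<noteq> 0\<^sub>v ?n" "transpose_mat T *\<^sub>v u = 0\<^sub>v ?n"
      using det_0_iff_vec_prod_zero[of "transpose_mat T" ?n] T(1) by auto
    have "(\<Sum>p<?n. complex_of_real (vec_index u p) * ?r j ^ p) = 0" if "j \<le> k" for j
    proof -
      have "cpair (vec_index (0\<^sub>v ?n)) j = (0 :: complex)" using that by (simp add: cpair_def complex_eq_iff)
      then have "(\<Sum>p<?n. complex_of_real (vec_index u p) * ?r j ^ p) / pchar (?r j) = 0"
        using mult[OF u(1) that] unfolding u(3) by (simp only:)
      then show ?thesis using nz[of j] by (simp only: divide_eq_0_iff simp_thms)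
    qed
    then have "vec_index u p = 0" if "p < ?n" for p
      using real_poly_roots_imp_zero[OF pos inj _ that] by blast
    then have "u = 0\<^sub>v ?n" using u(1) by (intro eq_vecI) auto
    then show False using u(2) by contradiction
  qed
  then have "T \<in> Units (ring_mat TYPE(real) ?n ())"
    using det_transpose[OF T(1)] det_non_zero_imp_unit[OF T(1)] by simp
  then obtain Y where Y: "mat_inverse T = Some Y"
    using mat_inverse(1)[OF T(1), where b="()"] by (cases "mat_inverse T") auto
  have TY: "T * Y = 1\<^sub>m ?n" "Y \<in> carrier_mat ?n ?n" using mat_inverse(2)[OF T(1) Y] by auto
  define u where "u = Matrix.vec ?n (\<lambda>p. interleave \<beta>f (\<lambda>j. \<alpha>f j - \<alpha>h j) p
    - (if even p then \<beta>f 0 / sq_coeff k \<alpha>h 0 * sq_coeff k \<alpha>h (p div 2) else 0))"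
  have u: "u \<in> carrier_vec ?n" by (simp add: u_def)
  have upoly: "(\<Sum>p<?n. complex_of_real (vec_index u p) * s ^ p) = pchar s
      - (s + complex_of_real (\<beta>f 0 / sq_coeff k \<alpha>h 0)) * (\<Sum>m\<le>k. complex_of_real (sq_coeff k \<alpha>h m) * (s\<^sup>2) ^ m)" for s
  proof -
    have "(\<Sum>p<?n. complex_of_real (vec_index u p) * s ^ p)
      = (\<Sum>p<?n. complex_of_real (interleave \<beta>f (\<lambda>j. \<alpha>f j - \<alpha>h j) p) * s ^ p)
        - (\<Sum>p<?n. complex_of_real (if even p then \<beta>f 0 / sq_coeff k \<alpha>h 0 * sq_coeff k \<alpha>h (p div 2) else 0) * s ^ p)"
      unfolding sum_subtractf[symmetric]
      by (intro sum.cong refl) (simp add: u_def left_diff_distrib)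
    also have "(\<Sum>p<?n. complex_of_real (if even p then \<beta>f 0 / sq_coeff k \<alpha>h 0 * sq_coeff k \<alpha>h (p div 2) else 0) * s ^ p)
      = complex_of_real (\<beta>f 0 / sq_coeff k \<alpha>h 0) * (\<Sum>m\<le>k. complex_of_real (sq_coeff k \<alpha>h m) * (s\<^sup>2) ^ m)"
      unfolding sum_even_odd by (simp add: sum_distrib_left power_mult mult.assoc)
    finally show ?thesis
      unfolding char_fun_interleave_diff by (simp only: distrib_right diff_diff_eq)
  qed
  have "transpose_mat T *\<^sub>v u = output_row0 k"
  proof (rule eq_vecI)
    fix q assume "q < dim_vec (output_row0 k)"
    then have q: "q < ?n" by (simp add: output_row0_def)
    have "cpair (vec_index (transpose_mat T *\<^sub>v u)) j = cpair (vec_index (output_row0 k)) j" if j: "j \<le> k" for j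
    proof (cases "j = 0")
      case True
      have "(\<Sum>m\<le>k. complex_of_real (sq_coeff k \<alpha>h m) * ((0::complex)\<^sup>2) ^ m) = complex_of_real (sq_coeff k \<alpha>h 0)"
        by (simp add: power_0_left if_distrib cong: if_cong)
      then have "(\<Sum>p<?n. complex_of_real (vec_index u p) * ?r j ^ p) = 0"
        unfolding upoly using A0 True by (simp add: sylvester_root_def pchar_0)
      then show ?thesis using mult[OF u j] True by (simp add: cpair_def output_row0_def)
    next
      case False
      then have "(\<Sum>p<?n. complex_of_real (vec_index u p) * ?r j ^ p) = pchar (?r j)"
        unfolding upoly using estimate_root[OF est, of j] j by (simp add: sylvester_root_def)
      then have "cpair (vec_index (transpose_mat T *\<^sub>v u)) j = 1" using mult[OF u j] nz[of j] by simp
      also have "1 = cpair (vec_index (output_row0 k)) j"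
        using False j by (simp add: cpair_def output_row0_def complex_eq_iff)
      finally show ?thesis .
    qed
    then show "vec_index (transpose_mat T *\<^sub>v u) q = vec_index (output_row0 k) q" using q by (rule cpair_inject)
  qed (use T(1) in \<open>simp add: output_row0_def\<close>)
  then have "compensation k \<alpha>f \<beta>f \<omega>h \<eta> = Matrix.scalar_prod (transpose_mat T *\<^sub>v u) (Y *\<^sub>v \<eta>)"
    by (simp add: compensation_def T_def[symmetric] Y)
  also have "\<dots> = Matrix.scalar_prod u (T *\<^sub>v (Y *\<^sub>v \<eta>))"
    by (rule transpose_vec_mult_scalar[OF T(1) _ u]) (use TY \<eta> in auto)
  also have "T *\<^sub>v (Y *\<^sub>v \<eta>) = \<eta>"
    using assoc_mult_mat_vec[OF T(1) TY(2) \<eta>] TY(1) \<eta> by simp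
  also have "Matrix.scalar_prod u \<eta> = (\<Sum>p<?n. vec_index u p * vec_index \<eta> p)"
    using \<eta> by (simp add: scalar_prod_def lessThan_atLeast0 del: sum.op_ivl_Suc sum.lessThan_Suc)
  also have "\<dots> = (\<Sum>p<?n. interleave \<beta>f (\<lambda>j. \<alpha>f j - \<alpha>h j) p * vec_index \<eta> p)
      - (\<Sum>p<?n. (if even p then \<beta>f 0 / sq_coeff k \<alpha>h 0 * sq_coeff k \<alpha>h (p div 2) else 0) * vec_index \<eta> p)"
    unfolding sum_subtractf[symmetric]
    by (intro sum.cong refl) (simp add: u_def left_diff_distrib)
  also have "(\<Sum>p<?n. (if even p then \<beta>f 0 / sq_coeff k \<alpha>h 0 * sq_coeff k \<alpha>h (p div 2) else 0) * vec_index \<eta> p)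
      = \<beta>f 0 * (\<Sum>m\<le>k. sq_coeff k \<alpha>h m / sq_coeff k \<alpha>h 0 * vec_index \<eta> (2 * m))"
    unfolding sum_even_odd by (simp add: sum_distrib_left mult.assoc)
  finally show ?thesis .
qed

end

section \<open>Persistence of excitation\<close>

lemma abs_integral_cos_le:
  fixes a b \<nu> \<psi> :: real
  assumes "\<nu> \<noteq> 0" "a \<le> b"
  shows "\<bar>integral {a..b} (\<lambda>t. cos (\<nu> * t + \<psi>))\<bar> \<le> 2 / \<bar>\<nu>\<bar>"
proof -
  have "((\<lambda>t. cos (\<nu> * t + \<psi>)) has_integral sin (\<nu> * b + \<psi>) / \<nu> - sin (\<nu> * a + \<psi>) / \<nu>) {a..b}"
    by (rule fundamental_theorem_of_calculus[OF assms(2)])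
       (use assms(1) in \<open>auto intro!: derivative_eq_intros simp: has_real_derivative_iff_has_vector_derivative[symmetric]\<close>)
  then have "\<bar>integral {a..b} (\<lambda>t. cos (\<nu> * t + \<psi>))\<bar> = \<bar>sin (\<nu> * b + \<psi>) - sin (\<nu> * a + \<psi>)\<bar> / \<bar>\<nu>\<bar>"
    by (simp add: integral_unique diff_divide_distrib[symmetric])
  also have "\<dots> \<le> 2 / \<bar>\<nu>\<bar>"
    using abs_sin_le_one[of "\<nu> * b + \<psi>"] abs_sin_le_one[of "\<nu> * a + \<psi>"]
    by (intro divide_right_mono) linarith+
  finally show ?thesis .
qed

text \<open>Sinusoids of distinct frequencies are asymptotically orthogonal, uniformly in the position of
  the window; hence a sufficiently long window sees all amplitudes.\<close>

lemma sinusoids_persistently_exciting: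
  fixes \<omega> \<psi> r :: "nat \<Rightarrow> real"
  assumes fin: "finite J" and pos: "\<And>j. j \<in> J \<Longrightarrow> 0 < \<omega> j" and inj: "inj_on \<omega> J"
  obtains \<tau> where "\<tau> > 0" "\<And>b s. (\<Sum>j\<in>J. (b j)\<^sup>2)
    \<le> integral {s..s + \<tau>} (\<lambda>t. (\<Sum>j\<in>J. b j * cos (\<omega> j * t + \<psi> j))\<^sup>2)"
proof -
  \<comment> \<open>Bounds the integrals at all sum and difference frequencies, wherever the window
    lies.\<close>
  define M where "M = (\<Sum>i\<in>J. \<Sum>j\<in>J. 2 / \<bar>\<omega> i + \<omega> j\<bar> + (if i = j then 0 else 2 / \<bar>\<omega> i - \<omega> j\<bar>))"
  have M0: "0 \<le> M" unfolding M_def by (intro sum_nonneg add_nonneg_nonneg) auto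
  define N where "N = real (card J)"
  \<comment> \<open>The diagonal contributes \<open>\<tau> / 2\<close> and the error terms at most
    \<open>M * N / 2\<close>; with this length the difference is 1.\<close>
  define \<tau> where "\<tau> = 2 + M * N"
  have \<tau>: "0 < \<tau>" using M0 by (simp add: \<tau>_def N_def add_pos_nonneg)
  define I where "I s i j = integral {s..s + \<tau>} (\<lambda>t. cos (\<omega> i * t + \<psi> i) * cos (\<omega> j * t + \<psi> j))" for s i j
  have I: "\<bar>I s i j - (if i = j then \<tau> / 2 else 0)\<bar> \<le> M / 2" if ij: "i \<in> J" "j \<in> J" for s i j
  proof -
    let ?c1 = "\<lambda>t. cos ((\<omega> i - \<omega> j) * t + (\<psi> i - \<psi> j))" and ?c2 = "\<lambda>t. cos ((\<omega> i + \<omega> j) * t + (\<psi> i + \<psi> j))"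
    have int: "?c1 integrable_on {s..s + \<tau>}" "?c2 integrable_on {s..s + \<tau>}"
      by (intro integrable_continuous_interval continuous_intros)+
    have "I s i j = integral {s..s + \<tau>} (\<lambda>t. (1/2) * ?c1 t + (1/2) * ?c2 t)"
      unfolding I_def by (simp add: cos_times_cos algebra_simps add_divide_distrib)
    also have "\<dots> = (1/2) * integral {s..s + \<tau>} ?c1 + (1/2) * integral {s..s + \<tau>} ?c2"
      using int by (subst integral_add) (simp_all add: integrable_on_cmult_left)
    finally have eq: "I s i j = (1/2) * integral {s..s + \<tau>} ?c1 + (1/2) * integral {s..s + \<tau>} ?c2" .
    have c2: "\<bar>integral {s..s + \<tau>} ?c2\<bar> \<le> 2 / \<bar>\<omega> i + \<omega> j\<bar>"
      using pos[OF ij(1)] pos[OF ij(2)] \<tau> by (intro abs_integral_cos_le) auto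
    have c1: "\<bar>integral {s..s + \<tau>} ?c1 - (if i = j then \<tau> else 0)\<bar> \<le> (if i = j then 0 else 2 / \<bar>\<omega> i - \<omega> j\<bar>)"
    proof (cases "i = j")
      case True
      then show ?thesis using \<tau> by simp
    next
      case False
      then have "\<omega> i \<noteq> \<omega> j" using inj ij by (auto dest: inj_onD)
      then show ?thesis using False abs_integral_cos_le[of "\<omega> i - \<omega> j" s "s + \<tau>"] \<tau> by simp
    qed
    have le_M: "2 / \<bar>\<omega> i + \<omega> j\<bar> + (if i = j then 0 else 2 / \<bar>\<omega> i - \<omega> j\<bar>) \<le> M"
    proof -
      have "2 / \<bar>\<omega> i + \<omega> j\<bar> + (if i = j then 0 else 2 / \<bar>\<omega> i - \<omega> j\<bar>)
          \<le> (\<Sum>j\<in>J. 2 / \<bar>\<omega> i + \<omega> j\<bar> + (if i = j then 0 else 2 / \<bar>\<omega> i - \<omega> j\<bar>))"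
        by (rule member_le_sum[OF ij(2) _ fin]) auto
      also have "\<dots> \<le> M" unfolding M_def
        by (rule member_le_sum[OF ij(1) _ fin, of "\<lambda>i. \<Sum>j\<in>J. 2 / \<bar>\<omega> i + \<omega> j\<bar> + (if i = j then 0 else 2 / \<bar>\<omega> i - \<omega> j\<bar>)"])
           (auto intro!: sum_nonneg add_nonneg_nonneg)
      finally show ?thesis .
    qed
    have "(if i = j then \<tau> / 2 else 0) = (1/2) * (if i = j then \<tau> else 0)" by simp
    then show ?thesis using c1 c2 le_M unfolding eq by linarith
  qed
  have "(\<Sum>j\<in>J. (b j)\<^sup>2) \<le> integral {s..s + \<tau>} (\<lambda>t. (\<Sum>j\<in>J. b j * cos (\<omega> j * t + \<psi> j))\<^sup>2)" for b s
  proof -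
    have "(\<lambda>t. (\<Sum>j\<in>J. b j * cos (\<omega> j * t + \<psi> j))\<^sup>2)
        = (\<lambda>t. \<Sum>i\<in>J. \<Sum>j\<in>J. (b i * b j) * (cos (\<omega> i * t + \<psi> i) * cos (\<omega> j * t + \<psi> j)))"
      by (simp add: power2_eq_square sum_product mult_ac)
    then have "integral {s..s + \<tau>} (\<lambda>t. (\<Sum>j\<in>J. b j * cos (\<omega> j * t + \<psi> j))\<^sup>2)
        = (\<Sum>i\<in>J. \<Sum>j\<in>J. (b i * b j) * I s i j)"
      unfolding I_def
      by (simp add: integral_sum[OF fin] integrable_continuous_interval continuous_intros
          integrable_sum[OF fin])
    also have "\<dots> \<ge> (\<Sum>i\<in>J. \<Sum>j\<in>J. (if i = j then \<tau> / 2 * (b i)\<^sup>2 else 0) - M / 2 * (\<bar>b i\<bar> * \<bar>b j\<bar>))"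
    proof (intro sum_mono)
      fix i j assume ij: "i \<in> J" "j \<in> J"
      have "\<bar>(b i * b j) * (I s i j - (if i = j then \<tau> / 2 else 0))\<bar> \<le> M / 2 * (\<bar>b i\<bar> * \<bar>b j\<bar>)"
        unfolding abs_mult mult.commute[of "M / 2"] using I[OF ij, of s] by (intro mult_left_mono) (auto simp: abs_mult)
      moreover have "(b i * b j) * I s i j
          = (b i * b j) * (I s i j - (if i = j then \<tau> / 2 else 0)) + (if i = j then \<tau> / 2 * (b i)\<^sup>2 else 0)"
        by (simp add: algebra_simps power2_eq_square)
      ultimately show "(if i = j then \<tau> / 2 * (b i)\<^sup>2 else 0) - M / 2 * (\<bar>b i\<bar> * \<bar>b j\<bar>) \<le> (b i * b j) * I s i j"
        by linarith
    qed
    also have "(\<Sum>i\<in>J. \<Sum>j\<in>J. (if i = j then \<tau> / 2 * (b i)\<^sup>2 else 0) - M / 2 * (\<bar>b i\<bar> * \<bar>b j\<bar>))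
        = \<tau> / 2 * (\<Sum>i\<in>J. (b i)\<^sup>2) - M / 2 * (\<Sum>i\<in>J. \<bar>b i\<bar>)\<^sup>2"
    proof -
      have "(\<Sum>i\<in>J. \<Sum>j\<in>J. M / 2 * (\<bar>b i\<bar> * \<bar>b j\<bar>)) = M / 2 * (\<Sum>i\<in>J. \<bar>b i\<bar>)\<^sup>2"
        unfolding power2_eq_square sum_product by (simp only: sum_distrib_left)
      moreover have "(\<Sum>i\<in>J. \<Sum>j\<in>J. if i = j then \<tau> / 2 * (b i)\<^sup>2 else 0) = \<tau> / 2 * (\<Sum>i\<in>J. (b i)\<^sup>2)"
        using fin by (simp add: sum_distrib_left)
      ultimately show ?thesis by (simp only: sum_subtractf)
    qed
    finally have ge: "\<tau> / 2 * (\<Sum>i\<in>J. (b i)\<^sup>2) - M / 2 * (\<Sum>i\<in>J. \<bar>b i\<bar>)\<^sup>2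
        \<le> integral {s..s + \<tau>} (\<lambda>t. (\<Sum>j\<in>J. b j * cos (\<omega> j * t + \<psi> j))\<^sup>2)" .
    have "(\<Sum>i\<in>J. \<bar>b i\<bar>)\<^sup>2 \<le> N * (\<Sum>i\<in>J. (b i)\<^sup>2)"
      using Cauchy_Schwarz_ineq_sum[of "\<lambda>_. 1" "\<lambda>i. \<bar>b i\<bar>" J] by (simp add: N_def)
    then have "M / 2 * (\<Sum>i\<in>J. \<bar>b i\<bar>)\<^sup>2 \<le> M / 2 * (N * (\<Sum>i\<in>J. (b i)\<^sup>2))"
      using M0 by (intro mult_left_mono) auto
    then show ?thesis using ge by (simp add: \<tau>_def algebra_simps)
  qed
  then show ?thesis using that \<tau> by blast
qed

text \<open>Coefficients of a polynomial of degree below \<open>k\<close> are bounded by its values at \<open>k\<close> points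
  (Lagrange interpolation).\<close>

lemma coefficients_le_values:
  fixes x :: "nat \<Rightarrow> real"
  assumes inj: "inj_on x {1..k}"
  obtains C where "C > 0" "\<And>a. (\<Sum>m=1..k. (a m)\<^sup>2) \<le> C * (\<Sum>j=1..k. (\<Sum>m=1..k. a m * x j ^ (m - 1))\<^sup>2)"
proof -
  define lag where "lag j = (\<Prod>i\<in>{1..k} - {j}. Polynomial.smult (1 / (x j - x i)) [:- x i, 1:])" for j
  have lag: "poly (lag j) (x i) = (if i = j then 1 else 0)" if ij: "i \<in> {1..k}" "j \<in> {1..k}" for i j
  proof (cases "i = j")
    case True
    have "x j - x l \<noteq> 0" if "l \<in> {1..k} - {j}" for l using inj that ij by (auto dest: inj_onD)
    then have "poly (lag j) (x j) = (\<Prod>i\<in>{1..k} - {j}. 1)"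
      unfolding lag_def poly_prod by (intro prod.cong refl) (simp add: diff_divide_distrib[symmetric])
    then show ?thesis using True by simp
  next
    case False
    then have "i \<in> {1..k} - {j}" using ij by auto
    then show ?thesis using False unfolding lag_def poly_prod
      by (simp, intro prod_zero bexI[of _ i]) auto
  qed
  have deglag: "degree (lag j) < k" if "j \<in> {1..k}" for j
  proof -
    have "degree (lag j) \<le> (\<Sum>i\<in>{1..k} - {j}. degree (Polynomial.smult (1 / (x j - x i)) [:- x i, 1:]))"
      unfolding lag_def by (intro order_trans[OF degree_prod_sum_le]) (auto simp: o_def)
    also have "\<dots> \<le> (\<Sum>i\<in>{1..k} - {j}. 1)" by (intro sum_mono) (simp add: degree_smult_le[THEN order_trans])
    also have "\<dots> = k - 1" using that by simp
    finally show ?thesis using that by (auto intro: le_less_trans)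
  qed
  define K where "K = (\<Sum>m=1..k. \<Sum>j=1..k. (coeff (lag j) (m - 1))\<^sup>2)"
  have K0: "0 \<le> K" unfolding K_def by (intro sum_nonneg) auto
  have "(\<Sum>m=1..k. (a m)\<^sup>2) \<le> (K + 1) * (\<Sum>j=1..k. (\<Sum>m=1..k. a m * x j ^ (m - 1))\<^sup>2)" for a :: "nat \<Rightarrow> real"
  proof -
    define P where "P = (\<Sum>m=1..k. monom (a m) (m - 1))"
    define v where "v j = poly P (x j)" for j
    define Q where "Q = (\<Sum>j=1..k. Polynomial.smult (v j) (lag j))"
    have coeffP: "coeff P (m - 1) = a m" if "m \<in> {1..k}" for m
    proof -
      have "coeff P (m - 1) = (\<Sum>i=1..k. if i = m then a i else 0)"
        unfolding P_def coeff_sum using that by (intro sum.cong refl) auto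
      then show ?thesis using that by simp
    qed
    have "P - Q = 0"
    proof (rule ccontr)
      assume nz: "P - Q \<noteq> 0"
      have "poly Q (x i) = v i" if "i \<in> {1..k}" for i
      proof -
        have "poly Q (x i) = (\<Sum>j=1..k. if j = i then v j else 0)"
          unfolding Q_def poly_sum using that lag by (intro sum.cong refl) auto
        then show ?thesis using that by simp
      qed
      then have "x ` {1..k} \<subseteq> {y. poly (P - Q) y = 0}" by (auto simp: v_def)
      then have "card (x ` {1..k}) \<le> card {y. poly (P - Q) y = 0}"
        by (rule card_mono[OF poly_roots_finite[OF nz]])
      also have "\<dots> \<le> degree (P - Q)" by (rule card_poly_roots_bound[OF nz])
      finally have k: "k \<le> degree (P - Q)" using inj by (simp add: card_image)
      have k0: "0 < k"
      proof (rule ccontr)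
        assume "\<not> 0 < k"
        then show False using nz by (simp add: P_def Q_def)
      qed
      have "degree P < k" unfolding P_def
        using k0 by (intro degree_sum_less) (auto intro: le_less_trans[OF degree_monom_le])
      moreover have "degree Q < k" unfolding Q_def
        using k0 deglag by (intro degree_sum_less) (auto intro: le_less_trans[OF degree_smult_le])
      ultimately show False using k degree_diff_less[of P k Q] by simp
    qed
    then have PQ: "P = Q" by simp
    have "(a m)\<^sup>2 \<le> (\<Sum>j=1..k. (coeff (lag j) (m - 1))\<^sup>2) * (\<Sum>j=1..k. (v j)\<^sup>2)" if m: "m \<in> {1..k}" for m
    proof -
      have "a m = (\<Sum>j=1..k. coeff (lag j) (m - 1) * v j)"
        unfolding coeffP[OF m, symmetric] PQ by (simp add: Q_def coeff_sum mult.commute)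
      then show ?thesis using Cauchy_Schwarz_ineq_sum by metis
    qed
    then have "(\<Sum>m=1..k. (a m)\<^sup>2) \<le> (\<Sum>m=1..k. (\<Sum>j=1..k. (coeff (lag j) (m - 1))\<^sup>2) * (\<Sum>j=1..k. (v j)\<^sup>2))"
      by (rule sum_mono)
    also have "\<dots> = K * (\<Sum>j=1..k. (v j)\<^sup>2)" by (simp add: K_def sum_distrib_right)
    also have "\<dots> \<le> (K + 1) * (\<Sum>j=1..k. (v j)\<^sup>2)" by (intro mult_right_mono sum_nonneg) auto
    also have "(\<Sum>j=1..k. (v j)\<^sup>2) = (\<Sum>j=1..k. (\<Sum>m=1..k. a m * x j ^ (m - 1))\<^sup>2)"
      by (simp add: v_def P_def poly_sum poly_monom)
    finally show ?thesis .
  qed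
  then show ?thesis using that[of "K + 1"] K0 by simp
qed

text \<open>For the squared parameter error \<open>V\<close> one has
  \<open>V' = 2 l e (d - e) = l d^2 - l e^2 - l (d - e)^2\<close>. The regressor drops out of this
  identity, so its size does not enter the bound.\<close>

lemma identifier_L2:
  fixes e d :: "'p \<Rightarrow> real \<Rightarrow> real" and \<alpha> y :: "'p \<Rightarrow> nat \<Rightarrow> real \<Rightarrow> real"
  assumes l: "l > 0" and d: "L2_family S d"
    and y: "\<And>p W m. S p W \<Longrightarrow> m \<in> J \<Longrightarrow> lbm (y p m)"
    and e: "\<And>p W. S p W \<Longrightarrow> lbm (e p)"
      "\<And>p W t. S p W \<Longrightarrow> 0 \<le> t \<Longrightarrow> e p t = d p t - (\<Sum>m\<in>J. \<alpha> p m t * y p m t)"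
    and \<alpha>: "\<And>p W m. S p W \<Longrightarrow> m \<in> J \<Longrightarrow> primitive (\<lambda>t. l * e p t * y p m t) (\<alpha> p m)"
      "\<And>p W m. S p W \<Longrightarrow> m \<in> J \<Longrightarrow> \<alpha> p m 0 = a0 m"
  shows "L2_family S e"
proof -
  obtain K where K: "K \<ge> 0" "\<And>p W. S p W \<Longrightarrow> 0 \<le> W" "\<And>p W. S p W \<Longrightarrow> lbm (d p)"
    "\<And>p W T. S p W \<Longrightarrow> 0 \<le> T \<Longrightarrow> integral {0..T} (\<lambda>t. (norm (d p t))\<^sup>2) \<le> K * (1 + W)"
    using d unfolding L2_family_def by auto
  define V0 where "V0 = (\<Sum>m\<in>J. a0 m * a0 m)"
  have V0: "0 \<le> V0" unfolding V0_def by (intro sum_nonneg) simp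
  show ?thesis
  proof (rule L2_familyI[of "V0 / l + K"])
    show "0 \<le> V0 / l + K" using V0 K(1) l by simp
  next
    fix p W T assume S: "S p W" and T: "0 \<le> (T::real)"
    let ?v = "\<lambda>t. \<Sum>m\<in>J. (l * e p t * y p m t) * \<alpha> p m t + \<alpha> p m t * (l * e p t * y p m t)"
    have pV: "primitive ?v (\<lambda>t. \<Sum>m\<in>J. \<alpha> p m t * \<alpha> p m t)"
      by (intro primitive_sum primitive_mult \<alpha>(1)[OF S])
    have le: "?v t \<le> l * (d p t)\<^sup>2 - l * (e p t)\<^sup>2" if t: "0 \<le> t" for t
    proof -
      have "?v t = 2 * l * e p t * (\<Sum>m\<in>J. \<alpha> p m t * y p m t)"
        by (simp add: sum_distrib_left mult_ac)
      also have "(\<Sum>m\<in>J. \<alpha> p m t * y p m t) = d p t - e p t" using e(2)[OF S t] by simp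
      also have "2 * l * e p t * (d p t - e p t) = l * (d p t)\<^sup>2 - l * (e p t)\<^sup>2 - l * (d p t - e p t)\<^sup>2"
        by (simp add: power2_eq_square algebra_simps)
      finally show ?thesis using l by simp
    qed
    have "(\<Sum>m\<in>J. \<alpha> p m T * \<alpha> p m T) - (\<Sum>m\<in>J. \<alpha> p m 0 * \<alpha> p m 0)
        \<le> integral {0..T} (\<lambda>t. l * (d p t)\<^sup>2 - l * (e p t)\<^sup>2)"
      by (rule primitive_le_integral[OF pV _ le T]) (intro lbm_diff lbm_cmult lbm_power2 K(3)[OF S] e(1)[OF S])
    also have "\<dots> = l * integral {0..T} (\<lambda>t. (d p t)\<^sup>2) - l * integral {0..T} (\<lambda>t. (e p t)\<^sup>2)"
      by (subst integral_diff)
         (simp_all only: integral_mult_right, (intro lbm_integrable lbm_cmult lbm_power2 K(3)[OF S] e(1)[OF S] order_refl)+)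
    finally have "l * integral {0..T} (\<lambda>t. (e p t)\<^sup>2) \<le> V0 + l * integral {0..T} (\<lambda>t. (d p t)\<^sup>2)"
    proof -
      assume *: "(\<Sum>m\<in>J. \<alpha> p m T * \<alpha> p m T) - (\<Sum>m\<in>J. \<alpha> p m 0 * \<alpha> p m 0)
        \<le> l * integral {0..T} (\<lambda>t. (d p t)\<^sup>2) - l * integral {0..T} (\<lambda>t. (e p t)\<^sup>2)"
      have "(\<Sum>m\<in>J. \<alpha> p m 0 * \<alpha> p m 0) = V0"
        unfolding V0_def using \<alpha>(2)[OF S] by (intro sum.cong refl) simp
      moreover have "0 \<le> (\<Sum>m\<in>J. \<alpha> p m T * \<alpha> p m T)" by (intro sum_nonneg) simp
      ultimately show ?thesis using * by linarith
    qed
    also have "\<dots> \<le> V0 + l * (K * (1 + W))"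
      using K(4)[OF S T] l by (intro add_left_mono mult_left_mono) auto
    also have "\<dots> \<le> l * ((V0 / l + K) * (1 + W))"
    proof -
      have "l * ((V0 / l + K) * (1 + W)) = (V0 + l * K) * (1 + W)"
        using l by (simp add: distrib_left flip: mult.assoc)
      then show ?thesis using mult_nonneg_nonneg[OF V0 K(2)[OF S]] by (simp add: algebra_simps)
    qed
    finally show "integral {0..T} (\<lambda>t. (norm (e p t))\<^sup>2) \<le> (V0 / l + K) * (1 + W)"
      using l by simp
  qed (use K(2) e(1) in auto)
qed

lemma integral_affine_combination:
  fixes f g :: "real \<Rightarrow> real"
  assumes "lbm f" "lbm g" "0 \<le> s" "0 \<le> \<tau>"
  shows "integral {s..s + \<tau>} (\<lambda>r. p * f r + b + q * g r)
    = p * integral {s..s + \<tau>} f + b * \<tau> + q * integral {s..s + \<tau>} g"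
proof -
  have "(\<lambda>r. p * f r) integrable_on {s..s + \<tau>}" "(\<lambda>r. q * g r) integrable_on {s..s + \<tau>}"
    using assms by (auto intro: lbm_integrable lbm_cmult)
  then show ?thesis
    using assms(4) by (subst integral_add, simp_all add: integrable_add integrable_const_ivl,
      subst integral_add, simp_all add: integrable_const_ivl)
qed

lemma power2_sum5_le:
  fixes x1 :: real
  shows "(x1 + x2 + x3 + x4 + x5)\<^sup>2 \<le> 5 * (x1\<^sup>2 + x2\<^sup>2 + x3\<^sup>2 + x4\<^sup>2 + x5\<^sup>2)"
proof -
  have "5 * (x1\<^sup>2 + x2\<^sup>2 + x3\<^sup>2 + x4\<^sup>2 + x5\<^sup>2) - (x1 + x2 + x3 + x4 + x5)\<^sup>2
    = (x1 - x2)\<^sup>2 + (x1 - x3)\<^sup>2 + (x1 - x4)\<^sup>2 + (x1 - x5)\<^sup>2 + (x2 - x3)\<^sup>2 + (x2 - x4)\<^sup>2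
      + (x2 - x5)\<^sup>2 + (x3 - x4)\<^sup>2 + (x3 - x5)\<^sup>2 + (x4 - x5)\<^sup>2"
    by (simp add: power2_eq_square algebra_simps)
  also have "\<dots> \<ge> 0" by (intro add_nonneg_nonneg zero_le_power2)
  finally show ?thesis by simp
qed

text \<open>On a window where the perturbation \<open>\<zeta>\<close> of the regressor has little energy, the parameter error
  \<open>\<alpha>\<close> is nearly constant and excitation of the nominal regressor \<open>\<sigma>\<close> makes it observable from \<open>e - d\<close>.\<close>

lemma window_bound:
  fixes \<sigma> :: "nat \<Rightarrow> real \<Rightarrow> real"
  assumes fin: "finite J" and \<tau>: "\<tau> > 0" and c: "c > 0"
    and \<sigma>: "\<And>m. m \<in> J \<Longrightarrow> lbm (\<sigma> m)" "\<And>m t. m \<in> J \<Longrightarrow> \<bar>\<sigma> m t\<bar> \<le> K0"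
    and exc: "\<And>a s. 0 \<le> s \<Longrightarrow> c * (\<Sum>m\<in>J. (a m)\<^sup>2) \<le> integral {s..s + \<tau>} (\<lambda>t. (\<Sum>m\<in>J. a m * \<sigma> m t)\<^sup>2)"
  obtains \<theta> K where "\<theta> > 0" "K \<ge> 0" "\<And>\<alpha> e d \<zeta> s t.
    \<lbrakk>lbm e; lbm d; \<And>m. m \<in> J \<Longrightarrow> lbm (\<zeta> m);
     \<And>m. m \<in> J \<Longrightarrow> primitive (\<lambda>t. l * e t * (\<sigma> m t + \<zeta> m t)) (\<alpha> m);
     \<And>t. 0 \<le> t \<Longrightarrow> e t = d t - (\<Sum>m\<in>J. \<alpha> m t * (\<sigma> m t + \<zeta> m t)); 0 \<le> s;
     integral {s..s + \<tau>} (\<lambda>t. \<Sum>m\<in>J. (\<zeta> m t)\<^sup>2) \<le> \<theta>; t \<in> {s..s + \<tau>}\<rbrakk>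
    \<Longrightarrow> (\<Sum>m\<in>J. (\<alpha> m t)\<^sup>2) \<le> K * integral {s..s + \<tau>} (\<lambda>t. (e t)\<^sup>2 + (d t)\<^sup>2)"
proof -
  define N where "N = real (card J)"
  \<comment> \<open>\<open>\<theta> \<le> c / 10\<close> lets the excitation \<open>c * a2\<close>
    absorb \<open>5 * \<theta> * a2\<close>, and \<open>\<theta> \<le> 1\<close> bounds the energy
    of the perturbed regressor on the window.\<close>
  define \<theta> where "\<theta> = min 1 (c / 10)"
  define K1 where "K1 = l\<^sup>2 * (2 * K0\<^sup>2 * \<tau> + 2)"
  define K2 where "K2 = N * K1"
  define K3 where "K3 = (10 / c) * (1 + K2 + K2 * (N * K0\<^sup>2) * \<tau>)"
  have \<theta>: "0 < \<theta>" "\<theta> \<le> 1" "5 * \<theta> \<le> c / 2" using c by (auto simp: \<theta>_def)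
  have K: "0 \<le> K1" "0 \<le> K2" "0 \<le> K3" "0 \<le> N"
    using \<tau> c unfolding K1_def K2_def K3_def N_def
    by (auto intro!: mult_nonneg_nonneg add_nonneg_nonneg)
  show ?thesis
  proof (rule that[of \<theta> "2 * K3 + 2 * K2"])
    fix \<alpha> :: "nat \<Rightarrow> real \<Rightarrow> real" and e d :: "real \<Rightarrow> real" and \<zeta> :: "nat \<Rightarrow> real \<Rightarrow> real" and s t :: real
    assume e: "lbm e" and d: "lbm d" and \<zeta>: "\<And>m. m \<in> J \<Longrightarrow> lbm (\<zeta> m)"
      and \<alpha>: "\<And>m. m \<in> J \<Longrightarrow> primitive (\<lambda>t. l * e t * (\<sigma> m t + \<zeta> m t)) (\<alpha> m)"
      and eq: "\<And>t. 0 \<le> t \<Longrightarrow> e t = d t - (\<Sum>m\<in>J. \<alpha> m t * (\<sigma> m t + \<zeta> m t))"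
      and s: "0 \<le> s" and small: "integral {s..s + \<tau>} (\<lambda>t. \<Sum>m\<in>J. (\<zeta> m t)\<^sup>2) \<le> \<theta>"
      and t: "t \<in> {s..s + \<tau>}"
    define E where "E = integral {s..s + \<tau>} (\<lambda>t. (e t)\<^sup>2 + (d t)\<^sup>2)"
    have E0: "0 \<le> E" unfolding E_def by (intro integral_nonneg_lbm lbm_add lbm_power2 e d s) auto
    have l\<zeta>: "lbm (\<lambda>t. \<Sum>m\<in>J. (\<zeta> m t)\<^sup>2)" by (intro lbm_sum lbm_power2 \<zeta>)
    \<comment> \<open>The parameter moves by an integral of \<open>l * e\<close> against the
      regressor; by Cauchy-Schwarz the squared displacement is at most a multiple of the energy of
      \<open>e\<close>.\<close>
    have \<Delta>: "(\<alpha> m r - \<alpha> m s)\<^sup>2 \<le> K1 * E" if m: "m \<in> J" and r: "r \<in> {s..s + \<tau>}" for m r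
    proof -
      have "integral {s..r} (\<lambda>t. (\<sigma> m t + \<zeta> m t)\<^sup>2) \<le> integral {s..s + \<tau>} (\<lambda>t. (\<sigma> m t + \<zeta> m t)\<^sup>2)"
        using r by (intro integral_mono_interval lbm_power2 lbm_add \<sigma>(1) \<zeta> m s) auto
      also have "\<dots> \<le> integral {s..s + \<tau>} (\<lambda>t. 2 * K0\<^sup>2 + 2 * (\<Sum>m\<in>J. (\<zeta> m t)\<^sup>2))"
      proof (intro integral_mono_lbm lbm_power2 lbm_add lbm_const lbm_cmult \<sigma>(1) \<zeta> m s l\<zeta>)
        fix t
        have "(\<sigma> m t + \<zeta> m t)\<^sup>2 \<le> 2 * (\<sigma> m t)\<^sup>2 + 2 * (\<zeta> m t)\<^sup>2"
          using zero_le_power2[of "\<sigma> m t - \<zeta> m t"] by (simp add: power2_eq_square algebra_simps)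
        moreover have "(\<sigma> m t)\<^sup>2 \<le> K0\<^sup>2" using \<sigma>(2)[OF m, of t] by (rule abs_le_square_iff[THEN iffD1, OF order_trans]) simp
        moreover have "(\<zeta> m t)\<^sup>2 \<le> (\<Sum>m\<in>J. (\<zeta> m t)\<^sup>2)" by (rule member_le_sum[OF m _ fin]) simp
        ultimately show "(\<sigma> m t + \<zeta> m t)\<^sup>2 \<le> 2 * K0\<^sup>2 + 2 * (\<Sum>m\<in>J. (\<zeta> m t)\<^sup>2)" by linarith
      qed
      also have "\<dots> = 2 * K0\<^sup>2 * \<tau> + 2 * integral {s..s + \<tau>} (\<lambda>t. \<Sum>m\<in>J. (\<zeta> m t)\<^sup>2)"
        using \<tau> by (subst integral_add) (simp_all add: lbm_integrable[OF lbm_cmult[OF l\<zeta>] s] integrable_const_ivl)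
      also have "\<dots> \<le> 2 * K0\<^sup>2 * \<tau> + 2" using small \<theta>(2) by simp
      finally have G: "integral {s..r} (\<lambda>t. (\<sigma> m t + \<zeta> m t)\<^sup>2) \<le> 2 * K0\<^sup>2 * \<tau> + 2" .
      have "integral {s..r} (\<lambda>t. (e t)\<^sup>2) \<le> integral {s..s + \<tau>} (\<lambda>t. (e t)\<^sup>2)"
        using r by (intro integral_mono_interval lbm_power2 e s) auto
      also have "\<dots> \<le> E" unfolding E_def by (intro integral_mono_lbm lbm_add lbm_power2 e d s) simp
      finally have F: "integral {s..r} (\<lambda>t. (e t)\<^sup>2) \<le> E" .
      have "\<alpha> m r - \<alpha> m s = integral {s..r} (\<lambda>t. l * e t * (\<sigma> m t + \<zeta> m t))"
        using primitive_integral[OF \<alpha>[OF m] s, of r] r by simp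
      also have "\<dots> = l * integral {s..r} (\<lambda>t. e t * (\<sigma> m t + \<zeta> m t))"
        by (simp add: mult.assoc)
      finally have "(\<alpha> m r - \<alpha> m s)\<^sup>2 = l\<^sup>2 * (integral {s..r} (\<lambda>t. e t * (\<sigma> m t + \<zeta> m t)))\<^sup>2"
        by (simp add: power_mult_distrib)
      also have "\<dots> \<le> l\<^sup>2 * ((2 * K0\<^sup>2 * \<tau> + 2) * integral {s..r} (\<lambda>t. (e t)\<^sup>2))"
        by (intro mult_left_mono integral_Cauchy_Schwarz[OF e lbm_add[OF \<sigma>(1)[OF m] \<zeta>[OF m]] s G]) simp
      also have "\<dots> \<le> l\<^sup>2 * ((2 * K0\<^sup>2 * \<tau> + 2) * E)"
        using \<tau> by (intro mult_left_mono F) auto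
      finally show ?thesis by (simp add: K1_def mult.assoc)
    qed
    have \<Delta>sum: "(\<Sum>m\<in>J. (\<alpha> m r - \<alpha> m s)\<^sup>2) \<le> K2 * E" if r: "r \<in> {s..s + \<tau>}" for r
      using sum_mono[of J "\<lambda>m. (\<alpha> m r - \<alpha> m s)\<^sup>2" "\<lambda>_. K1 * E"] \<Delta> r by (simp add: K2_def N_def mult.assoc)
    define a2 where "a2 = (\<Sum>m\<in>J. (\<alpha> m s)\<^sup>2)"
    have a20: "0 \<le> a2" unfolding a2_def by (intro sum_nonneg) simp
    define Z where "Z r = (\<Sum>m\<in>J. (\<zeta> m r)\<^sup>2)" for r
    have Z0: "0 \<le> Z r" for r unfolding Z_def by (intro sum_nonneg) simp
    have pt: "(\<Sum>m\<in>J. \<alpha> m s * \<sigma> m r)\<^sup>2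
        \<le> 5 * ((e r)\<^sup>2 + (d r)\<^sup>2) + 5 * (K2 * E * (N * K0\<^sup>2)) + (5 * a2 + 5 * (K2 * E)) * Z r"
      if r: "r \<in> {s..s + \<tau>}" for r
    proof -
      have r0: "0 \<le> r" using r s by simp
      let ?D = "\<lambda>m. \<alpha> m r - \<alpha> m s"
      have "(\<Sum>m\<in>J. \<alpha> m s * \<sigma> m r) = (\<Sum>m\<in>J. \<alpha> m r * (\<sigma> m r + \<zeta> m r) - ?D m * \<sigma> m r
          - \<alpha> m s * \<zeta> m r - ?D m * \<zeta> m r)"
        by (intro sum.cong refl) (simp add: algebra_simps)
      also have "\<dots> = d r + (- e r) + (- (\<Sum>m\<in>J. \<alpha> m s * \<zeta> m r)) + (- (\<Sum>m\<in>J. ?D m * \<zeta> m r))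
          + (- (\<Sum>m\<in>J. ?D m * \<sigma> m r))"
        unfolding sum_subtractf using eq[OF r0] by simp
      finally have "(\<Sum>m\<in>J. \<alpha> m s * \<sigma> m r)\<^sup>2 \<le> 5 * ((d r)\<^sup>2 + (e r)\<^sup>2 + (\<Sum>m\<in>J. \<alpha> m s * \<zeta> m r)\<^sup>2
          + (\<Sum>m\<in>J. ?D m * \<zeta> m r)\<^sup>2 + (\<Sum>m\<in>J. ?D m * \<sigma> m r)\<^sup>2)"
        using power2_sum5_le[of "d r" "- e r" "- (\<Sum>m\<in>J. \<alpha> m s * \<zeta> m r)" "- (\<Sum>m\<in>J. ?D m * \<zeta> m r)"
          "- (\<Sum>m\<in>J. ?D m * \<sigma> m r)"] by (simp only: power2_minus)
      moreover have "(\<Sum>m\<in>J. \<alpha> m s * \<zeta> m r)\<^sup>2 \<le> a2 * Z r"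
        unfolding a2_def Z_def by (rule Cauchy_Schwarz_ineq_sum)
      moreover have "(\<Sum>m\<in>J. ?D m * \<zeta> m r)\<^sup>2 \<le> K2 * E * Z r"
      proof -
        have "(\<Sum>m\<in>J. ?D m * \<zeta> m r)\<^sup>2 \<le> (\<Sum>m\<in>J. (?D m)\<^sup>2) * Z r"
          unfolding Z_def by (rule Cauchy_Schwarz_ineq_sum)
        also have "\<dots> \<le> K2 * E * Z r" by (intro mult_right_mono \<Delta>sum r Z0)
        finally show ?thesis .
      qed
      moreover have "(\<Sum>m\<in>J. ?D m * \<sigma> m r)\<^sup>2 \<le> K2 * E * (N * K0\<^sup>2)"
      proof -
        have "(\<Sum>m\<in>J. (\<sigma> m r)\<^sup>2) \<le> (\<Sum>m\<in>J. K0\<^sup>2)"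
        proof (rule sum_mono)
          fix m assume "m \<in> J"
          then show "(\<sigma> m r)\<^sup>2 \<le> K0\<^sup>2"
            using \<sigma>(2)[of m r] by (intro abs_le_square_iff[THEN iffD1] order_trans[OF \<sigma>(2) abs_ge_self])
        qed
        then have "(\<Sum>m\<in>J. (\<sigma> m r)\<^sup>2) \<le> N * K0\<^sup>2" by (simp add: N_def)
        then have "(\<Sum>m\<in>J. (?D m)\<^sup>2) * (\<Sum>m\<in>J. (\<sigma> m r)\<^sup>2) \<le> K2 * E * (N * K0\<^sup>2)"
          using K E0 by (intro mult_mono \<Delta>sum r) (auto intro: sum_nonneg)
        then show ?thesis using Cauchy_Schwarz_ineq_sum[of ?D "\<lambda>m. \<sigma> m r" J] by linarith
      qed
      ultimately show ?thesis by (simp add: distrib_right)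
    qed
    have "c * a2 \<le> integral {s..s + \<tau>} (\<lambda>r. (\<Sum>m\<in>J. \<alpha> m s * \<sigma> m r)\<^sup>2)"
      unfolding a2_def by (rule exc[OF s])
    also have "\<dots> \<le> integral {s..s + \<tau>} (\<lambda>r. 5 * ((e r)\<^sup>2 + (d r)\<^sup>2) + 5 * (K2 * E * (N * K0\<^sup>2)) + (5 * a2 + 5 * (K2 * E)) * Z r)"
    proof (intro integral_mono_lbm)
      show "lbm (\<lambda>r. (\<Sum>m\<in>J. \<alpha> m s * \<sigma> m r)\<^sup>2)" by (intro lbm_power2 lbm_sum lbm_cmult \<sigma>(1))
      show "lbm (\<lambda>r. 5 * ((e r)\<^sup>2 + (d r)\<^sup>2) + 5 * (K2 * E * (N * K0\<^sup>2)) + (5 * a2 + 5 * (K2 * E)) * Z r)"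
        unfolding Z_def by (intro lbm_add lbm_cmult lbm_const lbm_power2 e d l\<zeta>)
    qed (use s pt in auto)
    also have "\<dots> = 5 * E + 5 * (K2 * E * (N * K0\<^sup>2)) * \<tau> + (5 * a2 + 5 * (K2 * E)) * integral {s..s + \<tau>} Z"
    proof -
      have "lbm Z" unfolding Z_def by (rule l\<zeta>)
      then show ?thesis
        unfolding E_def[symmetric]
        by (subst integral_affine_combination[OF lbm_add[OF lbm_power2[OF e] lbm_power2[OF d]] _ s less_imp_le[OF \<tau>]])
           (simp_all only: E_def)
    qed
    also have "\<dots> \<le> 5 * E + 5 * (K2 * E * (N * K0\<^sup>2)) * \<tau> + (5 * a2 + 5 * (K2 * E)) * \<theta>"
      using small a20 K E0 by (intro add_left_mono mult_left_mono) (auto simp: Z_def[abs_def])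
    also have "\<dots> \<le> 5 * E + 5 * (K2 * E * (N * K0\<^sup>2)) * \<tau> + (c / 2 * a2 + 5 * (K2 * E))"
    proof -
      have "5 * \<theta> * a2 \<le> c / 2 * a2" using \<theta>(3) a20 by (rule mult_right_mono)
      moreover have "(K2 * E) * \<theta> \<le> (K2 * E) * 1" using \<theta>(2) K E0 by (intro mult_left_mono) auto
      moreover have "(5 * a2 + 5 * (K2 * E)) * \<theta> = 5 * \<theta> * a2 + 5 * ((K2 * E) * \<theta>)"
        by (simp add: algebra_simps)
      ultimately show ?thesis by linarith
    qed
    finally have "c / 2 * a2 \<le> 5 * E * (1 + K2 + K2 * (N * K0\<^sup>2) * \<tau>)" by (simp add: algebra_simps)
    then have "a2 \<le> K3 * E" using c by (simp add: K3_def field_simps)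
    moreover have "(\<Sum>m\<in>J. (\<alpha> m t)\<^sup>2) \<le> 2 * a2 + 2 * (\<Sum>m\<in>J. (\<alpha> m t - \<alpha> m s)\<^sup>2)"
    proof -
      have "(\<alpha> m t)\<^sup>2 \<le> 2 * (\<alpha> m s)\<^sup>2 + 2 * (\<alpha> m t - \<alpha> m s)\<^sup>2" for m
        using zero_le_power2[of "2 * \<alpha> m s - \<alpha> m t"] by (simp add: power2_eq_square algebra_simps)
      then have "(\<Sum>m\<in>J. (\<alpha> m t)\<^sup>2) \<le> (\<Sum>m\<in>J. 2 * (\<alpha> m s)\<^sup>2 + 2 * (\<alpha> m t - \<alpha> m s)\<^sup>2)" by (rule sum_mono)
      then show ?thesis by (simp add: a2_def sum.distrib sum_distrib_left)
    qed
    ultimately show "(\<Sum>m\<in>J. (\<alpha> m t)\<^sup>2) \<le> (2 * K3 + 2 * K2) * integral {s..s + \<tau>} (\<lambda>t. (e t)\<^sup>2 + (d t)\<^sup>2)"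
      using \<Delta>sum[OF t] unfolding E_def[symmetric] by (simp add: distrib_right)
  qed (use \<theta> K in auto)
qed

lemma sum_power2_le_power2_sum_abs: "(\<Sum>i\<in>I. (f i)\<^sup>2) \<le> (\<Sum>i\<in>I. \<bar>f i :: real\<bar>)\<^sup>2"
proof -
  have "L2_set (\<lambda>i. \<bar>f i\<bar>) I \<le> (\<Sum>i\<in>I. \<bar>f i\<bar>)" by (rule L2_set_le_sum) simp
  then show ?thesis by (simp add: L2_set_def real_le_lsqrt sqrt_le_D)
qed

text \<open>Each of the two pointwise bounds on \<open>g\<close> serves one kind of window. Both
  kinds are charged to the energy of the single signal \<open>h\<close> over the same window, so the
  estimates of consecutive windows add up.\<close>

lemma window_L2:
  fixes \<sigma> :: "nat \<Rightarrow> real \<Rightarrow> real" and e d g :: "'p \<Rightarrow> real \<Rightarrow> real" and \<alpha> \<zeta> :: "'p \<Rightarrow> nat \<Rightarrow> real \<Rightarrow> real"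
  assumes fin: "finite J" and \<tau>: "\<tau> > 0" and c: "c > 0"
    and \<sigma>: "\<And>m. m \<in> J \<Longrightarrow> lbm (\<sigma> m)" "\<And>m t. m \<in> J \<Longrightarrow> \<bar>\<sigma> m t\<bar> \<le> K0"
    and exc: "\<And>a s. 0 \<le> s \<Longrightarrow> c * (\<Sum>m\<in>J. (a m)\<^sup>2) \<le> integral {s..s + \<tau>} (\<lambda>t. (\<Sum>m\<in>J. a m * \<sigma> m t)\<^sup>2)"
    and e: "L2_family S e" and d: "L2_family S d" and \<zeta>: "\<And>m. m \<in> J \<Longrightarrow> L2_family S (\<lambda>p. \<zeta> p m)"
    and \<alpha>: "\<And>p W m. S p W \<Longrightarrow> m \<in> J \<Longrightarrow> primitive (\<lambda>t. l * e p t * (\<sigma> m t + \<zeta> p m t)) (\<alpha> p m)"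
    and eq: "\<And>p W t. S p W \<Longrightarrow> 0 \<le> t \<Longrightarrow> e p t = d p t - (\<Sum>m\<in>J. \<alpha> p m t * (\<sigma> m t + \<zeta> p m t))"
    and g: "\<And>p W. S p W \<Longrightarrow> lbm (g p)" "\<And>p W t. S p W \<Longrightarrow> 0 \<le> t \<Longrightarrow> (g p t)\<^sup>2 \<le> B"
      "\<And>p W t. S p W \<Longrightarrow> 0 \<le> t \<Longrightarrow> (g p t)\<^sup>2 \<le> B * (\<Sum>m\<in>J. (\<alpha> p m t)\<^sup>2)"
    and B: "0 \<le> B"
  shows "L2_family S g"
proof -
  obtain \<theta> K where \<theta>: "\<theta> > 0" and K: "K \<ge> 0" and window: "\<And>\<alpha> e d \<zeta> s t.
    \<lbrakk>lbm e; lbm d; \<And>m. m \<in> J \<Longrightarrow> lbm (\<zeta> m);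
     \<And>m. m \<in> J \<Longrightarrow> primitive (\<lambda>t. l * e t * (\<sigma> m t + \<zeta> m t)) (\<alpha> m);
     \<And>t. 0 \<le> t \<Longrightarrow> e t = d t - (\<Sum>m\<in>J. \<alpha> m t * (\<sigma> m t + \<zeta> m t)); 0 \<le> s;
     integral {s..s + \<tau>} (\<lambda>t. \<Sum>m\<in>J. (\<zeta> m t)\<^sup>2) \<le> \<theta>; t \<in> {s..s + \<tau>}\<rbrakk>
    \<Longrightarrow> (\<Sum>m\<in>J. (\<alpha> m t)\<^sup>2) \<le> K * integral {s..s + \<tau>} (\<lambda>t. (e t)\<^sup>2 + (d t)\<^sup>2)"
    by (rule window_bound[OF fin \<tau> c \<sigma> exc, where l=l]) blast+
  define h where "h p t = (\<bar>e p t\<bar> + \<bar>d p t\<bar>) + (\<Sum>m\<in>J. \<bar>\<zeta> p m t\<bar>)" for p t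
  have abs_fam: "L2_family S (\<lambda>p t. \<bar>f p t\<bar>)" if "L2_family S f" for f :: "'p \<Rightarrow> real \<Rightarrow> real"
    by (rule L2_family_dominated[OF that, of _ 1])
       (use lbm_norm[OF L2_family_lbm[OF that]] in auto)
  have "L2_family S h"
    unfolding h_def by (intro L2_family_add L2_family_sum[OF e] abs_fam e d \<zeta>)
  then obtain L where L: "L \<ge> 0" "\<And>p W. S p W \<Longrightarrow> 0 \<le> W" "\<And>p W. S p W \<Longrightarrow> lbm (h p)"
    "\<And>p W T. S p W \<Longrightarrow> 0 \<le> T \<Longrightarrow> integral {0..T} (\<lambda>t. (norm (h p t))\<^sup>2) \<le> L * (1 + W)"
    unfolding L2_family_def by auto
  define M where "M = B * \<tau> / \<theta> + B * \<tau> * K"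
  have M: "0 \<le> M" "B * \<tau> / \<theta> \<le> M" "B * \<tau> * K \<le> M" using B \<tau> \<theta> K by (auto simp: M_def)
  show ?thesis
  proof (rule L2_familyI[of "M * L"])
    fix p W T assume S: "S p W" and T: "0 \<le> (T::real)"
    note le = L2_family_lbm[OF e S] and ld = L2_family_lbm[OF d S] and lz = L2_family_lbm[OF \<zeta> S]
    note lh = L(3)[OF S]
    have lg2: "lbm (\<lambda>t. (g p t)\<^sup>2)" and lh2: "lbm (\<lambda>t. (h p t)\<^sup>2)"
      by (intro lbm_power2 g(1)[OF S] lh)+
    have h1: "(e p t)\<^sup>2 + (d p t)\<^sup>2 \<le> (h p t)\<^sup>2" and h2: "(\<Sum>m\<in>J. (\<zeta> p m t)\<^sup>2) \<le> (h p t)\<^sup>2" for t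
    proof -
      have s0: "0 \<le> (\<Sum>m\<in>J. \<bar>\<zeta> p m t\<bar>)" by (intro sum_nonneg) simp
      have "(e p t)\<^sup>2 + (d p t)\<^sup>2 \<le> (\<bar>e p t\<bar> + \<bar>d p t\<bar>)\<^sup>2"
        by (simp add: power2_sum)
      also have "\<dots> \<le> (h p t)\<^sup>2" unfolding h_def using s0 by (intro power_mono) auto
      finally show "(e p t)\<^sup>2 + (d p t)\<^sup>2 \<le> (h p t)\<^sup>2" .
      have "(\<Sum>m\<in>J. (\<zeta> p m t)\<^sup>2) \<le> (\<Sum>m\<in>J. \<bar>\<zeta> p m t\<bar>)\<^sup>2" by (rule sum_power2_le_power2_sum_abs)
      also have "\<dots> \<le> (h p t)\<^sup>2" unfolding h_def using s0 by (intro power_mono) auto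
      finally show "(\<Sum>m\<in>J. (\<zeta> p m t)\<^sup>2) \<le> (h p t)\<^sup>2" .
    qed
    have win: "integral {s..s + \<tau>} (\<lambda>t. (g p t)\<^sup>2) \<le> M * integral {s..s + \<tau>} (\<lambda>t. (h p t)\<^sup>2)"
      if s: "0 \<le> s" for s
    proof -
      define I where "I = integral {s..s + \<tau>} (\<lambda>t. (h p t)\<^sup>2)"
      have I0: "0 \<le> I" unfolding I_def by (intro integral_nonneg_lbm lh2 s) simp
      have const: "integral {s..s + \<tau>} (\<lambda>t. (g p t)\<^sup>2) \<le> b * \<tau>"
        if "\<And>t. t \<in> {s..s + \<tau>} \<Longrightarrow> (g p t)\<^sup>2 \<le> b" for b
        using integral_mono_lbm[OF lg2 lbm_const s, of "s + \<tau>" b] that \<tau> by (simp add: mult.commute)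
      show ?thesis
      proof (cases "integral {s..s + \<tau>} (\<lambda>t. \<Sum>m\<in>J. (\<zeta> p m t)\<^sup>2) \<le> \<theta>")
        case True
        have "(g p t)\<^sup>2 \<le> B * (K * I)" if t: "t \<in> {s..s + \<tau>}" for t
        proof -
          have "(\<Sum>m\<in>J. (\<alpha> p m t)\<^sup>2) \<le> K * integral {s..s + \<tau>} (\<lambda>t. (e p t)\<^sup>2 + (d p t)\<^sup>2)"
            by (rule window[OF le ld lz \<alpha>[OF S] eq[OF S] s True t])
          also have "\<dots> \<le> K * I"
            unfolding I_def by (intro mult_left_mono K integral_mono_lbm lbm_add lbm_power2 le ld lh s h1)
          finally have "B * (\<Sum>m\<in>J. (\<alpha> p m t)\<^sup>2) \<le> B * (K * I)" using B by (rule mult_left_mono)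
          moreover have "0 \<le> t" using t s by simp
          ultimately show ?thesis using g(3)[OF S, of t] by linarith
        qed
        then have "integral {s..s + \<tau>} (\<lambda>t. (g p t)\<^sup>2) \<le> B * (K * I) * \<tau>" by (rule const)
        also have "\<dots> = (B * \<tau> * K) * I" by simp
        also have "\<dots> \<le> M * I" by (intro mult_right_mono M I0)
        finally show ?thesis by (simp add: I_def)
      next
        case False
        \<comment> \<open>Such a window carries at least the energy \<open>\<theta>\<close>, so the
          factor \<open>I / \<theta> \<ge> 1\<close> may be inserted into the absolute bound on
          \<open>g\<close>.\<close>
        then have "\<theta> \<le> integral {s..s + \<tau>} (\<lambda>t. \<Sum>m\<in>J. (\<zeta> p m t)\<^sup>2)" by simp
        also have "\<dots> \<le> I" unfolding I_def
          by (intro integral_mono_lbm lbm_sum lbm_power2 lz lh s h2)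
        finally have "1 \<le> I / \<theta>" using \<theta> by (simp add: pos_le_divide_eq)
        have "integral {s..s + \<tau>} (\<lambda>t. (g p t)\<^sup>2) \<le> B * \<tau>" using g(2)[OF S] s by (intro const) auto
        also have "\<dots> \<le> B * \<tau> * (I / \<theta>)"
          using \<open>1 \<le> I / \<theta>\<close> B \<tau> mult_left_mono[of 1 "I / \<theta>" "B * \<tau>"] by simp
        also have "\<dots> = (B * \<tau> / \<theta>) * I" by simp
        also have "\<dots> \<le> M * I" by (intro mult_right_mono M I0)
        finally show ?thesis by (simp add: I_def)
      qed
    qed
    have steps: "integral {0..real n * \<tau>} (\<lambda>t. (g p t)\<^sup>2) \<le> M * integral {0..real n * \<tau>} (\<lambda>t. (h p t)\<^sup>2)" for n
    proof (induction n)
      case (Suc n)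
      have n\<tau>: "0 \<le> real n * \<tau>" "real n * \<tau> \<le> real n * \<tau> + \<tau>" using \<tau> by auto
      have comb: "integral {0..real n * \<tau>} f + integral {real n * \<tau>..real n * \<tau> + \<tau>} f
          = integral {0..real n * \<tau> + \<tau>} f" if "lbm f" for f :: "real \<Rightarrow> real"
        by (rule Henstock_Kurzweil_Integration.integral_combine[OF n\<tau> lbm_integrable[OF that order_refl]])
      have "real (Suc n) * \<tau> = real n * \<tau> + \<tau>" by (simp add: algebra_simps)
      then show ?case
        using Suc win[OF n\<tau>(1)] comb[OF lg2] comb[OF lh2] by (simp only:) (simp add: distrib_left flip: comb[OF lg2] comb[OF lh2])
    qed simp
    \<comment> \<open>The horizon is rounded up to a whole number of windows.\<close>
    define n where "n = nat \<lceil>T / \<tau>\<rceil>"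
    have "T / \<tau> \<le> real n" by (simp add: n_def real_nat_ceiling_ge)
    then have n: "T \<le> real n * \<tau>" using \<tau> by (simp add: pos_divide_le_eq)
    have "integral {0..T} (\<lambda>t. (g p t)\<^sup>2) \<le> integral {0..real n * \<tau>} (\<lambda>t. (g p t)\<^sup>2)"
      by (rule integral_mono_interval[OF lg2 _ T n]) auto
    also have "\<dots> \<le> M * integral {0..real n * \<tau>} (\<lambda>t. (h p t)\<^sup>2)" by (rule steps)
    also have "\<dots> \<le> M * (L * (1 + W))"
      using L(4)[OF S, of "real n * \<tau>"] \<tau> M(1) by (intro mult_left_mono) auto
    finally show "integral {0..T} (\<lambda>t. (norm (g p t))\<^sup>2) \<le> M * L * (1 + W)" by (simp add: mult.assoc)
  qed (use M L g(1) in auto)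
qed

section \<open>A single node\<close>

text \<open>\<open>C j\<close> is the complex amplitude at frequency \<open>\<omega> j\<close>, and
  \<open>q\<close> is the order of differentiation, which matches the position in the filter
  chain.\<close>

definition tone :: "nat \<Rightarrow> (nat \<Rightarrow> real) \<Rightarrow> (nat \<Rightarrow> complex) \<Rightarrow> nat \<Rightarrow> real \<Rightarrow> real" where
  "tone k \<omega> C q t = (\<Sum>j=1..k. Im ((\<i> * complex_of_real (\<omega> j)) ^ q * (C j * cis (\<omega> j * t))))"

lemma tone_has_derivative:
  "(tone k \<omega> C q has_real_derivative tone k \<omega> C (Suc q) t) (at t within X)"
proof -
  have "((\<lambda>t. Im (z * (c * cis (w * t)))) has_real_derivative Im ((\<i> * complex_of_real w) * z * (c * cis (w * t)))) (at t within X)"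
    for z c w
    by (auto intro!: derivative_eq_intros simp: algebra_simps)
  then show ?thesis
    unfolding tone_def by (intro DERIV_sum) (simp add: mult.assoc)
qed

lemma tone_continuous: "continuous_on X (tone k \<omega> C q)"
  by (rule DERIV_continuous_on[OF tone_has_derivative])

lemma tone_lbm: "lbm (tone k \<omega> C q)"
  by (rule lbm_continuous[OF tone_continuous])

lemma tone_primitive: "primitive (tone k \<omega> C (Suc q)) (tone k \<omega> C q)"
  unfolding primitive_def
  by (intro conjI allI impI tone_lbm fundamental_theorem_of_calculus)
     (auto simp: has_real_derivative_iff_has_vector_derivative[symmetric] tone_has_derivative)

lemma tone_bounded: "\<bar>tone k \<omega> C q t\<bar> \<le> (\<Sum>j=1..k. \<bar>\<omega> j\<bar> ^ q * cmod (C j))"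
proof -
  have "\<bar>Im ((\<i> * complex_of_real (\<omega> j)) ^ q * (C j * cis (\<omega> j * t)))\<bar> \<le> \<bar>\<omega> j\<bar> ^ q * cmod (C j)" for j
    using abs_Im_le_cmod[of "(\<i> * complex_of_real (\<omega> j)) ^ q * (C j * cis (\<omega> j * t))"]
    by (simp add: norm_mult norm_power)
  then show ?thesis
    unfolding tone_def by (intro order_trans[OF sum_abs] sum_mono) simp
qed

text \<open>A combination of derivatives with constant coefficients acts on each frequency as a
  polynomial evaluated at \<open>\<i> * \<omega> j\<close>.\<close>

lemma tone_combination:
  "(\<Sum>q\<in>Q. f q * tone k \<omega> C (h q) t)
    = (\<Sum>j=1..k. Im ((\<Sum>q\<in>Q. complex_of_real (f q) * (\<i> * complex_of_real (\<omega> j)) ^ h q) * (C j * cis (\<omega> j * t))))"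
proof -
  have "(\<Sum>q\<in>Q. f q * tone k \<omega> C (h q) t)
      = (\<Sum>j=1..k. \<Sum>q\<in>Q. f q * Im ((\<i> * complex_of_real (\<omega> j)) ^ h q * (C j * cis (\<omega> j * t))))"
    unfolding tone_def sum_distrib_left by (rule sum.swap)
  also have "\<dots> = (\<Sum>j=1..k. Im (\<Sum>q\<in>Q. complex_of_real (f q) * (\<i> * complex_of_real (\<omega> j)) ^ h q * (C j * cis (\<omega> j * t))))"
  proof (intro sum.cong refl)
    fix j
    have "f q * Im z = Im (complex_of_real (f q) * z)" for q z by simp
    then show "(\<Sum>q\<in>Q. f q * Im ((\<i> * complex_of_real (\<omega> j)) ^ h q * (C j * cis (\<omega> j * t))))
      = Im (\<Sum>q\<in>Q. complex_of_real (f q) * (\<i> * complex_of_real (\<omega> j)) ^ h q * (C j * cis (\<omega> j * t)))"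
      by (simp only: Im_sum mult.assoc)
  qed
  finally show ?thesis by (simp only: sum_distrib_right)
qed

text \<open>Odd powers of \<open>\<i> * \<omega> j\<close> are \<open>\<i> * \<omega> j\<close>
  times powers of \<open>x j = - (\<omega> j)\<^sup>2\<close>. The amplitude at frequency
  \<open>\<omega> j\<close> is therefore, up to the nonzero factor \<open>r j\<close>, the value at
  \<open>x j\<close> of the polynomial with coefficients \<open>a\<close>, and interpolation at the
  distinct points \<open>x j\<close> recovers \<open>a\<close>.\<close>

lemma odd_tones_persistently_exciting:
  assumes \<omega>: "\<And>j. j \<in> {1..k} \<Longrightarrow> 0 < \<omega> j" "inj_on \<omega> {1..k}" and C: "\<And>j. j \<in> {1..k} \<Longrightarrow> C j \<noteq> 0"
  obtains c \<tau> where "c > 0" "\<tau> > 0" "\<And>a s. c * (\<Sum>m\<in>{1..k}. (a m)\<^sup>2)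
    \<le> integral {s..s + \<tau>} (\<lambda>t. (\<Sum>m\<in>{1..k}. a m * tone k \<omega> C (2 * m - 1) t)\<^sup>2)"
proof -
  define x where "x j = - (\<omega> j)\<^sup>2" for j
  define r where "r j = \<omega> j * cmod (C j)" for j
  have r: "r j \<noteq> 0" if "j \<in> {1..k}" for j using \<omega>(1)[OF that] C[OF that] by (simp add: r_def)
  have "inj_on x {1..k}"
  proof (rule inj_onI)
    fix i j assume ij: "i \<in> {1..k}" "j \<in> {1..k}" "x i = x j"
    then have "\<omega> i = \<omega> j" using \<omega>(1)[OF ij(1)] \<omega>(1)[OF ij(2)] by (simp add: x_def)
    then show "i = j" using inj_onD[OF \<omega>(2) _ ij(1,2)] by simp
  qed
  then obtain D where D: "D > 0"
    "\<And>a. (\<Sum>m=1..k. (a m)\<^sup>2) \<le> D * (\<Sum>j=1..k. (\<Sum>m=1..k. a m * x j ^ (m - 1))\<^sup>2)"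
    by (rule coefficients_le_values) blast
  obtain \<tau> where \<tau>: "\<tau> > 0" "\<And>b s. (\<Sum>j\<in>{1..k}. (b j)\<^sup>2)
    \<le> integral {s..s + \<tau>} (\<lambda>t. (\<Sum>j\<in>{1..k}. b j * cos (\<omega> j * t + Arg (C j)))\<^sup>2)"
    by (rule sinusoids_persistently_exciting[OF finite_atLeastAtMost \<omega>, where \<psi>="\<lambda>j. Arg (C j)"])
       (assumption, rule that, assumption, simp)
  \<comment> \<open>Dominates every \<open>1 / (r j)\<^sup>2\<close>; the summand 1 keeps it
    positive when \<open>k = 0\<close>.\<close>
  define R where "R = (\<Sum>j=1..k. 1 / (r j)\<^sup>2) + 1"
  have R: "R > 0" unfolding R_def by (intro add_nonneg_pos sum_nonneg) auto
  have "(1 / (D * R)) * (\<Sum>m\<in>{1..k}. (a m)\<^sup>2)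
    \<le> integral {s..s + \<tau>} (\<lambda>t. (\<Sum>m\<in>{1..k}. a m * tone k \<omega> C (2 * m - 1) t)\<^sup>2)" for a s
  proof -
    define v where "v j = (\<Sum>m=1..k. a m * x j ^ (m - 1))" for j
    have "(\<Sum>m\<in>{1..k}. a m * tone k \<omega> C (2 * m - 1) t) = (\<Sum>j\<in>{1..k}. (v j * r j) * cos (\<omega> j * t + Arg (C j)))" for t
      unfolding tone_combination
    proof (intro sum.cong refl)
      fix j assume "j \<in> {1..k}"
      have "(\<i> * complex_of_real (\<omega> j)) ^ (2 * m - 1) = \<i> * complex_of_real (\<omega> j * x j ^ (m - 1))" if "m \<in> {1..k}" for m
      proof -
        obtain i where "m = Suc i" using \<open>m \<in> {1..k}\<close> by (cases m) auto
        then show ?thesis by (simp add: power_mult x_def power_mult_distrib)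
      qed
      then have "(\<Sum>m\<in>{1..k}. complex_of_real (a m) * (\<i> * complex_of_real (\<omega> j)) ^ (2 * m - 1))
          = (\<Sum>m\<in>{1..k}. \<i> * complex_of_real (\<omega> j) * complex_of_real (a m * x j ^ (m - 1)))"
        by (intro sum.cong refl) simp
      also have "\<dots> = \<i> * complex_of_real (\<omega> j * v j)"
        by (simp add: v_def sum_distrib_left mult.assoc)
      finally have eq: "(\<Sum>m\<in>{1..k}. complex_of_real (a m) * (\<i> * complex_of_real (\<omega> j)) ^ (2 * m - 1))
          = \<i> * complex_of_real (\<omega> j * v j)" .
      have "C j * cis (\<omega> j * t) = complex_of_real (cmod (C j)) * cis (\<omega> j * t + Arg (C j))"
        using rcis_cmod_Arg[of "C j"] by (simp add: rcis_def cis_mult[symmetric] mult_ac)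
      then show "Im ((\<Sum>m\<in>{1..k}. complex_of_real (a m) * (\<i> * complex_of_real (\<omega> j)) ^ (2 * m - 1)) * (C j * cis (\<omega> j * t)))
          = (v j * r j) * cos (\<omega> j * t + Arg (C j))"
        unfolding eq by (simp add: r_def)
    qed
    then have ge: "(\<Sum>j\<in>{1..k}. (v j * r j)\<^sup>2)
        \<le> integral {s..s + \<tau>} (\<lambda>t. (\<Sum>m\<in>{1..k}. a m * tone k \<omega> C (2 * m - 1) t)\<^sup>2)"
      using \<tau>(2)[of "\<lambda>j. v j * r j" s] by simp
    have "(v j)\<^sup>2 \<le> R * (v j * r j)\<^sup>2" if j: "j \<in> {1..k}" for j
    proof -
      have "1 / (r j)\<^sup>2 \<le> (\<Sum>j=1..k. 1 / (r j)\<^sup>2)"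
        by (rule member_le_sum[OF j, of "\<lambda>j. 1 / (r j)\<^sup>2"]) auto
      then have "1 / (r j)\<^sup>2 * (v j * r j)\<^sup>2 \<le> R * (v j * r j)\<^sup>2"
        unfolding R_def by (intro mult_right_mono) auto
      then show ?thesis using r[OF j] by (simp add: power_mult_distrib)
    qed
    then have "(\<Sum>j=1..k. (v j)\<^sup>2) \<le> (\<Sum>j=1..k. R * (v j * r j)\<^sup>2)" by (rule sum_mono)
    then have "D * (\<Sum>j=1..k. (v j)\<^sup>2) \<le> D * (R * (\<Sum>j=1..k. (v j * r j)\<^sup>2))"
      using D(1) by (intro mult_left_mono) (simp_all add: sum_distrib_left)
    then have "(\<Sum>m\<in>{1..k}. (a m)\<^sup>2) \<le> D * R * (\<Sum>j\<in>{1..k}. (v j * r j)\<^sup>2)"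
      using D(2)[of a] by (simp add: v_def mult.assoc)
    then have "(1 / (D * R)) * (\<Sum>m\<in>{1..k}. (a m)\<^sup>2) \<le> (\<Sum>j\<in>{1..k}. (v j * r j)\<^sup>2)"
      using D(1) R by (simp add: pos_divide_le_eq mult.commute)
    then show ?thesis using ge by linarith
  qed
  then show ?thesis using that[of "1 / (D * R)" \<tau>] D(1) R \<tau>(1) by simp
qed

text \<open>\<open>P j\<close> will be the characteristic polynomial at
  \<open>\<i> * \<omega> j\<close>; the amplitude divided by it is the response of the first filter
  state.\<close>

lemma structured_disturbance_tones:
  assumes "\<And>j. j \<in> {1..k} \<Longrightarrow> P j \<noteq> 0"
  shows "structured_disturbance k A \<omega> \<phi> t
    = (\<Sum>j=1..k. Im (P j * ((complex_of_real (A j) * cis (\<phi> j) / P j) * cis (\<omega> j * t))))"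
  unfolding structured_disturbance_def
proof (intro sum.cong refl)
  fix j assume "j \<in> {1..k}"
  then have "P j * ((complex_of_real (A j) * cis (\<phi> j) / P j) * cis (\<omega> j * t)) = complex_of_real (A j) * cis (\<omega> j * t + \<phi> j)"
    using assms[of j] by (simp add: cis_mult[symmetric] field_simps)
  then show "A j * sin (\<omega> j * t + \<phi> j) = Im (P j * ((complex_of_real (A j) * cis (\<phi> j) / P j) * cis (\<omega> j * t)))"
    by simp
qed

text \<open>The true frequencies fit the same predicate with lower bound 0: \<open>\<mu>\<close>
  restricts the estimates and not the true frequencies.\<close>

lemma true_coefficients:
  assumes \<omega>: "\<And>j. j \<in> {1..k} \<Longrightarrow> 0 < \<omega> j" "inj_on \<omega> {1..k}"
  obtains \<alpha> where "frequency_estimates k \<omega> 0 \<alpha> \<omega>"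
proof -
  define P where "P = (\<Prod>j=1..k. [:(\<omega> j)\<^sup>2, 1:])"
  define \<alpha> where "\<alpha> m = coeff P (m - 1)" for m
  have deg: "degree P = k" unfolding P_def by (subst degree_prod_eq_sum_degree) auto
  have "lead_coeff P = 1" unfolding P_def by (simp add: lead_coeff_prod)
  then have lead: "coeff P k = 1" by (simp add: deg)
  have "(\<Prod>j=1..k. s ^ 2 + (\<omega> j) ^ 2) = s ^ (2 * k) + (\<Sum>j=1..k. \<alpha> j * s ^ (2 * (j - 1)))" for s :: real
  proof -
    have "(\<Prod>j=1..k. s ^ 2 + (\<omega> j) ^ 2) = poly P (s\<^sup>2)" by (simp add: P_def poly_prod add.commute)
    also have "\<dots> = (\<Sum>m<k. coeff P m * (s\<^sup>2) ^ m) + (s\<^sup>2) ^ k"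
      by (simp add: poly_altdef deg lessThan_Suc_atMost[symmetric] lead)
    also have "(\<Sum>m<k. coeff P m * (s\<^sup>2) ^ m) = (\<Sum>j=1..k. \<alpha> j * s ^ (2 * (j - 1)))"
      by (rule sum.reindex_bij_witness[of _ "\<lambda>j. j - 1" Suc]) (auto simp: \<alpha>_def power_mult)
    finally show ?thesis by (simp add: power_mult)
  qed
  then have "frequency_estimates k \<omega> 0 \<alpha> \<omega>"
    using \<omega> by (auto simp: frequency_estimates_def intro: less_imp_le)
  then show ?thesis by (rule that)
qed

section \<open>Filter and identifier of one node along a trajectory\<close>

lemma solution_cong:
  assumes "\<And>t. 0 \<le> t \<Longrightarrow> f t = g t" "\<And>t. 0 \<le> t \<Longrightarrow> x t = y t"
  shows "solution f x0 x \<longleftrightarrow> solution g x0 y"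
proof -
  have "(f has_integral (x t - x0)) {0..t} \<longleftrightarrow> (g has_integral (y t - x0)) {0..t}" if "0 \<le> t" for t
    unfolding assms(2)[OF that] by (rule has_integral_cong) (simp add: assms(1))
  then show ?thesis by (simp add: solution_def)
qed

lemma solution_lbm: "solution f x0 (x :: real \<Rightarrow> 'a::euclidean_space) \<Longrightarrow> lbm x"
  by (rule lbm_continuous, rule integrated_continuous) (auto simp: solution_def)

lemma solution_initial: "solution f x0 x \<Longrightarrow> x 0 = x0"
  unfolding solution_def by (drule spec[of _ 0]) (auto dest!: has_integral_unique[OF has_integral_refl(2)])

lemma solution_primitive: "solution f x0 x \<Longrightarrow> lbm f \<Longrightarrow> primitive f x"
  using solution_initial[of f x0 x] by (simp add: primitive_def solution_def)

lemma filter_row: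
  assumes \<eta>: "\<eta> \<in> carrier_vec (2 * k + 1)" and q: "q < 2 * k + 1"
  shows "vec_index (filter_matrix k \<alpha>f \<beta>f *\<^sub>v \<eta> + y \<cdot>\<^sub>v filter_input k) q
    = (if Suc q < 2 * k + 1 then vec_index \<eta> (Suc q)
       else y - (\<Sum>i<2 * k + 1. interleave \<beta>f \<alpha>f i * vec_index \<eta> i))"
proof -
  have row: "vec_index (filter_matrix k \<alpha>f \<beta>f *\<^sub>v \<eta> + y \<cdot>\<^sub>v filter_input k) q
      = (\<Sum>i<2 * k + 1. (if q < 2 * k then (if i = Suc q then 1 else 0) else - interleave \<beta>f \<alpha>f i) * vec_index \<eta> i)
        + (if q = 2 * k then y else 0)"
    using \<eta> q by (simp add: filter_matrix_def filter_input_def scalar_prod_def lessThan_atLeast0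
        del: sum.op_ivl_Suc sum.lessThan_Suc)
  show ?thesis
  proof (cases "q < 2 * k")
    case True
    then have "(\<Sum>i<2 * k + 1. (if q < 2 * k then (if i = Suc q then 1 else 0) else - interleave \<beta>f \<alpha>f i) * vec_index \<eta> i)
        = (\<Sum>i<2 * k + 1. if i = Suc q then vec_index \<eta> i else 0)" by (intro sum.cong refl) auto
    then show ?thesis unfolding row using True by (simp del: sum.lessThan_Suc)
  next
    case False
    then show ?thesis unfolding row using q by (simp add: sum_negf del: sum.lessThan_Suc)
  qed
qed

lemma identifier_error_sum:
  assumes "\<eta> \<in> carrier_vec (2 * k + 1)"
  shows "identifier_error k \<alpha>f \<beta>f \<alpha>h \<eta> y
    = (\<Sum>p<2 * k + 1. interleave \<beta>f (\<lambda>j. \<alpha>f j - \<alpha>h j) p * vec_index \<eta> p) - y"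
  using assms by (simp add: identifier_error_def scalar_prod_def lessThan_atLeast0 del: sum.op_ivl_Suc sum.lessThan_Suc)

text \<open>Parameters sit at the odd positions only; position \<open>2 * m - 1\<close>, counted
  from 0, is the filter state that serves as regressor for parameter \<open>m\<close>.\<close>

lemma sum_interleave_shift:
  fixes x :: "nat \<Rightarrow> real"
  shows "(\<Sum>p<2 * k + 1. interleave \<beta>f (\<lambda>j. \<alpha>f j - \<alpha>h j) p * x p)
    = (\<Sum>p<2 * k + 1. interleave \<beta>f (\<lambda>j. \<alpha>f j - \<alpha> j) p * x p)
      - (\<Sum>m=1..k. (\<alpha>h m - \<alpha> m) * x (2 * m - 1))"
proof -
  have "(\<Sum>m=1..k. (\<alpha>h m - \<alpha> m) * x (2 * m - 1)) = (\<Sum>m<k. (\<alpha>h (Suc m) - \<alpha> (Suc m)) * x (2 * m + 1))"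
    by (simp add: sum.atLeast1_atMost_eq)
  then show ?thesis
    unfolding sum_even_odd by (simp add: interleave_def algebra_simps sum_subtractf sum.distrib)
qed

text \<open>\<open>u\<close> is defined so that the bracket \<open>H x - y + compensation\<close> of
  the solver equals \<open>H x - z + u\<close>. It is quantified existentially because measurability
  and energy are established for another expression, which agrees with this one for
  \<open>t \<ge> 0\<close> only.\<close>

definition node_gain ::
  "nat \<Rightarrow> (nat \<Rightarrow> real) \<Rightarrow> (nat \<Rightarrow> real) \<Rightarrow> (nat \<Rightarrow> real) \<Rightarrow> (nat \<Rightarrow> real) \<Rightarrow> (nat \<Rightarrow> real) \<Rightarrow>
   real \<Rightarrow> real \<Rightarrow> real \<Rightarrow> real Matrix.vec \<Rightarrow> (nat \<Rightarrow> real) \<Rightarrow> real \<Rightarrow> bool" where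
  "node_gain k A \<omega> \<phi> \<alpha>f \<beta>f l \<mu> z \<eta>0 \<alpha>0 K \<longleftrightarrow> (\<forall>w \<eta> \<alpha>h \<omega>h W. lbm w \<longrightarrow> (\<forall>T\<ge>0. integral {0..T} (\<lambda>t. (w t)\<^sup>2) \<le> W) \<longrightarrow>
    (\<forall>t\<ge>0. \<eta> t \<in> carrier_vec (2 * k + 1)) \<longrightarrow>
    (\<forall>p<2 * k + 1. solution
       (\<lambda>t. vec_index (filter_matrix k \<alpha>f \<beta>f *\<^sub>v \<eta> t
          + (z + structured_disturbance k A \<omega> \<phi> t + w t) \<cdot>\<^sub>v filter_input k) p)
       (vec_index \<eta>0 p) (\<lambda>t. vec_index (\<eta> t) p)) \<longrightarrow>
    (\<forall>j\<in>{1..k}. solution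
       (\<lambda>t. l * identifier_error k \<alpha>f \<beta>f (\<alpha>h t) (\<eta> t) (z + structured_disturbance k A \<omega> \<phi> t + w t)
              * vec_index (\<eta> t) (2 * j - 1)) (\<alpha>0 j) (\<lambda>t. \<alpha>h t j)) \<longrightarrow>
    (\<forall>t\<ge>0. frequency_estimates k \<omega> \<mu> (\<alpha>h t) (\<omega>h t)) \<longrightarrow>
    (\<exists>u. lbm u \<and> (\<forall>T\<ge>0. integral {0..T} (\<lambda>t. (u t)\<^sup>2) \<le> K * (1 + W)) \<and>
      (\<forall>t\<ge>0. u t = compensation k \<alpha>f \<beta>f (\<omega>h t) (\<eta> t)
        - (z + structured_disturbance k A \<omega> \<phi> t + w t) + z)))"

lemma node_gainD:
  assumes "node_gain k A \<omega> \<phi> \<alpha>f \<beta>f l \<mu> z \<eta>0 \<alpha>0 K"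
    and "lbm w" "\<forall>T\<ge>0. integral {0..T} (\<lambda>t. (w t)\<^sup>2) \<le> W"
    and "\<forall>t\<ge>0. \<eta> t \<in> carrier_vec (2 * k + 1)"
    and "\<forall>p<2 * k + 1. solution
       (\<lambda>t. vec_index (filter_matrix k \<alpha>f \<beta>f *\<^sub>v \<eta> t
          + (z + structured_disturbance k A \<omega> \<phi> t + w t) \<cdot>\<^sub>v filter_input k) p)
       (vec_index \<eta>0 p) (\<lambda>t. vec_index (\<eta> t) p)"
    and "\<forall>j\<in>{1..k}. solution
       (\<lambda>t. l * identifier_error k \<alpha>f \<beta>f (\<alpha>h t) (\<eta> t) (z + structured_disturbance k A \<omega> \<phi> t + w t)
              * vec_index (\<eta> t) (2 * j - 1)) (\<alpha>0 j) (\<lambda>t. \<alpha>h t j)"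
    and "\<forall>t\<ge>0. frequency_estimates k \<omega> \<mu> (\<alpha>h t) (\<omega>h t)"
  shows "\<exists>u. lbm u \<and> (\<forall>T\<ge>0. integral {0..T} (\<lambda>t. (u t)\<^sup>2) \<le> K * (1 + W)) \<and>
      (\<forall>t\<ge>0. u t = compensation k \<alpha>f \<beta>f (\<omega>h t) (\<eta> t)
        - (z + structured_disturbance k A \<omega> \<phi> t + w t) + z)"
  by (rule assms(1)[unfolded node_gain_def, THEN spec, THEN spec, THEN spec, THEN spec, THEN spec,
        THEN mp, THEN mp, THEN mp, THEN mp, THEN mp, THEN mp, OF assms(2-7)])

text \<open>The exact response of the filter to \<open>z\<close> and the sinusoids is written down,
  and relative to it the filter error is driven by \<open>w\<close> alone. With the true parameters,
  the identifier row reproduces the undisturbed measurement and the even states reproduce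
  \<open>z\<close>; what remains are error signals to which the preceding energy bounds
  apply.\<close>

lemma node_L2:
  fixes A \<omega> \<phi> \<alpha>f \<beta>f \<alpha>0 :: "nat \<Rightarrow> real" and \<eta>0 :: "real Matrix.vec"
  assumes A: "\<And>j. j \<in> {1..k} \<Longrightarrow> A j \<noteq> 0"
    and \<omega>: "\<And>j. j \<in> {1..k} \<Longrightarrow> 0 < \<omega> j" "inj_on \<omega> {1..k}"
    and hurwitz: "hurwitz (filter_matrix k \<alpha>f \<beta>f)" and l: "l > 0" and \<mu>: "\<mu> > 0"
  shows "\<exists>K\<ge>0. node_gain k A \<omega> \<phi> \<alpha>f \<beta>f l \<mu> z \<eta>0 \<alpha>0 K"
proof -
  let ?n = "2 * k + 1"
  define sd where "sd = structured_disturbance k A \<omega> \<phi>"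
  \<comment> \<open>A parameter \<open>p\<close> is the tuple of disturbance, filter state,
    parameter estimate and frequency estimates, while the initial data stay fixed outside.\<close>
  define S where "S p W \<longleftrightarrow> (case p of (w, \<eta>, \<alpha>h, \<omega>h) \<Rightarrow>
    lbm w \<and> (\<forall>T\<ge>0. integral {0..T} (\<lambda>t. (w t)\<^sup>2) \<le> W) \<and>
    (\<forall>t\<ge>0. \<eta> t \<in> carrier_vec ?n) \<and>
    (\<forall>p<?n. solution
       (\<lambda>t. vec_index (filter_matrix k \<alpha>f \<beta>f *\<^sub>v \<eta> t + (z + sd t + w t) \<cdot>\<^sub>v filter_input k) p)
       (vec_index \<eta>0 p) (\<lambda>t. vec_index (\<eta> t) p)) \<and>
    (\<forall>j\<in>{1..k}. solution
       (\<lambda>t. l * identifier_error k \<alpha>f \<beta>f (\<alpha>h t) (\<eta> t) (z + sd t + w t)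
              * vec_index (\<eta> t) (2 * j - 1)) (\<alpha>0 j) (\<lambda>t. \<alpha>h t j)) \<and>
    (\<forall>t\<ge>0. frequency_estimates k \<omega> \<mu> (\<alpha>h t) (\<omega>h t)))"
    for p :: "(real \<Rightarrow> real) \<times> (real \<Rightarrow> real Matrix.vec) \<times> (real \<Rightarrow> nat \<Rightarrow> real) \<times> (real \<Rightarrow> nat \<Rightarrow> real)" and W
  define w where "w = (\<lambda>p :: (real \<Rightarrow> real) \<times> (real \<Rightarrow> real Matrix.vec) \<times> (real \<Rightarrow> nat \<Rightarrow> real) \<times> (real \<Rightarrow> nat \<Rightarrow> real). fst p)"
  define \<eta> where "\<eta> = (\<lambda>(p :: (real \<Rightarrow> real) \<times> (real \<Rightarrow> real Matrix.vec) \<times> (real \<Rightarrow> nat \<Rightarrow> real) \<times> (real \<Rightarrow> nat \<Rightarrow> real)) q t. vec_index (fst (snd p) t) q)"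
  define \<alpha>h where "\<alpha>h = (\<lambda>p :: (real \<Rightarrow> real) \<times> (real \<Rightarrow> real Matrix.vec) \<times> (real \<Rightarrow> nat \<Rightarrow> real) \<times> (real \<Rightarrow> nat \<Rightarrow> real). fst (snd (snd p)))"
  define \<omega>h where "\<omega>h = (\<lambda>p :: (real \<Rightarrow> real) \<times> (real \<Rightarrow> real Matrix.vec) \<times> (real \<Rightarrow> nat \<Rightarrow> real) \<times> (real \<Rightarrow> nat \<Rightarrow> real). snd (snd (snd p)))"
  have S: "lbm (w p)" "0 \<le> T \<Longrightarrow> integral {0..T} (\<lambda>t. (w p t)\<^sup>2) \<le> W"
    "0 \<le> t \<Longrightarrow> fst (snd p) t \<in> carrier_vec ?n"
    "q < ?n \<Longrightarrow> solution
       (\<lambda>t. vec_index (filter_matrix k \<alpha>f \<beta>f *\<^sub>v fst (snd p) t + (z + sd t + w p t) \<cdot>\<^sub>v filter_input k) q)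
       (vec_index \<eta>0 q) (\<eta> p q)"
    "j \<in> {1..k} \<Longrightarrow> solution
       (\<lambda>t. l * identifier_error k \<alpha>f \<beta>f (\<alpha>h p t) (fst (snd p) t) (z + sd t + w p t)
              * \<eta> p (2 * j - 1) t) (\<alpha>0 j) (\<lambda>t. \<alpha>h p t j)"
    "0 \<le> t \<Longrightarrow> frequency_estimates k \<omega> \<mu> (\<alpha>h p t) (\<omega>h p t)" if "S p W" for p W T t q j
    using that unfolding S_def w_def \<eta>_def \<alpha>h_def \<omega>h_def by (cases p; simp)+
  have W0: "0 \<le> W" if "S p W" for p W using S(2)[OF that, of 0] by simp
  have w: "L2_family S w"
  proof (rule L2_familyI[of 1])
    fix p W T assume Sp: "S p W" and T: "0 \<le> (T::real)"
    show "integral {0..T} (\<lambda>t. (norm (w p t))\<^sup>2) \<le> 1 * (1 + W)" using S(2)[OF Sp T] by simp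
  qed (simp_all add: S(1) W0)
  define c where "c = interleave \<beta>f \<alpha>f"
  define r where "r j = \<i> * complex_of_real (\<omega> j)" for j
  define P where "P j = char_fun ?n c (r j)" for j
  have P: "P j \<noteq> 0" for j
    unfolding P_def c_def by (rule pchar_nonzero[OF hurwitz]) (simp add: r_def)
  define C where "C j = complex_of_real (A j) * cis (\<phi> j) / P j" for j
  have C: "C j \<noteq> 0" if "j \<in> {1..k}" for j using A[OF that] P[of j] by (simp add: C_def)
  have \<beta>0: "\<beta>f 0 \<noteq> 0" by (rule \<beta>f_nonzero[OF hurwitz])
  define \<sigma> where "\<sigma> = tone k \<omega> C"
  have sd: "sd t = (\<Sum>j=1..k. Im (P j * (C j * cis (\<omega> j * t))))" for t
    unfolding sd_def C_def by (rule structured_disturbance_tones[OF P])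
  obtain \<alpha> where \<alpha>: "frequency_estimates k \<omega> 0 \<alpha> \<omega>" using true_coefficients[OF \<omega>] by blast
  have root: "(\<Sum>m\<le>k. complex_of_real (sq_coeff k \<alpha> m) * ((r j)\<^sup>2) ^ m) = 0" if "j \<in> {1..k}" for j
    unfolding r_def by (rule estimate_root[OF \<alpha> that])
  \<comment> \<open>A constant input settles in the first state only, because the later states are
    its derivatives.\<close>
  define \<eta>s where "\<eta>s q t = (if q = 0 then z / \<beta>f 0 else 0) + \<sigma> q t" for q t
  have steady: "(\<Sum>i<?n. f i * \<eta>s i t) = f 0 * (z / \<beta>f 0) + (\<Sum>i<?n. f i * \<sigma> i t)" for f t
    by (simp add: \<eta>s_def distrib_left sum.distrib if_distrib[of "\<lambda>x. _ * x"] del: sum.lessThan_Suc cong: if_cong)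
  \<comment> \<open>As \<open>\<sigma> ?n\<close> is the derivative of the last steady state, this
    is the last filter row for the input \<open>z + sd t\<close>.\<close>
  have I1: "(\<Sum>i<?n. c i * \<eta>s i t) = z + sd t - \<sigma> ?n t" for t
  proof -
    have "(\<Sum>i<?n. c i * \<sigma> i t) + \<sigma> ?n t
        = (\<Sum>j=1..k. Im ((\<Sum>i<?n. complex_of_real (c i) * r j ^ i) * (C j * cis (\<omega> j * t)))
            + Im (r j ^ ?n * (C j * cis (\<omega> j * t))))"
      unfolding \<sigma>_def tone_combination[where h="\<lambda>i. i"] r_def sum.distrib by (simp add: tone_def)
    also have "\<dots> = sd t"
      unfolding sd P_def char_fun_def by (intro sum.cong refl) (simp add: algebra_simps del: sum.lessThan_Suc)
    finally show ?thesis unfolding steady using \<beta>0 by (simp add: c_def interleave_def)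
  qed
  \<comment> \<open>With the true parameters the identifier polynomial takes the value
    \<open>P j\<close> at each frequency, so the prediction is exact.\<close>
  have I2: "(\<Sum>i<?n. interleave \<beta>f (\<lambda>j. \<alpha>f j - \<alpha> j) i * \<eta>s i t) = z + sd t" for t
  proof -
    have "(\<Sum>i<?n. interleave \<beta>f (\<lambda>j. \<alpha>f j - \<alpha> j) i * \<sigma> i t) = sd t"
      unfolding \<sigma>_def tone_combination[where h="\<lambda>i. i"] sd
    proof (intro sum.cong refl)
      fix j assume j: "j \<in> {1..k}"
      have "(\<Sum>i<?n. complex_of_real (interleave \<beta>f (\<lambda>j. \<alpha>f j - \<alpha> j) i) * (\<i> * complex_of_real (\<omega> j)) ^ i) = P j"
        unfolding char_fun_interleave_diff r_def[symmetric] root[OF j] by (simp add: P_def c_def)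
      then show "Im ((\<Sum>i<?n. complex_of_real (interleave \<beta>f (\<lambda>j. \<alpha>f j - \<alpha> j) i) * (\<i> * complex_of_real (\<omega> j)) ^ i)
          * (C j * cis (\<omega> j * t))) = Im (P j * (C j * cis (\<omega> j * t)))" by (simp only:)
    qed
    then show ?thesis unfolding steady using \<beta>0 by (simp add: interleave_def)
  qed
  \<comment> \<open>The true coefficients form a polynomial in the squared frequency variable that
    vanishes at all true frequencies.\<close>
  have I3: "(\<Sum>m\<le>k. sq_coeff k \<alpha> m * \<sigma> (2 * m) t) = 0" for t
    unfolding \<sigma>_def tone_combination[where h="\<lambda>m. 2 * m"]
    using root by (intro sum.neutral) (simp add: r_def power_mult)
  define \<zeta> where "\<zeta> p q t = \<eta> p q t - \<eta>s q t" for p q t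
  have l\<sigma>: "lbm (\<sigma> q)" for q unfolding \<sigma>_def by (rule tone_lbm)
  have l\<eta>: "lbm (\<eta> p q)" if "S p W" "q < ?n" for p W q by (rule solution_lbm[OF S(4)[OF that]])
  have l\<alpha>: "continuous_on {0..} (\<lambda>t. \<alpha>h p t j)" if "S p W" "j \<in> {1..k}" for p W j
    by (rule integrated_continuous) (use S(5)[OF that] in \<open>auto simp: solution_def\<close>)
  have lsd: "lbm sd" unfolding sd_def structured_disturbance_def by (intro lbm_continuous continuous_intros)
  have l\<eta>s: "lbm (\<eta>s q)" for q unfolding \<eta>s_def by (intro lbm_add lbm_const l\<sigma>)
  have l\<zeta>: "lbm (\<zeta> p q)" if "S p W" "q < ?n" for p W q
    unfolding \<zeta>_def by (intro lbm_diff l\<eta>[OF that] l\<eta>s)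
  have p\<zeta>: "primitive (\<lambda>t. if Suc q < ?n then \<zeta> p (Suc q) t else w p t - (\<Sum>i<?n. c i * \<zeta> p i t)) (\<zeta> p q)"
    if Sp: "S p W" and q: "q < ?n" for p W q
  proof -
    let ?f = "\<lambda>t. if Suc q < ?n then \<eta> p (Suc q) t else (z + sd t + w p t) - (\<Sum>i<?n. c i * \<eta> p i t)"
    have "solution ?f (vec_index \<eta>0 q) (\<eta> p q)"
      by (rule iffD1[OF solution_cong S(4)[OF Sp q]]) (simp_all only: filter_row[OF S(3)[OF Sp] q] \<eta>_def c_def)
    moreover have "lbm ?f"
      using l\<eta>[OF Sp, of "Suc q"]
      by (cases "Suc q < ?n") (simp_all only: if_True if_False, intro lbm_diff lbm_add lbm_sum lbm_cmult lbm_const lsd S(1)[OF Sp] l\<eta>[OF Sp], simp)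
    ultimately have "primitive ?f (\<eta> p q)" by (rule solution_primitive)
    from primitive_diff[OF this primitive_add[OF primitive_const[of "if q = 0 then z / \<beta>f 0 else 0"] tone_primitive[of k \<omega> C q]]]
    have pr: "primitive (\<lambda>t. ?f t - (0 + \<sigma> (Suc q) t)) (\<zeta> p q)"
      unfolding \<zeta>_def[abs_def] \<eta>s_def \<sigma>_def .
    have "(\<lambda>t. ?f t - (0 + \<sigma> (Suc q) t))
        = (\<lambda>t. if Suc q < ?n then \<zeta> p (Suc q) t else w p t - (\<Sum>i<?n. c i * \<zeta> p i t))"
    proof
      fix t
      show "?f t - (0 + \<sigma> (Suc q) t) = (if Suc q < ?n then \<zeta> p (Suc q) t else w p t - (\<Sum>i<?n. c i * \<zeta> p i t))"
      proof (cases "Suc q < ?n")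
        case True
        then show ?thesis by (simp add: \<zeta>_def \<eta>s_def)
      next
        case False
        then have "Suc q = ?n" using q by simp
        moreover have "(\<Sum>i<?n. c i * \<zeta> p i t) = (\<Sum>i<?n. c i * \<eta> p i t) - (z + sd t - \<sigma> ?n t)"
          unfolding \<zeta>_def right_diff_distrib sum_subtractf I1 ..
        ultimately show ?thesis by simp
      qed
    qed
    then show ?thesis using pr by simp
  qed
  have \<zeta>: "L2_family S (\<lambda>p. \<zeta> p q)" if "q < ?n" for q
  proof (rule companion_L2[OF _ _ w p\<zeta> _ that])
    show "Re s < 0" if "char_fun ?n c s = 0" for s
      using hurwitz_char_fun[OF hurwitz] that by (simp only: c_def)
    show "\<zeta> p q 0 = vec_index \<eta>0 q - \<eta>s q 0" if "S p W" "q < ?n" for p W q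
      using solution_initial[OF S(4)[OF that]] by (simp add: \<zeta>_def)
  qed auto
  define \<alpha>e where "\<alpha>e p m t = \<alpha>h p t m - \<alpha> m" for p m t
  define y where "y p m t = \<sigma> (2 * m - 1) t + \<zeta> p (2 * m - 1) t" for p m t
  \<comment> \<open>The part of the identifier error that is not due to wrong parameters: filter
    error and disturbance.\<close>
  define d where "d p t = (\<Sum>i<?n. interleave \<beta>f (\<lambda>j. \<alpha>f j - \<alpha> j) i * \<zeta> p i t) - w p t" for p t
  define e where "e p t = d p t - (\<Sum>m\<in>{1..k}. \<alpha>e p m t * y p m t)" for p t
  have idx: "2 * m - 1 < ?n" "2 * m - 1 \<noteq> 0" if "m \<in> {1..k}" for m using that by auto
  have d: "L2_family S d"
    unfolding d_def by (intro L2_family_diff L2_family_sum[OF w] L2_family_mult_left \<zeta> w) simp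
  have ly: "lbm (y p m)" if "S p W" "m \<in> {1..k}" for p W m
    unfolding y_def by (intro lbm_add l\<sigma> l\<zeta>[OF that(1)] idx that(2))
  have lae: "lbm (\<alpha>e p m)" if "S p W" "m \<in> {1..k}" for p W m
    unfolding \<alpha>e_def by (intro lbm_diff lbm_const lbm_continuous[OF l\<alpha>[OF that]])
  have le: "lbm (e p)" if "S p W" for p W
    unfolding e_def by (intro lbm_diff lbm_sum lbm_mult L2_family_lbm[OF d that] lae[OF that] ly[OF that])
  have y: "\<eta> p (2 * m - 1) t = y p m t" if "m \<in> {1..k}" for p m t
    using idx(2)[OF that] by (simp add: y_def \<zeta>_def \<eta>s_def)
  have ident: "(\<Sum>i<?n. interleave \<beta>f (\<lambda>j. \<alpha>f j - \<alpha>h p t j) i * \<eta> p i t) - (z + sd t + w p t) = e p t" for p t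
  proof -
    have "(\<Sum>i<?n. interleave \<beta>f (\<lambda>j. \<alpha>f j - \<alpha> j) i * \<zeta> p i t)
        = (\<Sum>i<?n. interleave \<beta>f (\<lambda>j. \<alpha>f j - \<alpha> j) i * \<eta> p i t) - (z + sd t)"
      unfolding \<zeta>_def right_diff_distrib sum_subtractf I2 ..
    moreover have "(\<Sum>m=1..k. (\<alpha>h p t m - \<alpha> m) * \<eta> p (2 * m - 1) t) = (\<Sum>m\<in>{1..k}. \<alpha>e p m t * y p m t)"
      by (intro sum.cong refl) (simp only: \<alpha>e_def y)
    ultimately show ?thesis
      unfolding sum_interleave_shift[where \<alpha>=\<alpha> and \<alpha>h="\<alpha>h p t" and x="\<lambda>i. \<eta> p i t"] e_def d_def by linarith
  qed
  have p\<alpha>: "primitive (\<lambda>t. l * e p t * y p m t) (\<alpha>e p m)" if Sp: "S p W" and m: "m \<in> {1..k}" for p W m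
  proof -
    have "identifier_error k \<alpha>f \<beta>f (\<alpha>h p t) (fst (snd p) t) (z + sd t + w p t) = e p t" if "0 \<le> t" for t
      unfolding identifier_error_sum[OF S(3)[OF Sp that]] ident[symmetric] \<eta>_def ..
    then have "solution (\<lambda>t. l * e p t * y p m t) (\<alpha>0 m) (\<lambda>t. \<alpha>h p t m)"
      by (intro iffD1[OF solution_cong S(5)[OF Sp m]]) (simp_all only: y[OF m])
    then have "primitive (\<lambda>t. l * e p t * y p m t) (\<lambda>t. \<alpha>h p t m)"
      by (rule solution_primitive) (intro lbm_mult lbm_const le[OF Sp] ly[OF Sp m])
    from primitive_diff[OF this primitive_const[of "\<alpha> m"]] show ?thesis by (simp add: \<alpha>e_def[abs_def])
  qed
  have e: "L2_family S e"
  proof (rule identifier_L2[OF l d ly le e_def p\<alpha>])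
    show "\<alpha>e p m 0 = \<alpha>0 m - \<alpha> m" if "S p W" "m \<in> {1..k}" for p W m
      using solution_initial[OF S(5)[OF that]] by (simp add: \<alpha>e_def)
  qed
  define R where "R = (1 + 1 / \<mu>\<^sup>2) ^ k"
  have R0: "0 \<le> R" by (simp add: R_def)
  define a where "a p m t = sq_coeff k (\<alpha>h p t) m" for p m t
  have a0: "\<mu> ^ (2 * k) \<le> a p 0 t" and ratio: "m \<le> k \<Longrightarrow> \<bar>a p m t / a p 0 t\<bar> \<le> R"
    if "S p W" "0 \<le> t" for p W t m
    using estimate_coeff_bounds[OF S(6)[OF that] \<mu>] by (simp_all add: a_def R_def)
  have a0': "0 < a p 0 t" if "S p W" "0 \<le> t" for p W t
    using a0[OF that] zero_less_power[OF \<mu>, of "2 * k"] by linarith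
  have lratio: "lbm (\<lambda>t. a p m t / a p 0 t)" if Sp: "S p W" for p W m
  proof -
    have "continuous_on {0..} (a p m)" for m
      using l\<alpha>[OF Sp, of "Suc m"] by (cases "m < k") (simp_all add: a_def sq_coeff_def)
    then show ?thesis
      by (intro lbm_continuous continuous_on_divide) (use a0'[OF Sp] in force)+
  qed
  \<comment> \<open>The contribution of the sinusoidal steady state to \<open>q - z\<close>. Its two
    bounds have different origins: \<open>B1\<close> comes from the coefficient ratios; for
    \<open>B2\<close> the identity \<open>I3\<close> is subtracted, which leaves parameter errors
    over a denominator of at least \<open>\<mu> ^ (2 * k)\<close>.\<close>
  define g where "g p t = \<beta>f 0 * (\<Sum>m\<le>k. a p m t / a p 0 t * \<sigma> (2 * m) t)" for p t
  have lg: "lbm (g p)" if "S p W" for p W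
    unfolding g_def by (intro lbm_cmult lbm_sum lbm_mult lratio[OF that] l\<sigma>)
  define Ks where "Ks = (\<Sum>q\<le>?n. \<Sum>j=1..k. \<bar>\<omega> j\<bar> ^ q * cmod (C j))"
  have Ks: "\<bar>\<sigma> q t\<bar> \<le> Ks" if "q \<le> ?n" for q t
  proof -
    have "\<bar>\<sigma> q t\<bar> \<le> (\<Sum>j=1..k. \<bar>\<omega> j\<bar> ^ q * cmod (C j))" unfolding \<sigma>_def by (rule tone_bounded)
    also have "\<dots> \<le> Ks" unfolding Ks_def
      by (rule member_le_sum[of q "{..?n}" "\<lambda>q. \<Sum>j=1..k. \<bar>\<omega> j\<bar> ^ q * cmod (C j)"]) (use that in \<open>auto intro!: sum_nonneg\<close>)
    finally show ?thesis .
  qed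
  have Ks0: "0 \<le> Ks" using Ks[of 0 0] by simp
  define B1 where "B1 = (\<bar>\<beta>f 0\<bar> * (real (Suc k) * (R * Ks)))\<^sup>2"
  define B2 where "B2 = (\<beta>f 0 / \<mu> ^ (2 * k))\<^sup>2 * (real k * Ks\<^sup>2)"
  have B0: "0 \<le> B1" "0 \<le> B2" by (simp_all add: B1_def B2_def)
  have g1: "(g p t)\<^sup>2 \<le> B1" if "S p W" "0 \<le> t" for p W t
  proof -
    have "\<bar>\<Sum>m\<le>k. a p m t / a p 0 t * \<sigma> (2 * m) t\<bar> \<le> (\<Sum>m\<le>k. \<bar>a p m t / a p 0 t * \<sigma> (2 * m) t\<bar>)" by (rule sum_abs)
    also have "\<dots> \<le> (\<Sum>m\<le>k. R * Ks)"
    proof (rule sum_mono)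
      fix m assume "m \<in> {..k}"
      then show "\<bar>a p m t / a p 0 t * \<sigma> (2 * m) t\<bar> \<le> R * Ks"
        unfolding abs_mult using ratio[OF that, of m] Ks[of "2 * m" t] R0 by (intro mult_mono) auto
    qed
    also have "\<dots> = real (Suc k) * (R * Ks)" by simp
    finally have "\<bar>g p t\<bar> \<le> \<bar>\<beta>f 0\<bar> * (real (Suc k) * (R * Ks))"
      unfolding g_def abs_mult by (rule mult_left_mono) simp
    then have "\<bar>g p t\<bar>\<^sup>2 \<le> (\<bar>\<beta>f 0\<bar> * (real (Suc k) * (R * Ks)))\<^sup>2" by (rule power_mono) simp
    then show ?thesis by (simp only: B1_def power2_abs)
  qed
  have g2: "(g p t)\<^sup>2 \<le> B2 * (\<Sum>m\<in>{1..k}. (\<alpha>e p m t)\<^sup>2)" if "S p W" "0 \<le> t" for p W t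
  proof -
    note pos = a0'[OF that]
    have "(\<Sum>m\<le>k. a p m t / a p 0 t * \<sigma> (2 * m) t) = (\<Sum>m\<le>k. a p m t * \<sigma> (2 * m) t) / a p 0 t"
      by (simp add: sum_divide_distrib)
    also have "(\<Sum>m\<le>k. a p m t * \<sigma> (2 * m) t) = (\<Sum>m\<le>k. (a p m t - sq_coeff k \<alpha> m) * \<sigma> (2 * m) t)"
      unfolding left_diff_distrib sum_subtractf I3 by simp
    also have "\<dots> = (\<Sum>m<k. \<alpha>e p (Suc m) t * \<sigma> (2 * m) t)"
      by (simp add: lessThan_Suc_atMost[symmetric] a_def sq_coeff_def \<alpha>e_def)
    finally have "(g p t)\<^sup>2 = (\<beta>f 0 / a p 0 t)\<^sup>2 * (\<Sum>m<k. \<alpha>e p (Suc m) t * \<sigma> (2 * m) t)\<^sup>2"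
      by (simp add: g_def power_mult_distrib power_divide)
    also have "\<dots> \<le> (\<beta>f 0 / \<mu> ^ (2 * k))\<^sup>2 * ((\<Sum>m<k. (\<alpha>e p (Suc m) t)\<^sup>2) * (real k * Ks\<^sup>2))"
    proof (rule mult_mono)
      have "\<bar>\<beta>f 0 / a p 0 t\<bar> \<le> \<bar>\<beta>f 0 / \<mu> ^ (2 * k)\<bar>"
        using a0[OF that] pos \<mu> by (simp add: abs_divide divide_left_mono)
      then show "(\<beta>f 0 / a p 0 t)\<^sup>2 \<le> (\<beta>f 0 / \<mu> ^ (2 * k))\<^sup>2" by (simp only: abs_le_square_iff)
      have "(\<Sum>m<k. (\<sigma> (2 * m) t)\<^sup>2) \<le> (\<Sum>m<k. Ks\<^sup>2)"
      proof (rule sum_mono)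
        fix m assume "m \<in> {..<k}"
        then have "\<bar>\<sigma> (2 * m) t\<bar>\<^sup>2 \<le> Ks\<^sup>2" by (intro power_mono Ks) auto
        then show "(\<sigma> (2 * m) t)\<^sup>2 \<le> Ks\<^sup>2" by (simp only: power2_abs)
      qed
      then have "(\<Sum>m<k. (\<alpha>e p (Suc m) t)\<^sup>2) * (\<Sum>m<k. (\<sigma> (2 * m) t)\<^sup>2)
          \<le> (\<Sum>m<k. (\<alpha>e p (Suc m) t)\<^sup>2) * (real k * Ks\<^sup>2)"
        by (intro mult_left_mono sum_nonneg) auto
      then show "(\<Sum>m<k. \<alpha>e p (Suc m) t * \<sigma> (2 * m) t)\<^sup>2 \<le> (\<Sum>m<k. (\<alpha>e p (Suc m) t)\<^sup>2) * (real k * Ks\<^sup>2)"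
        using Cauchy_Schwarz_ineq_sum[of "\<lambda>m. \<alpha>e p (Suc m) t" "\<lambda>m. \<sigma> (2 * m) t" "{..<k}"] by linarith
    qed auto
    also have "(\<Sum>m<k. (\<alpha>e p (Suc m) t)\<^sup>2) = (\<Sum>m\<in>{1..k}. (\<alpha>e p m t)\<^sup>2)"
      by (simp add: sum.atLeast1_atMost_eq)
    finally show ?thesis by (simp add: B2_def mult_ac)
  qed
  obtain ce \<tau> where exc: "ce > 0" "\<tau> > 0" "\<And>b s. ce * (\<Sum>m\<in>{1..k}. (b m)\<^sup>2)
    \<le> integral {s..s + \<tau>} (\<lambda>t. (\<Sum>m\<in>{1..k}. b m * \<sigma> (2 * m - 1) t)\<^sup>2)"
    unfolding \<sigma>_def
    by (rule odd_tones_persistently_exciting[OF \<omega> C]) (assumption, assumption, erule that, assumption, simp add: \<sigma>_def)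
  have g: "L2_family S g"
  proof (rule window_L2[where J="{1..k}" and l=l and \<sigma>="\<lambda>m. \<sigma> (2 * m - 1)" and \<zeta>="\<lambda>p m. \<zeta> p (2 * m - 1)"
        and \<alpha>=\<alpha>e and e=e and d=d and B="B1 + B2" and \<tau>=\<tau> and c=ce and ?K0.0=Ks])
    show "\<bar>\<sigma> (2 * m - 1) t\<bar> \<le> Ks" if "m \<in> {1..k}" for m t using idx(1)[OF that] by (intro Ks) simp
    show "primitive (\<lambda>t. l * e p t * (\<sigma> (2 * m - 1) t + \<zeta> p (2 * m - 1) t)) (\<alpha>e p m)" if "S p W" "m \<in> {1..k}" for p W m
      using p\<alpha>[OF that] by (simp only: y_def)
    show "e p t = d p t - (\<Sum>m\<in>{1..k}. \<alpha>e p m t * (\<sigma> (2 * m - 1) t + \<zeta> p (2 * m - 1) t))" for p t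
      by (simp only: e_def y_def)
    show "(g p t)\<^sup>2 \<le> B1 + B2" if "S p W" "0 \<le> t" for p W t using g1[OF that] B0 by linarith
    show "(g p t)\<^sup>2 \<le> (B1 + B2) * (\<Sum>m\<in>{1..k}. (\<alpha>e p m t)\<^sup>2)" if "S p W" "0 \<le> t" for p W t
    proof -
      have "0 \<le> B1 * (\<Sum>m\<in>{1..k}. (\<alpha>e p m t)\<^sup>2)" by (intro mult_nonneg_nonneg B0 sum_nonneg) simp
      then show ?thesis using g2[OF that] by (simp add: distrib_right)
    qed
  qed (use exc l\<sigma> e d \<zeta> idx lg B0 in auto)
  \<comment> \<open>Identifier error, filter error seen through the coefficient ratios, and
    \<open>g\<close>. The constant steady state in the combination of even states accounts for
    exactly \<open>z\<close>.\<close>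
  define u where "u p t = e p t - \<beta>f 0 * (\<Sum>m\<le>k. a p m t / a p 0 t * \<zeta> p (2 * m) t) - g p t" for p t
  have "L2_family S (\<lambda>p t. a p m t / a p 0 t * \<zeta> p (2 * m) t)" if m: "m \<le> k" for m
  proof (rule L2_family_dominated[OF \<zeta>, of "2 * m" _ R])
    show "2 * m < ?n" using m by simp
    show "lbm (\<lambda>t. a p m t / a p 0 t * \<zeta> p (2 * m) t)" if "S p W" for p W
      using m by (intro lbm_mult lratio[OF that] l\<zeta>[OF that]) simp
    show "norm (a p m t / a p 0 t * \<zeta> p (2 * m) t) \<le> R * norm (\<zeta> p (2 * m) t)" if "S p W" "0 \<le> t" for p W t
      unfolding real_norm_def abs_mult[of _ "\<zeta> p (2 * m) t"] by (intro mult_right_mono ratio[OF that m]) simp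
  qed
  then have u: "L2_family S u"
    unfolding u_def by (intro L2_family_diff e g L2_family_mult_left L2_family_sum[OF w]) simp
  then obtain K where K: "K \<ge> 0" "\<And>p W. S p W \<Longrightarrow> lbm (u p) \<and> (\<forall>T\<ge>0. integral {0..T} (\<lambda>t. (u p t)\<^sup>2) \<le> K * (1 + W))"
    unfolding L2_family_def by auto
  have comp: "u p t = compensation k \<alpha>f \<beta>f (\<omega>h p t) (fst (snd p) t) - (z + sd t + w p t) + z"
    if Sp: "S p W" and t: "0 \<le> t" for p W t
  proof -
    have "(\<Sum>m\<le>k. a p m t / a p 0 t * \<eta> p (2 * m) t)
        = (\<Sum>m\<le>k. a p m t / a p 0 t * \<zeta> p (2 * m) t) + (\<Sum>m\<le>k. a p m t / a p 0 t * \<sigma> (2 * m) t)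
          + (\<Sum>m\<le>k. if m = 0 then a p 0 t / a p 0 t * (z / \<beta>f 0) else 0)"
      unfolding sum.distrib[symmetric] by (intro sum.cong refl) (simp add: \<zeta>_def \<eta>s_def algebra_simps)
    also have "(\<Sum>m\<le>k. if m = 0 then a p 0 t / a p 0 t * (z / \<beta>f 0) else 0) = z / \<beta>f 0"
      using a0'[OF Sp t] by simp
    finally have "\<beta>f 0 * (\<Sum>m\<le>k. a p m t / a p 0 t * \<eta> p (2 * m) t)
        = \<beta>f 0 * (\<Sum>m\<le>k. a p m t / a p 0 t * \<zeta> p (2 * m) t) + g p t + z"
      using \<beta>0 by (simp add: g_def distrib_left)
    moreover have "compensation k \<alpha>f \<beta>f (\<omega>h p t) (fst (snd p) t) = (e p t + (z + sd t + w p t))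
        - \<beta>f 0 * (\<Sum>m\<le>k. a p m t / a p 0 t * \<eta> p (2 * m) t)"
      unfolding compensation_formula[OF hurwitz S(6)[OF Sp t] \<mu> S(3)[OF Sp t]] ident[symmetric] a_def \<eta>_def by simp
    ultimately show ?thesis by (simp add: u_def)
  qed
  show ?thesis
    unfolding node_gain_def
  proof (intro exI[of _ K] conjI K(1) allI impI)
    fix w' :: "real \<Rightarrow> real" and \<eta>' :: "real \<Rightarrow> real Matrix.vec" and \<alpha>' \<omega>' :: "real \<Rightarrow> nat \<Rightarrow> real" and W
    assume *: "lbm w'" "\<forall>T\<ge>0. integral {0..T} (\<lambda>t. (w' t)\<^sup>2) \<le> W" "\<forall>t\<ge>0. \<eta>' t \<in> carrier_vec ?n"
      "\<forall>p<?n. solution (\<lambda>t. vec_index (filter_matrix k \<alpha>f \<beta>f *\<^sub>v \<eta>' t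
          + (z + structured_disturbance k A \<omega> \<phi> t + w' t) \<cdot>\<^sub>v filter_input k) p) (vec_index \<eta>0 p) (\<lambda>t. vec_index (\<eta>' t) p)"
      "\<forall>j\<in>{1..k}. solution (\<lambda>t. l * identifier_error k \<alpha>f \<beta>f (\<alpha>' t) (\<eta>' t) (z + structured_disturbance k A \<omega> \<phi> t + w' t)
              * vec_index (\<eta>' t) (2 * j - 1)) (\<alpha>0 j) (\<lambda>t. \<alpha>' t j)"
      "\<forall>t\<ge>0. frequency_estimates k \<omega> \<mu> (\<alpha>' t) (\<omega>' t)"
    define p where "p = (w', \<eta>', \<alpha>', \<omega>')"
    have Sp: "S p W" unfolding S_def p_def prod.case sd_def by (intro conjI *)
    show "\<exists>u. lbm u \<and> (\<forall>T\<ge>0. integral {0..T} (\<lambda>t. (u t)\<^sup>2) \<le> K * (1 + W)) \<and>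
      (\<forall>t\<ge>0. u t = compensation k \<alpha>f \<beta>f (\<omega>' t) (\<eta>' t) - (z + structured_disturbance k A \<omega> \<phi> t + w' t) + z)"
      using K(2)[OF Sp] comp[OF Sp] by (intro exI[of _ "u p"]) (simp add: p_def \<omega>h_def w_def sd_def)
  qed
qed

section \<open>The closed loop\<close>

lemma nn_integral_Icc_lbm:
  assumes f: "lbm f" and nonneg: "\<And>t. 0 \<le> t \<Longrightarrow> 0 \<le> f t"
  shows "(\<integral>\<^sup>+t\<in>{0..T}. ennreal (f t) \<partial>lebesgue) = ennreal (integral {0..T} f)"
proof -
  have "(f has_integral integral {0..T} f) {0..T}"
    using lbm_integrable[OF f order_refl] by (rule integrable_integral)
  from nn_integral_has_integral_lebesgue[OF _ this] nonneg
  have "(\<integral>\<^sup>+t. ennreal (indicator {0..T} t * f t) \<partial>lborel) = ennreal (integral {0..T} f)" by simp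
  moreover have "ennreal (indicator {0..T} t * f t) = ennreal (f t) * indicator {0..T} t" for t
    by (simp split: split_indicator)
  ultimately show ?thesis by (simp add: nn_integral_completion)
qed

text \<open>Monotone convergence along \<open>{0..real n}\<close>. It leads from the gauge integrals
  on finite horizons, in which all estimates are made, to the extended nonnegative integral of the
  theorem.\<close>

lemma nn_integral_Ici_le:
  assumes f: "lbm f" and nonneg: "\<And>t. 0 \<le> t \<Longrightarrow> 0 \<le> f t"
    and le: "\<And>T. 0 \<le> T \<Longrightarrow> integral {0..T} f \<le> M"
  shows "(\<integral>\<^sup>+t\<in>{0..}. ennreal (f t) \<partial>lebesgue) \<le> ennreal M"
proof -
  define F where "F n t = ennreal (f t) * indicator {0..real n} t" for n t
  have "F n \<in> borel_measurable lebesgue" for n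
  proof -
    have "f \<in> borel_measurable (lebesgue_on {0..real n})"
      using f unfolding locally_bounded_measurable_def
      by (auto intro!: measurable_restrict_mono[of f lebesgue "{0..}"])
    then have "(\<lambda>t. ennreal (f t)) \<in> borel_measurable (lebesgue_on {0..real n})" by measurable
    then show ?thesis
      unfolding F_def by (subst borel_measurable_restrict_space_iff_ennreal[symmetric]) auto
  qed
  moreover have "incseq F"
    by (auto simp: F_def incseq_def le_fun_def split: split_indicator)
  ultimately have SUP: "(\<integral>\<^sup>+t. (SUP n. F n t) \<partial>lebesgue) = (SUP n. integral\<^sup>N lebesgue (F n))"
    by (intro nn_integral_monotone_convergence_SUP)
  have "ennreal (f t) * indicator {0..} t \<le> (SUP n. F n t)" for t
  proof (cases "0 \<le> t")
    case True
    obtain n where "t \<le> real n" using real_arch_simple by blast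
    then have "ennreal (f t) * indicator {0..} t = F n t" using True by (simp add: F_def)
    also have "\<dots> \<le> (SUP n. F n t)" by (rule SUP_upper) simp
    finally show ?thesis .
  qed simp
  then have "(\<integral>\<^sup>+t\<in>{0..}. ennreal (f t) \<partial>lebesgue) \<le> (\<integral>\<^sup>+t. (SUP n. F n t) \<partial>lebesgue)"
    by (rule nn_integral_mono)
  also have "\<dots> \<le> ennreal M"
    unfolding SUP
  proof (rule SUP_least)
    fix n
    show "integral\<^sup>N lebesgue (F n) \<le> ennreal M"
      unfolding F_def by (subst nn_integral_Icc_lbm[OF f nonneg]) (simp_all add: ennreal_leI le)
  qed
  finally show ?thesis .
qed

theorem theorem2:
  fixes a :: "real^'n^'n" and H :: "real^'m^'n" and z :: "real^'n"
    and k :: "'n \<Rightarrow> nat"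
    and A \<omega> \<phi> :: "'n \<Rightarrow> nat \<Rightarrow> real"
    and \<alpha>f \<beta>f :: "'n \<Rightarrow> nat \<Rightarrow> real"
    and l \<kappa>\<^sub>1 \<kappa>\<^sub>2 \<mu> :: real
    and x0 v0 :: "'n \<Rightarrow> real^'m"
    and \<eta>0 :: "'n \<Rightarrow> real Matrix.vec"
    and \<alpha>0 :: "'n \<Rightarrow> nat \<Rightarrow> real"
  assumes "CARD('n) \<ge> 2"
    and "adjacency_matrix a" "weight_balanced a" "strongly_connected a"
    and "rank H = CARD('m)"
    and "\<And>i j. j \<in> {1..k i} \<Longrightarrow> A i j \<noteq> 0"
    and "\<And>i j. j \<in> {1..k i} \<Longrightarrow> \<omega> i j > 0"
    and "\<And>i. inj_on (\<omega> i) {1..k i}"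
    and "\<And>i. hurwitz (filter_matrix (k i) (\<alpha>f i) (\<beta>f i))"
    and "l > 0" "\<kappa>\<^sub>1 \<ge> 1"
    and "\<kappa>\<^sub>2 \<ge> 6 * real CARD('n) * lambda_upper a H ^ 4 * \<kappa>\<^sub>1\<^sup>2 / lambda_lower a H ^ 4
                * max 1 (1 / lambda_lower a H)"
    and "\<And>i. \<eta>0 i \<in> carrier_vec (2 * k i + 1)"
    and "\<mu> > 0"
  shows "\<exists>\<gamma>>0. \<exists>\<delta>>0. \<forall>(w :: real \<Rightarrow> real^'n) x v \<eta> \<alpha>h \<omega>h.
    w \<in> borel_measurable (lebesgue_on {0..}) \<longrightarrow> bounded (w ` {0..}) \<longrightarrow>
    solver_trajectory a H k \<alpha>f \<beta>f l \<kappa>\<^sub>1 \<kappa>\<^sub>2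
      (\<lambda>i t. z $ i + structured_disturbance (k i) (A i) (\<omega> i) (\<phi> i) t + w t $ i)
      x0 v0 \<eta>0 \<alpha>0 x v \<eta> \<alpha>h \<omega>h \<longrightarrow>
    (\<forall>i. \<forall>t\<ge>0. frequency_estimates (k i) (\<omega> i) \<mu> (\<alpha>h i t) (\<omega>h i t)) \<longrightarrow>
    (\<forall>i. (\<integral>\<^sup>+t\<in>{0..}. ennreal ((norm (x i t - least_squares H z))\<^sup>2) \<partial>lebesgue)
        \<le> ennreal \<gamma> * (\<integral>\<^sup>+t\<in>{0..}. ennreal ((norm (w t))\<^sup>2) \<partial>lebesgue) + ennreal \<delta>)"
proof -
  let ?y = "\<lambda>w i t. z $ i + structured_disturbance (k i) (A i) (\<omega> i) (\<phi> i) t + (w t :: real^'n) $ i"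
  define G where "G i = node_gain (k i) (A i) (\<omega> i) (\<phi> i) (\<alpha>f i) (\<beta>f i) l \<mu> (z $ i) (\<eta>0 i) (\<alpha>0 i)" for i
  have "\<forall>i. \<exists>K\<ge>0. G i K"
    unfolding G_def by (intro allI node_L2 assms(6-10,14))
  then obtain Kn where Kn: "\<forall>i. Kn i \<ge> 0 \<and> G i (Kn i)" by (rule choice[THEN exE])
  \<comment> \<open>A common gain of all nodes, because the network estimate takes one energy bound
    for all of them.\<close>
  define M where "M = (\<Sum>i\<in>UNIV. Kn i)"
  have M: "0 \<le> M" "Kn i \<le> M" for i
    unfolding M_def by (auto intro!: sum_nonneg member_le_sum simp: Kn)
  obtain K where K: "network_gain a H \<kappa>\<^sub>1 \<kappa>\<^sub>2 z x0 v0 K"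
    using network_L2_gain[OF assms(1-5,11,12)] by blast
  \<comment> \<open>Strictly positive whatever the sign of \<open>K\<close>, as the two constants of
    the theorem have to be.\<close>
  define K' where "K' = \<bar>K\<bar> + 1"
  have K': "0 < K'" "K \<le> K'" by (auto simp: K'_def)
  have pos: "0 < K' * M + 1" "0 < K' * (1 + M)" using K' M(1) by (auto intro: add_nonneg_pos)
  show ?thesis
  proof (rule exI[of _ "K' * M + 1"], rule conjI[OF pos(1)], rule exI[of _ "K' * (1 + M)"],
      rule conjI[OF pos(2)], intro allI impI)
    fix w :: "real \<Rightarrow> real^'n" and x v \<eta> \<alpha>h \<omega>h i0
    assume w: "w \<in> borel_measurable (lebesgue_on {0..})" "bounded (w ` {0..})"
      and traj: "solver_trajectory a H k \<alpha>f \<beta>f l \<kappa>\<^sub>1 \<kappa>\<^sub>2 (?y w) x0 v0 \<eta>0 \<alpha>0 x v \<eta> \<alpha>h \<omega>h"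
      and est: "\<forall>i. \<forall>t\<ge>0. frequency_estimates (k i) (\<omega> i) \<mu> (\<alpha>h i t) (\<omega>h i t)"
    note tr = traj[unfolded solver_trajectory_def, THEN spec]
    note tx = tr[THEN conjunct1] and tv = tr[THEN conjunct2, THEN conjunct1]
      and tr_\<eta> = tr[THEN conjunct2, THEN conjunct2, THEN conjunct1]
      and tr_filter = tr[THEN conjunct2, THEN conjunct2, THEN conjunct2, THEN conjunct1]
      and tr_\<alpha> = tr[THEN conjunct2, THEN conjunct2, THEN conjunct2, THEN conjunct2]
    define I where "I = (\<integral>\<^sup>+t\<in>{0..}. ennreal ((norm (w t))\<^sup>2) \<partial>lebesgue)"
    show "(\<integral>\<^sup>+t\<in>{0..}. ennreal ((norm (x i0 t - least_squares H z))\<^sup>2) \<partial>lebesgue)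
        \<le> ennreal (K' * M + 1) * (\<integral>\<^sup>+t\<in>{0..}. ennreal ((norm (w t))\<^sup>2) \<partial>lebesgue) + ennreal (K' * (1 + M))"
      unfolding I_def[symmetric]
    proof (cases I rule: ennreal_cases)
      \<comment> \<open>A disturbance of infinite energy makes the right-hand side infinite once its
        factor is nonzero; the summand 1 in that factor guarantees this even when
        \<open>M = 0\<close>.\<close>
      case top
      have "ennreal (K' * M + 1) \<noteq> 0" using K' M(1) by (auto simp: ennreal_eq_0_iff not_le intro: add_nonneg_pos)
      then show "(\<integral>\<^sup>+t\<in>{0..}. ennreal ((norm (x i0 t - least_squares H z))\<^sup>2) \<partial>lebesgue)
        \<le> ennreal (K' * M + 1) * I + ennreal (K' * (1 + M))"
        unfolding top by (simp add: ennreal_mult_top)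
    next
      case (real W)
      have lw: "lbm w"
        using w unfolding locally_bounded_measurable_def
        by (auto intro: bounded_subset)
      have lw2: "lbm (\<lambda>t. (norm (w t))\<^sup>2)" by (intro lbm_power2 lbm_norm lw)
      have lwi: "lbm (\<lambda>t. w t $ i)" for i
        by (rule lbm_bounded_linear[OF bounded_linear_vec_nth lw])
      have W: "integral {0..T} (\<lambda>t. (norm (w t))\<^sup>2) \<le> W" for T
      proof -
        have "ennreal (integral {0..T} (\<lambda>t. (norm (w t))\<^sup>2)) = (\<integral>\<^sup>+t\<in>{0..T}. ennreal ((norm (w t))\<^sup>2) \<partial>lebesgue)"
          by (rule nn_integral_Icc_lbm[OF lw2, symmetric]) simp
        also have "\<dots> \<le> I" unfolding I_def
          by (intro nn_integral_mono) (auto split: split_indicator)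
        finally show ?thesis using real by simp
      qed
      have Wi: "\<forall>T\<ge>0. integral {0..T} (\<lambda>t. (w t $ i)\<^sup>2) \<le> W" for i
      proof (intro allI impI)
        fix T :: real assume "0 \<le> T"
        have "(w t $ i)\<^sup>2 \<le> (norm (w t))\<^sup>2" for t
          using power_mono[OF component_le_norm_cart[of "w t" i], of 2] by simp
        then have "integral {0..T} (\<lambda>t. (w t $ i)\<^sup>2) \<le> integral {0..T} (\<lambda>t. (norm (w t))\<^sup>2)"
          by (intro integral_mono_lbm lbm_power2 lwi lw2) auto
        then show "integral {0..T} (\<lambda>t. (w t $ i)\<^sup>2) \<le> W" using W[of T] by linarith
      qed
      have "\<exists>u. lbm u \<and> (\<forall>T\<ge>0. integral {0..T} (\<lambda>t. (u t)\<^sup>2) \<le> Kn i * (1 + W)) \<and>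
        (\<forall>t\<ge>0. u t = compensation (k i) (\<alpha>f i) (\<beta>f i) (\<omega>h i t) (\<eta> i t) - ?y w i t + z $ i)" for i
        by (rule node_gainD[OF Kn[THEN spec, THEN conjunct2, unfolded G_def] lwi Wi tr_\<eta> tr_filter tr_\<alpha> est[THEN spec]])
      then have "\<forall>i. \<exists>u. lbm u \<and> (\<forall>T\<ge>0. integral {0..T} (\<lambda>t. (u t)\<^sup>2) \<le> Kn i * (1 + W)) \<and>
        (\<forall>t\<ge>0. u t = compensation (k i) (\<alpha>f i) (\<beta>f i) (\<omega>h i t) (\<eta> i t) - ?y w i t + z $ i)" ..
      then obtain u where u0: "\<forall>i. lbm (u i) \<and> (\<forall>T\<ge>0. integral {0..T} (\<lambda>t. (u i t)\<^sup>2) \<le> Kn i * (1 + W)) \<and>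
        (\<forall>t\<ge>0. u i t = compensation (k i) (\<alpha>f i) (\<beta>f i) (\<omega>h i t) (\<eta> i t) - ?y w i t + z $ i)"
        by (rule choice[THEN exE])
      note u = u0[THEN spec, THEN conjunct1] u0[THEN spec, THEN conjunct2, THEN conjunct1, rule_format]
        u0[THEN spec, THEN conjunct2, THEN conjunct2, rule_format]
      let ?fx = "\<lambda>i t. - \<kappa>\<^sub>1 *\<^sub>R ((inner (H $ i) (x i t) - z $ i + u i t) *\<^sub>R (H $ i))
            - (\<kappa>\<^sub>1 + \<kappa>\<^sub>2) *\<^sub>R lap a (\<lambda>j. x j t) i - lap a (\<lambda>j. v j t) i"
      let ?fv = "\<lambda>i t. (\<kappa>\<^sub>1 * \<kappa>\<^sub>2) *\<^sub>R lap a (\<lambda>j. x j t) i"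
      have sv: "solution (?fv i) (v0 i) (v i)" for i
        using tv[of i] by (simp add: lap_def)
      \<comment> \<open>Filter, identifier and compensator disappear from the equation of
        \<open>x\<close> here; only \<open>u\<close> is left of them.\<close>
      have sx: "solution (?fx i) (x0 i) (x i)" for i
        by (rule iffD1[OF solution_cong tx[of i]]) (simp_all add: u(3) lap_def)
      have lx: "lbm (x i)" and lv: "lbm (v i)" for i
        using solution_lbm[OF sx] solution_lbm[OF sv] by blast+
      have px: "primitive (?fx i) (x i)" and pv: "primitive (?fv i) (v i)" for i
        by (rule solution_primitive[OF sx] solution_primitive[OF sv];
            unfold lap_def; intro lbm_intros lx lv u(1))+
      have uM: "\<forall>i. \<forall>T\<ge>0. integral {0..T} (\<lambda>t. (u i t)\<^sup>2) \<le> M * (1 + W)"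
      proof (intro allI impI)
        fix i and T :: real assume T: "0 \<le> T"
        have "Kn i * (1 + W) \<le> M * (1 + W)" using M(2) real by (intro mult_right_mono) auto
        then show "integral {0..T} (\<lambda>t. (u i t)\<^sup>2) \<le> M * (1 + W)" using u(2)[OF T, of i] by linarith
      qed
      have "\<forall>i. x i 0 = x0 i" "\<forall>i. v i 0 = v0 i"
        by (intro allI solution_initial[OF sx] solution_initial[OF sv])+
      from K[unfolded network_gain_def, THEN spec, THEN spec, THEN spec, THEN spec, THEN mp, THEN mp, THEN mp,
          THEN mp, THEN mp, THEN mp, THEN spec, THEN spec, THEN mp, OF allI[OF px] allI[OF pv] this allI[OF u(1)] uM]
      have "integral {0..T} (\<lambda>t. (norm (x i0 t - least_squares H z))\<^sup>2) \<le> K * (1 + M * (1 + W))" if "0 \<le> T" for T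
        using that .
      then have "(\<integral>\<^sup>+t\<in>{0..}. ennreal ((norm (x i0 t - least_squares H z))\<^sup>2) \<partial>lebesgue)
          \<le> ennreal (K * (1 + M * (1 + W)))"
        by (intro nn_integral_Ici_le lbm_power2 lbm_norm lbm_diff lx lbm_const) auto
      also have "\<dots> \<le> ennreal ((K' * M + 1) * W + K' * (1 + M))"
      proof (rule ennreal_leI)
        have "0 \<le> 1 + M * (1 + W)" using M(1) real by simp
        then have "K * (1 + M * (1 + W)) \<le> K' * (1 + M * (1 + W))" by (rule mult_right_mono[OF K'(2)])
        then show "K * (1 + M * (1 + W)) \<le> (K' * M + 1) * W + K' * (1 + M)"
          using real by (simp add: algebra_simps)
      qed
      also have "\<dots> = ennreal (K' * M + 1) * I + ennreal (K' * (1 + M))"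
        using K' M(1) real by (simp add: ennreal_plus ennreal_mult)
      finally show "(\<integral>\<^sup>+t\<in>{0..}. ennreal ((norm (x i0 t - least_squares H z))\<^sup>2) \<partial>lebesgue)
        \<le> ennreal (K' * M + 1) * I + ennreal (K' * (1 + M))" .
    qed
  qed
qed

end
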